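(* Let $d_0>2$ and let $\alpha\in(0,1)$ be an irrational number whose Liouville--Roth irrationality measure is strictly smaller than $d_0$. For each $n$ let $\mathbf{G}_n^1,\mathbf{G}_n^2$ be independent samples of $G(n,n^{-\alpha})$. Then with probability tending to $1$ as $n\to\infty$, $k(\mathbf{G}_n^1,\mathbf{G}_n^2)\ge \frac{1}{\ln d_0}\ln\ln\ln n$. In particular, for Lebesgue-almost every irrational $\alpha\in(0,1)$, with probability tending to $1$, $k(\mathbf{G}_n^1,\mathbf{G}_n^2)\ge \frac{1-o(1)}{\ln 2}\ln\ln\ln n$.
   Context: Graphs are finite simple graphs; the first order (FO) language of graphs has the adjacency and equality relations. The FO distinguishability $k(G_1,G_2)$ is the minimum quantifier depth of a FO sentence that holds in exactly one of $G_1,G_2$. $G(n,p)$ is the random graph on $[n]$ in which each pair is an edge independently with probability $p$. The Liouville--Roth irrationality measure of an irrational $\alpha$ is the infimum (possibly $+\infty$) of the set of $d>0$ such that only finitely many pairs of integers $p,q$ (with $q>0$) satisfy $|\alpha-p/q|\le q^{-d}$. *)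

theory Defs
  imports "HOL-Probability.Probability"
begin

text \<open>A graph is a pair (vertex set, edge set); edges are two-element sets of vertices.\<close>

type_synonym 'v graph = "'v set \<times> 'v set set"

definition finite_simple_graph :: "'v graph \<Rightarrow> bool" where
  "finite_simple_graph G \<longleftrightarrow>
     finite (fst G) \<and> (\<forall>e \<in> snd G. e \<subseteq> fst G \<and> card e = 2)"

text \<open>The remaining connectives and the universal quantifier are expressed through \<open>Neg\<close>, \<open>Conj\<close>
  and \<open>Exi\<close> in the usual way, which does not affect the quantifier depth.\<close>

datatype fo =
    Eql nat nat
  | Adj nat nat
  | Neg fo
  | Conj fo fo
  | Exi nat fo

primrec free_vars :: "fo \<Rightarrow> nat set" where
  "free_vars (Eql x y) = {x, y}"
| "free_vars (Adj x y) = {x, y}"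
| "free_vars (Neg \<phi>) = free_vars \<phi>"
| "free_vars (Conj \<phi> \<psi>) = free_vars \<phi> \<union> free_vars \<psi>"
| "free_vars (Exi x \<phi>) = free_vars \<phi> - {x}"

definition sentence :: "fo \<Rightarrow> bool" where
  "sentence \<phi> \<longleftrightarrow> free_vars \<phi> = {}"

primrec qdepth :: "fo \<Rightarrow> nat" where
  "qdepth (Eql x y) = 0"
| "qdepth (Adj x y) = 0"
| "qdepth (Neg \<phi>) = qdepth \<phi>"
| "qdepth (Conj \<phi> \<psi>) = max (qdepth \<phi>) (qdepth \<psi>)"
| "qdepth (Exi x \<phi>) = Suc (qdepth \<phi>)"

primrec sat :: "'v graph \<Rightarrow> (nat \<Rightarrow> 'v) \<Rightarrow> fo \<Rightarrow> bool" where
  "sat G \<sigma> (Eql x y) \<longleftrightarrow> \<sigma> x = \<sigma> y"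
| "sat G \<sigma> (Adj x y) \<longleftrightarrow> {\<sigma> x, \<sigma> y} \<in> snd G"
| "sat G \<sigma> (Neg \<phi>) \<longleftrightarrow> \<not> sat G \<sigma> \<phi>"
| "sat G \<sigma> (Conj \<phi> \<psi>) \<longleftrightarrow> sat G \<sigma> \<phi> \<and> sat G \<sigma> \<psi>"
| "sat G \<sigma> (Exi x \<phi>) \<longleftrightarrow> (\<exists>v \<in> fst G. sat G (\<sigma>(x := v)) \<phi>)"

text \<open>Only used for sentences, whose truth value does not depend on the assignment
  (see \<open>holds_iff_sat\<close> below).\<close>

definition holds :: "'v graph \<Rightarrow> fo \<Rightarrow> bool" where
  "holds G \<phi> \<longleftrightarrow> (\<forall>\<sigma>. sat G \<sigma> \<phi>)"

lemma sat_cong_free_vars: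
  "(\<And>x. x \<in> free_vars \<phi> \<Longrightarrow> \<sigma> x = \<tau> x) \<Longrightarrow> sat G \<sigma> \<phi> = sat G \<tau> \<phi>"
proof (induction \<phi> arbitrary: \<sigma> \<tau>)
  case (Neg \<phi>)
  have "sat G \<sigma> \<phi> = sat G \<tau> \<phi>" by (rule Neg.IH) (simp add: Neg.prems)
  then show ?case by simp
next
  case (Conj \<phi> \<psi>)
  have "sat G \<sigma> \<phi> = sat G \<tau> \<phi>" by (rule Conj.IH) (simp add: Conj.prems)
  moreover have "sat G \<sigma> \<psi> = sat G \<tau> \<psi>" by (rule Conj.IH) (simp add: Conj.prems)
  ultimately show ?case by simp
next
  case (Exi x \<phi>)
  have "sat G (\<sigma>(x := v)) \<phi> = sat G (\<tau>(x := v)) \<phi>" for v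
    by (rule Exi.IH) (simp add: Exi.prems)
  then show ?case by simp
qed simp_all

lemma holds_iff_sat: "sentence \<phi> \<Longrightarrow> holds G \<phi> \<longleftrightarrow> sat G \<sigma> \<phi>"
  unfolding holds_def sentence_def by (metis empty_iff sat_cong_free_vars)

text \<open>The minimum over the empty set, which occurs for graphs that no sentence distinguishes,
  is \<open>\<infinity>\<close>.\<close>

definition fo_distinguishability :: "'v graph \<Rightarrow> 'w graph \<Rightarrow> enat" where
  "fo_distinguishability G H =
     Inf {enat (qdepth \<phi>) | \<phi>. sentence \<phi> \<and> holds G \<phi> \<noteq> holds H \<phi>}"

definition vertex_pairs :: "nat \<Rightarrow> nat set set" where
  "vertex_pairs n = {e. e \<subseteq> {1..n} \<and> card e = 2}"

definition random_graph :: "nat \<Rightarrow> real \<Rightarrow> nat graph pmf" where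
  "random_graph n p =
     map_pmf (\<lambda>X. ({1..n}, {e \<in> vertex_pairs n. X e}))
       (Pi_pmf (vertex_pairs n) False (\<lambda>_. bernoulli_pmf p))"

lemma set_pmf_random_graph:
  "G \<in> set_pmf (random_graph n p) \<Longrightarrow> finite_simple_graph G \<and> fst G = {1..n}"
  by (force simp: random_graph_def finite_simple_graph_def vertex_pairs_def)

definition irrationality_measure :: "real \<Rightarrow> ereal" where
  "irrationality_measure \<alpha> =
     Inf {ereal d | d :: real. d > 0 \<and>
       finite {(p :: int, q :: int). q > 0 \<and>
         \<bar>\<alpha> - real_of_int p / real_of_int q\<bar> \<le> real_of_int q powr (- d)}}"

end

theory Submission
  imports Defs "HOL-Real_Asymp.Real_Asymp"
begin

text \<open>
  Give a vertex set \<open>D\<close> added to \<open>A\<close> the weight \<open>|D| - \<alpha> e\<close>, where \<open>e\<close> counts the new edges, and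
  call \<open>A\<close> closed at scale \<open>t\<close> if no nonempty \<open>D\<close> with \<open>|D| \<le> t\<close> has weight \<open>\<le> 0\<close>. As in the
  Shelah--Spencer zero-one law, Duplicator survives the Ehrenfeucht game by keeping the chosen
  points inside isomorphic closed sets, with a scale \<open>t\<^sub>j\<close> that shrinks as the number \<open>j\<close> of remaining
  rounds does.

  The irrationality measure keeps weights of sets of size \<open>t\<close> away from \<open>0\<close> by \<open>c t\<^sup>1\<^sup>-\<^sup>d\<close> with
  \<open>d < d\<^sub>0\<close>. Closing up \<open>k\<close> points at scale \<open>t\<close> then needs only \<open>O(k t\<^sup>d)\<close> vertices, so the scales can
  be chosen with \<open>t\<^sub>k \<le> (C k)\<close> to the power \<open>d\<^sup>k\<close>, which is \<open>(ln n)\<^sup>o\<^sup>(\<^sup>1\<^sup>)\<close> when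
  \<open>k \<le> ln ln ln n / ln d\<^sub>0\<close>.

  It remains to see that with high probability every closed set \<open>R\<close> of size \<open>\<tau> = (ln n)\<^sup>o\<^sup>(\<^sup>1\<^sup>)\<close> has a closed
  copy of every admissible extension. There are \<open>n\<close> to the power \<open>O(\<tau>)\<close> cases, so a
  second moment bound is not enough; it is amplified by looking for the extension in \<open>2b\<close> disjoint
  families of vertex blocks. Too few copies in a family is an event of small probability, and these
  events are independent. Too many spoiled copies in many families at once is excluded by a joint
  moment of order up to \<open>2b\<close>, where closedness of \<open>R\<close> makes overlaps of the witnesses harmless.
\<close>

section \<open>Closed sets and the Ehrenfeucht game\<close>

text \<open>Why the base \<open>d\<^sub>0\<close>: \<open>k\<close> points have weight at most
  \<open>k\<close>, each dense extension at scale \<open>t\<close> costs at least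
  \<open>\<delta> = c t\<close> to the power \<open>1-d\<close> in weight and adds at most
  \<open>t\<close> vertices, so a closure has about \<open>k t / \<delta>\<close> vertices, which is
  \<open>k/c\<close> times the \<open>d\<close>-th power of \<open>t\<close>. Every round thus
  raises the scale to the power \<open>d\<close>. The room between \<open>d\<close> and
  \<open>d\<^sub>0\<close> makes the \<open>k\<close>-th power of \<open>d\<close> at most a power
  of \<open>ln ln n\<close> with exponent below 1, which also pays for the factors depending on
  \<open>k\<close> and for any fixed power of \<tau>. How small \<tau> must be: beating n to the
  power 3\<tau> patterns takes b of order \<tau>/\<delta> families, and the combinatorial factors, 2
  to the power O(b \<tau>^2), must stay below n to the power \<delta>/2. This bounds the power 2d+1
  of \<tau> by a constant times ln n. Spoiled copies in different families are dependent, because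
  the vertices that spoil a copy may lie anywhere; hence a joint moment for them, whereas the
  required edges of the copies sit in disjoint edge sets.\<close>

definition ext_edges :: "'v set set \<Rightarrow> 'v set \<Rightarrow> 'v set \<Rightarrow> 'v set set" where
  "ext_edges E A B = {e \<in> E. e \<subseteq> B \<and> \<not> e \<subseteq> A}"

definition t_closed :: "real \<Rightarrow> 'v graph \<Rightarrow> nat \<Rightarrow> 'v set \<Rightarrow> bool" where
  "t_closed \<alpha> G t A \<longleftrightarrow>
     (\<forall>D. D \<subseteq> fst G - A \<and> D \<noteq> {} \<and> card D \<le> t \<longrightarrow>
        \<alpha> * card (ext_edges (snd G) A (A \<union> D)) < card D)"

lemma t_closed_mono: "t_closed \<alpha> G t A \<Longrightarrow> s \<le> t \<Longrightarrow> t_closed \<alpha> G s A"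
  unfolding t_closed_def by (meson order_trans)

lemma finite_simple_graph_finite_edges:
  assumes "finite_simple_graph G" shows "finite (snd G)"
proof (rule finite_subset)
  show "snd G \<subseteq> Pow (fst G)" using assms by (auto simp: finite_simple_graph_def)
  show "finite (Pow (fst G))" using assms by (simp add: finite_simple_graph_def)
qed

lemma finite_ext_edges: "finite E \<Longrightarrow> finite (ext_edges E A B)"
  by (simp add: ext_edges_def)

text \<open>Each dense extension by at most \<open>u\<close> vertices lowers the weight by at least \<open>\<delta>\<close>, while the
  weight of a small set stays nonnegative; so after boundedly many extensions the set is closed.\<close>

lemma t_closed_superset_exists:
  fixes G :: "'v graph"
  assumes G: "finite_simple_graph G" and s: "t_closed \<alpha> G s {}" and \<alpha>: "\<alpha> > 0"
    and A: "A \<subseteq> fst G" and u: "u \<ge> 1" and \<delta>: "\<delta> > 0"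
    and gap: "\<And>v e :: nat. v \<le> u \<Longrightarrow> (v, e) \<noteq> (0, 0) \<Longrightarrow> \<delta> \<le> \<bar>real v - \<alpha> * real e\<bar>"
    and su: "real (card A) * (1 + real u / \<delta>) + real u \<le> real s"
  obtains Y where "A \<subseteq> Y" "Y \<subseteq> fst G" "t_closed \<alpha> G u Y"
    "real (card Y) \<le> real (card A) * (1 + real u / \<delta>)"
proof -
  have finV: "finite (fst G)" using G by (simp add: finite_simple_graph_def)
  have finE: "finite (snd G)" using G by (rule finite_simple_graph_finite_edges)
  \<comment> \<open>Instead of counting steps, the loss of \<delta> per step is spread over the at
    most \<open>u\<close> vertices it adds: at least \<delta>/u per vertex. The budget is then a
    property of \<open>Y\<close> alone, and a \<open>Y\<close> of maximal size replaces the
    iteration.\<close>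
  define P where "P Y \<longleftrightarrow> A \<subseteq> Y \<and> Y \<subseteq> fst G \<and> card Y \<le> s \<and>
    real (card Y) - \<alpha> * card (ext_edges (snd G) {} Y) \<le>
      card A - \<delta> * (real (card Y) - card A) / u" for Y
  have cA: "real (card A) \<le> real (card A) * (1 + real u / \<delta>)"
    using \<delta> by (simp add: algebra_simps)
  have bound: "real (card Y) \<le> real (card A) * (1 + real u / \<delta>)" if "P Y" for Y
  proof -
    have "0 \<le> real (card Y) - \<alpha> * card (ext_edges (snd G) {} Y)"
    proof (cases "Y = {}")
      case True
      have "ext_edges (snd G) {} Y = {}" by (auto simp: ext_edges_def True)
      then show ?thesis by simp
    next
      case False
      then show ?thesis
        using s[unfolded t_closed_def, rule_format, of Y] that by (simp add: P_def)
    qed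
    then have "\<delta> * (real (card Y) - card A) / u \<le> card A" using that unfolding P_def by linarith
    then show ?thesis using \<delta> u by (simp add: field_simps)
  qed
  have "P A"
    using A cA su \<alpha> by (simp add: P_def)
  moreover have fin: "finite {Y. P Y}"
    by (rule finite_subset[of _ "Pow (fst G)"]) (auto simp: P_def finV)
  ultimately obtain Y where Y: "P Y" and max: "\<And>Z. P Z \<Longrightarrow> card Z \<le> card Y"
    using finite_has_maximal[of "card ` {Y. P Y}"] by (auto, metis linorder_linear)
  have YV: "Y \<subseteq> fst G" and finY: "finite Y" using Y finV finite_subset by (auto simp: P_def)
  have "t_closed \<alpha> G u Y"
  proof (rule ccontr)
    assume "\<not> t_closed \<alpha> G u Y"
    then obtain D where D: "D \<subseteq> fst G - Y" "D \<noteq> {}" "card D \<le> u"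
      and le: "real (card D) \<le> \<alpha> * card (ext_edges (snd G) Y (Y \<union> D))"
      unfolding t_closed_def by (auto simp: not_less)
    have finD: "finite D" using D finV finite_subset by blast
    have cD: "card D > 0" using D finD by (simp add: card_gt_0_iff)
    have "\<delta> \<le> \<bar>real (card D) - \<alpha> * card (ext_edges (snd G) Y (Y \<union> D))\<bar>"
      using gap[of "card D"] D cD by auto
    then have w1: "real (card D) - \<alpha> * card (ext_edges (snd G) Y (Y \<union> D)) \<le> - \<delta>"
      using le by linarith
    have eq: "ext_edges (snd G) {} (Y \<union> D) = ext_edges (snd G) {} Y \<union> ext_edges (snd G) Y (Y \<union> D)"
      by (auto simp: ext_edges_def)
    have "card (ext_edges (snd G) {} (Y \<union> D)) =
        card (ext_edges (snd G) {} Y) + card (ext_edges (snd G) Y (Y \<union> D))"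
      unfolding eq by (rule card_Un_disjoint) (auto simp: finite_ext_edges finE, auto simp: ext_edges_def)
    moreover have cU: "card (Y \<union> D) = card Y + card D"
      using D finY finD by (intro card_Un_disjoint) auto
    moreover have "\<delta> * card D / u \<le> \<delta>" using D u \<delta> by (simp add: field_simps)
    ultimately have "real (card (Y \<union> D)) - \<alpha> * card (ext_edges (snd G) {} (Y \<union> D))
        \<le> card A - \<delta> * (real (card (Y \<union> D)) - card A) / u"
      using w1 Y unfolding P_def by (simp add: algebra_simps add_divide_distrib diff_divide_distrib)
    \<comment> \<open>The summand \<open>u\<close> in \<open>su\<close> is reserved for this last
      extension, which must still lie within the scale at which weights are known to be
      nonnegative.\<close>
    moreover have "card (Y \<union> D) \<le> s"
      using bound[OF Y] su D(3) cU by linarith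
    ultimately have "P (Y \<union> D)" using Y D by (auto simp: P_def)
    from max[OF this] cU cD show False by simp
  qed
  with that Y bound[OF Y] show thesis by (auto simp: P_def)
qed

text \<open>The pattern \<open>L\<close>, \<open>W\<close>, \<open>F\<close> comes from one graph
  and is realised in the other, over the image of \<open>L\<close>. Edges inside \<open>L\<close> do
  not enter, so \<open>f\<close> is only an injection; that it is an isomorphism is the business of
  the game. Drawing the labels from \<open>{1..n}\<close> keeps the number of patterns finite for
  the union bound. The image of \<open>L\<close> must be closed at scale \<open>card W + u\<close>
  to leave scale \<open>u\<close> after \<open>card W\<close> vertices are spent.\<close>

definition extension_property :: "real \<Rightarrow> nat \<Rightarrow> nat \<Rightarrow> nat graph \<Rightarrow> bool" where
  "extension_property \<alpha> \<tau> n G \<longleftrightarrow>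
    (\<forall>L W F f u. L \<subseteq> {1..n} \<and> W \<subseteq> {1..n} \<and> L \<inter> W = {} \<and> card L \<le> \<tau> \<and> card W + u \<le> \<tau> \<and>
      (\<forall>e\<in>F. e \<subseteq> L \<union> W \<and> card e = 2 \<and> \<not> e \<subseteq> L) \<and>
      inj_on f L \<and> f ` L \<subseteq> {1..n} \<and>
      t_closed \<alpha> G (card W + u) (f ` L) \<and>
      (\<forall>S. S \<subseteq> W \<and> S \<noteq> {} \<longrightarrow> \<alpha> * card {e \<in> F. e \<subseteq> L \<union> S} < card S) \<longrightarrow>
      (\<exists>g. (\<forall>x\<in>L. g x = f x) \<and> inj_on g (L \<union> W) \<and> g ` (L \<union> W) \<subseteq> {1..n} \<and>
        (\<forall>x\<in>W. \<forall>y\<in>L \<union> W. {g x, g y} \<in> snd G \<longleftrightarrow> {x, y} \<in> F) \<and>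
        t_closed \<alpha> G u (g ` (L \<union> W))))"

definition good_graph :: "real \<Rightarrow> nat \<Rightarrow> nat \<Rightarrow> nat graph \<Rightarrow> bool" where
  "good_graph \<alpha> \<tau> n G \<longleftrightarrow> finite_simple_graph G \<and> fst G = {1..n} \<and>
     t_closed \<alpha> G \<tau> {} \<and> extension_property \<alpha> \<tau> n G"

text \<open>\<open>A\<close> contains the chosen points but may be larger: closedness has to hold on
  a whole set, and the bound by \<tau> lets \<open>A\<close> serve as the base \<open>L\<close> of
  an extension.\<close>

definition ef_invariant ::
  "real \<Rightarrow> nat \<Rightarrow> nat graph \<Rightarrow> nat graph \<Rightarrow> nat \<Rightarrow> nat set \<Rightarrow> (nat \<Rightarrow> nat) \<Rightarrow> (nat \<Rightarrow> nat) \<Rightarrow> bool" where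
  "ef_invariant \<alpha> \<tau> G H t X \<sigma> \<rho> \<longleftrightarrow> (\<exists>A f. A \<subseteq> fst G \<and> card A \<le> \<tau> \<and> inj_on f A \<and> f ` A \<subseteq> fst H \<and>
     (\<forall>x\<in>A. \<forall>y\<in>A. {x, y} \<in> snd G \<longleftrightarrow> {f x, f y} \<in> snd H) \<and>
     t_closed \<alpha> G t A \<and> t_closed \<alpha> H t (f ` A) \<and>
     (\<forall>x\<in>X. \<sigma> x \<in> A \<and> \<rho> x = f (\<sigma> x)))"

lemma ef_invariant_sym:
  assumes "ef_invariant \<alpha> \<tau> G H t X \<sigma> \<rho>"
  shows "ef_invariant \<alpha> \<tau> H G t X \<rho> \<sigma>"
proof -
  obtain A f where A: "A \<subseteq> fst G" "card A \<le> \<tau>" and f: "inj_on f A" "f ` A \<subseteq> fst H"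
    and iso: "\<forall>x\<in>A. \<forall>y\<in>A. {x, y} \<in> snd G \<longleftrightarrow> {f x, f y} \<in> snd H"
    and cl: "t_closed \<alpha> G t A" "t_closed \<alpha> H t (f ` A)" and X: "\<forall>x\<in>X. \<sigma> x \<in> A \<and> \<rho> x = f (\<sigma> x)"
    using assms unfolding ef_invariant_def by blast
  let ?g = "the_inv_into A f"
  have gf: "?g (f x) = x" if "x \<in> A" for x using f that by (simp add: the_inv_into_f_f)
  have gA: "?g ` f ` A = A" using gf by force
  show ?thesis
    unfolding ef_invariant_def
  proof (intro exI[of _ "f ` A"] exI[of _ ?g] conjI)
    show "card (f ` A) \<le> \<tau>" using A f by (simp add: card_image)
    show "inj_on ?g (f ` A)" using f by (simp add: inj_on_the_inv_into)
    show "\<forall>x\<in>f ` A. \<forall>y\<in>f ` A. {x, y} \<in> snd H \<longleftrightarrow> {?g x, ?g y} \<in> snd G"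
      using iso gf by simp
    show "\<forall>x\<in>X. \<rho> x \<in> f ` A \<and> \<sigma> x = ?g (\<rho> x)" using X gf by simp
  qed (use A f cl gA in simp_all)
qed

text \<open>Weights are subadditive along \<open>D\<close>: the part of \<open>D\<close> inside the
  image of \<open>B\<close> pulls back to \<open>G\<close>, where \<open>Y\<close> is closed, and
  the rest is weighed over the whole image of \<open>B\<close>, where it can only see more edges
  than over the image of \<open>Y\<close>. Both parts have positive weight when nonempty.\<close>

lemma t_closed_image_of_closed:
  fixes G :: "'v graph" and H :: "'w graph"
  assumes G: "finite_simple_graph G" and H: "finite_simple_graph H" and \<alpha>: "\<alpha> > 0"
    and Y: "Y \<subseteq> B" and B: "B \<subseteq> fst G" and g: "inj_on g B"
    and iso: "\<And>x y. x \<in> B \<Longrightarrow> y \<in> B \<Longrightarrow> {x, y} \<in> snd G \<longleftrightarrow> {g x, g y} \<in> snd H"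
    and clY: "t_closed \<alpha> G u Y" and clB: "t_closed \<alpha> H u (g ` B)"
  shows "t_closed \<alpha> H u (g ` Y)"
  unfolding t_closed_def
proof (intro allI impI, elim conjE)
  fix D assume D: "D \<subseteq> fst H - g ` Y" "D \<noteq> {}" "card D \<le> u"
  have finH: "finite (snd H)" and finG: "finite (snd G)"
    by (rule finite_simple_graph_finite_edges, fact)+
  have finD: "finite D"
    using D H by (meson Diff_subset finite_simple_graph_def finite_subset order_trans)
  define S where "S = {x \<in> B. g x \<in> D}"
  define D2 where "D2 = D - g ` B"
  have SB: "S \<subseteq> fst G - Y" using D B by (auto simp: S_def)
  have D1: "D \<inter> g ` B = g ` S" by (auto simp: S_def)
  have cD: "card D = card S + card D2"
  proof -
    have "card D = card (D \<inter> g ` B) + card D2"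
      unfolding D2_def using finD by (metis card_Int_Diff)
    moreover have "card (g ` S) = card S"
      using g by (intro card_image) (auto simp: S_def inj_on_def)
    ultimately show ?thesis using D1 by simp
  qed
  let ?E1 = "ext_edges (snd H) (g ` Y) (g ` (Y \<union> S))"
  let ?E2 = "ext_edges (snd H) (g ` B) (g ` B \<union> D2)"
  have sub: "ext_edges (snd H) (g ` Y) (g ` Y \<union> D) \<subseteq> ?E1 \<union> ?E2"
  proof
    fix e assume e: "e \<in> ext_edges (snd H) (g ` Y) (g ` Y \<union> D)"
    show "e \<in> ?E1 \<union> ?E2"
    proof (cases "e \<subseteq> g ` B")
      case True
      then have "e \<subseteq> g ` Y \<union> (D \<inter> g ` B)" using e by (auto simp: ext_edges_def)
      then have "e \<subseteq> g ` (Y \<union> S)" unfolding D1 image_Un .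
      then show ?thesis using e by (simp add: ext_edges_def)
    next
      case False
      have "e \<subseteq> g ` Y \<union> D" using e by (simp add: ext_edges_def)
      then have "e \<subseteq> g ` B \<union> D2" using Y unfolding D2_def by blast
      then show ?thesis using e False by (simp add: ext_edges_def)
    qed
  qed
  have "?E1 \<subseteq> (`) g ` ext_edges (snd G) Y (Y \<union> S)"
  proof
    fix e assume e: "e \<in> ?E1"
    then have "card e = 2" "e \<subseteq> g ` (Y \<union> S)" "\<not> e \<subseteq> g ` Y" "e \<in> snd H"
      using H by (auto simp: ext_edges_def finite_simple_graph_def)
    then obtain z w where "e = {z, w}" "z \<in> g ` (Y \<union> S)" "w \<in> g ` (Y \<union> S)"
      by (metis card_2_iff insert_subset)
    then obtain x y where xy: "x \<in> Y \<union> S" "y \<in> Y \<union> S" "e = {g x, g y}" by blast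
    then have "{x, y} \<in> ext_edges (snd G) Y (Y \<union> S)"
      using iso[of x y] Y \<open>e \<in> snd H\<close> \<open>\<not> e \<subseteq> g ` Y\<close> by (auto simp: ext_edges_def S_def)
    moreover have "e = g ` {x, y}" using xy by simp
    ultimately show "e \<in> (`) g ` ext_edges (snd G) Y (Y \<union> S)" by (rule rev_image_eqI)
  qed
  then have c1: "card ?E1 \<le> card (ext_edges (snd G) Y (Y \<union> S))"
    by (rule surj_card_le[OF finite_ext_edges[OF finG]])
  have w1: "\<alpha> * card (ext_edges (snd G) Y (Y \<union> S)) < card S" if "S \<noteq> {}"
    using clY[unfolded t_closed_def, rule_format, of S] SB that D(3) cD by simp
  have w1': "\<alpha> * card (ext_edges (snd G) Y (Y \<union> S)) \<le> card S"
  proof (cases "S = {}")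
    case True
    then have "ext_edges (snd G) Y (Y \<union> S) = {}" by (auto simp: ext_edges_def)
    then show ?thesis by simp
  qed (use w1 in auto)
  have w2: "\<alpha> * card ?E2 < card D2" if "D2 \<noteq> {}"
    using clB[unfolded t_closed_def, rule_format, of D2] D that cD by (auto simp: D2_def)
  have w2': "\<alpha> * card ?E2 \<le> card D2"
  proof (cases "D2 = {}")
    case True
    then have "?E2 = {}" by (auto simp: ext_edges_def)
    then show ?thesis by simp
  qed (use w2 in auto)
  have ne: "S \<noteq> {} \<or> D2 \<noteq> {}" using D D1 by (auto simp: D2_def)
  have "card (ext_edges (snd H) (g ` Y) (g ` Y \<union> D)) \<le> card ?E1 + card ?E2"
    by (rule order_trans[OF card_mono[OF _ sub] card_Un_le]) (simp add: finite_ext_edges finH)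
  also have "\<dots> \<le> card (ext_edges (snd G) Y (Y \<union> S)) + card ?E2" using c1 by simp
  finally have "\<alpha> * card (ext_edges (snd H) (g ` Y) (g ` Y \<union> D))
      \<le> \<alpha> * card (ext_edges (snd G) Y (Y \<union> S)) + \<alpha> * card ?E2"
    using \<alpha> by (simp flip: distrib_left of_nat_add)
  also have "\<dots> < card S + card D2" using ne w1 w1' w2 w2' by (cases "S = {}") auto
  finally show "\<alpha> * card (ext_edges (snd H) (g ` Y) (g ` Y \<union> D)) < card D" using cD by simp
qed

text \<open>The closure \<open>Y\<close> of all chosen points is computed afresh in
  \<open>G\<close>, so its size depends on \<open>k\<close> and \<open>u\<close> only and does not
  accumulate over the rounds. \<open>A\<close> serves merely as the base over which
  \<open>Y - A\<close> is copied: closedness of \<open>A\<close> in \<open>G\<close> makes this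
  extension admissible, closedness of its image in \<open>H\<close> provides the copy. Then
  \<open>A\<close> is dropped, since \<open>A \<union> Y\<close> need not be closed in
  \<open>G\<close>.\<close>

lemma ef_invariant_step:
  assumes G: "good_graph \<alpha> \<tau> n G" and H: "good_graph \<alpha> \<tau> n H" and \<alpha>: "\<alpha> > 0"
    and inv: "ef_invariant \<alpha> \<tau> G H t X \<sigma> \<rho>" and v: "v \<in> fst G"
    and X: "finite X" "card X < k" and t: "t \<le> \<tau>" and u: "u \<ge> 1" and \<delta>: "\<delta> > 0"
    and gap: "\<And>v e :: nat. v \<le> u \<Longrightarrow> (v, e) \<noteq> (0, 0) \<Longrightarrow> \<delta> \<le> \<bar>real v - \<alpha> * real e\<bar>"
    and ku: "real k * (1 + real u / \<delta>) + real u \<le> real t"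
  shows "\<exists>w\<in>fst H. ef_invariant \<alpha> \<tau> G H u (insert x X) (\<sigma>(x := v)) (\<rho>(x := w))"
proof -
  have fsG: "finite_simple_graph G" "fst G = {1..n}" "t_closed \<alpha> G \<tau> {}"
    and fsH: "finite_simple_graph H" "fst H = {1..n}" "extension_property \<alpha> \<tau> n H"
    using G H by (auto simp: good_graph_def)
  obtain A f where A: "A \<subseteq> fst G" "card A \<le> \<tau>" and f: "inj_on f A" "f ` A \<subseteq> fst H"
    and iso: "\<forall>x\<in>A. \<forall>y\<in>A. {x, y} \<in> snd G \<longleftrightarrow> {f x, f y} \<in> snd H"
    and cl: "t_closed \<alpha> G t A" "t_closed \<alpha> H t (f ` A)" and XA: "\<forall>x\<in>X. \<sigma> x \<in> A \<and> \<rho> x = f (\<sigma> x)"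
    using inv unfolding ef_invariant_def by blast
  define a where "a = insert v (\<sigma> ` X)"
  have aV: "a \<subseteq> fst G" using XA A v by (auto simp: a_def)
  have "card a \<le> Suc (card (\<sigma> ` X))" by (simp add: a_def X card_insert_if)
  also have "\<dots> \<le> k" using X card_image_le[of X \<sigma>] by simp
  finally have ca: "card a \<le> k" .
  have ak: "real (card a) * (1 + real u / \<delta>) \<le> real k * (1 + real u / \<delta>)"
    using ca \<delta> by (intro mult_right_mono) auto
  have "real (card a) * (1 + real u / \<delta>) + real u \<le> real \<tau>"
    using ak ku t by linarith
  then obtain Y where Y: "a \<subseteq> Y" "Y \<subseteq> fst G" "t_closed \<alpha> G u Y"
    "real (card Y) \<le> real (card a) * (1 + real u / \<delta>)"
    using t_closed_superset_exists[OF fsG(1,3) \<alpha> aV u \<delta> gap] by blast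
  have finY: "finite Y" using Y fsG by (metis finite_atLeastAtMost finite_subset)
  have "real (card Y) + real u \<le> real t" using Y(4) ak ku by linarith
  then have cY: "card Y + u \<le> t" by linarith
  define W where "W = Y - A"
  define F where "F = ext_edges (snd G) A (A \<union> W)"
  have cW: "card W \<le> card Y" unfolding W_def using finY by (simp add: card_mono)
  have "\<exists>g. (\<forall>x\<in>A. g x = f x) \<and> inj_on g (A \<union> W) \<and> g ` (A \<union> W) \<subseteq> {1..n} \<and>
        (\<forall>x\<in>W. \<forall>y\<in>A \<union> W. {g x, g y} \<in> snd H \<longleftrightarrow> {x, y} \<in> F) \<and>
        t_closed \<alpha> H u (g ` (A \<union> W))"
  proof (rule fsH(3)[unfolded extension_property_def, rule_format], intro conjI allI impI)
    show "\<forall>e\<in>F. e \<subseteq> A \<union> W \<and> card e = 2 \<and> \<not> e \<subseteq> A"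
      using fsG(1) by (auto simp: F_def ext_edges_def finite_simple_graph_def)
    show "t_closed \<alpha> H (card W + u) (f ` A)"
      using cl(2) by (rule t_closed_mono) (use cW cY in linarith)
    fix S assume S: "S \<subseteq> W \<and> S \<noteq> {}"
    have "card S \<le> t" using S cW cY finY card_mono[of W S] by (auto simp: W_def)
    moreover have "{e \<in> F. e \<subseteq> A \<union> S} = ext_edges (snd G) A (A \<union> S)"
      using S by (auto simp: F_def ext_edges_def)
    moreover have "S \<subseteq> fst G - A" using S Y(2) by (auto simp: W_def)
    ultimately show "\<alpha> * card {e \<in> F. e \<subseteq> A \<union> S} < card S"
      using cl(1) S unfolding t_closed_def by auto
  next
    show "A \<subseteq> {1..n}" "card A \<le> \<tau>" "inj_on f A" "f ` A \<subseteq> {1..n}" using A f fsG(2) fsH(2) by simp_all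
    show "W \<subseteq> {1..n}" using Y(2) fsG(2) by (auto simp: W_def)
    show "A \<inter> W = {}" by (auto simp: W_def)
    show "card W + u \<le> \<tau>" using cW cY t by simp
  qed
  then obtain g where g: "\<forall>x\<in>A. g x = f x" "inj_on g (A \<union> W)" "g ` (A \<union> W) \<subseteq> {1..n}"
    "\<forall>x\<in>W. \<forall>y\<in>A \<union> W. {g x, g y} \<in> snd H \<longleftrightarrow> {x, y} \<in> F" "t_closed \<alpha> H u (g ` (A \<union> W))"
    by blast
  have isoF: "{x, y} \<in> snd G \<longleftrightarrow> {g x, g y} \<in> snd H" if xy: "x \<in> W" "y \<in> A \<union> W" for x y
    using g(4)[rule_format, OF xy] xy by (auto simp: F_def ext_edges_def W_def)
  have isoAW: "{x, y} \<in> snd G \<longleftrightarrow> {g x, g y} \<in> snd H" if "x \<in> A \<union> W" "y \<in> A \<union> W" for x y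
  proof -
    from that consider "x \<in> W" | "y \<in> W" | "x \<in> A" "y \<in> A" by blast
    then show ?thesis
    proof cases
      case 1 then show ?thesis using isoF that by blast
    next
      case 2 then show ?thesis using isoF[of y x] that by (simp add: insert_commute)
    next
      case 3 then show ?thesis using iso g(1) by simp
    qed
  qed
  have YAW: "Y \<subseteq> A \<union> W" by (auto simp: W_def)
  have AWV: "A \<union> W \<subseteq> fst G" using A Y by (auto simp: W_def)
  have "t_closed \<alpha> H u (g ` Y)"
    by (rule t_closed_image_of_closed[OF fsG(1) fsH(1) \<alpha> YAW AWV g(2) isoAW Y(3) g(5)])
  moreover have "inj_on g Y" using g(2) YAW by (rule inj_on_subset)
  moreover have "card Y \<le> \<tau>" using cY t by simp
  moreover have "\<forall>x\<in>Y. \<forall>y\<in>Y. {x, y} \<in> snd G \<longleftrightarrow> {g x, g y} \<in> snd H" using isoAW YAW by blast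
  moreover have "\<forall>z\<in>insert x X. (\<sigma>(x := v)) z \<in> Y \<and> (\<rho>(x := g v)) z = g ((\<sigma>(x := v)) z)"
    using Y(1) XA g(1) by (auto simp: a_def)
  moreover have "g ` Y \<subseteq> fst H" using g(3) YAW fsH(2) by auto
  ultimately have "ef_invariant \<alpha> \<tau> G H u (insert x X) (\<sigma>(x := v)) (\<rho>(x := g v))"
    unfolding ef_invariant_def using Y(2,3) by blast
  moreover have "g v \<in> fst H" using \<open>g ` Y \<subseteq> fst H\<close> Y(1) by (auto simp: a_def)
  ultimately show ?thesis by blast
qed

text \<open>With \<open>j\<close> rounds left, Duplicator maintains sets that are closed at scale \<open>t j\<close>.\<close>

locale ef_schedule =
  fixes \<alpha> :: real and \<tau> k :: nat and t :: "nat \<Rightarrow> nat" and \<delta> :: "nat \<Rightarrow> real"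
  assumes \<alpha>: "\<alpha> > 0"
    and t: "\<And>j. j \<le> k \<Longrightarrow> t j \<ge> 1 \<and> t j \<le> \<tau>" and \<delta>: "\<And>j. j < k \<Longrightarrow> \<delta> j > 0"
    and gap: "\<And>j v e :: nat. j < k \<Longrightarrow> v \<le> t j \<Longrightarrow> (v, e) \<noteq> (0, 0) \<Longrightarrow> \<delta> j \<le> \<bar>real v - \<alpha> * real e\<bar>"
    and kt: "\<And>j. j < k \<Longrightarrow> real k * (1 + real (t j) / \<delta> j) + real (t j) \<le> real (t (Suc j))"
begin

text \<open>\<open>X\<close> collects variables, so quantifying a variable again replaces its point.
  \<open>card X + j \<le> k\<close> guarantees that each closure is taken of at most
  \<open>k\<close> points, as the schedule assumes.\<close>

lemma ef_invariant_sat_iff: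
  assumes G: "good_graph \<alpha> \<tau> n G" and H: "good_graph \<alpha> \<tau> n H"
  shows "finite X \<Longrightarrow> free_vars \<phi> \<subseteq> X \<Longrightarrow> qdepth \<phi> \<le> j \<Longrightarrow> card X + j \<le> k \<Longrightarrow>
    ef_invariant \<alpha> \<tau> G H (t j) X \<sigma> \<rho> \<Longrightarrow> sat G \<sigma> \<phi> \<longleftrightarrow> sat H \<rho> \<phi>"
proof (induction \<phi> arbitrary: X j \<sigma> \<rho>)
  case (Eql x y)
  then show ?case unfolding ef_invariant_def by (auto simp: inj_on_def)
next
  case (Adj x y)
  then show ?case unfolding ef_invariant_def by auto
next
  case (Neg \<phi>)
  then show ?case by simp
next
  case (Conj \<phi> \<psi>)
  have "sat G \<sigma> \<phi> \<longleftrightarrow> sat H \<rho> \<phi>" by (rule Conj.IH) (use Conj.prems in auto)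
  moreover have "sat G \<sigma> \<psi> \<longleftrightarrow> sat H \<rho> \<psi>" by (rule Conj.IH) (use Conj.prems in auto)
  ultimately show ?case by simp
next
  case (Exi x \<phi>)
  from Exi.prems obtain i where j: "j = Suc i" by (cases j) auto
  have ci: "card (insert x X) + i \<le> k" using Exi.prems j by (simp add: card_insert_if)
  have cX: "card X < k" and ik: "i < k" and tk: "t (Suc i) \<le> \<tau>" "t i \<ge> 1" using Exi.prems j t by auto
  have fv: "free_vars \<phi> \<subseteq> insert x X" using Exi.prems by auto
  have IH: "ef_invariant \<alpha> \<tau> G H (t i) (insert x X) \<sigma>' \<rho>' \<Longrightarrow> sat G \<sigma>' \<phi> \<longleftrightarrow> sat H \<rho>' \<phi>" for \<sigma>' \<rho>'
    using Exi.IH[of "insert x X" i] Exi.prems fv ci j by auto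
  have inv: "ef_invariant \<alpha> \<tau> G H (t (Suc i)) X \<sigma> \<rho>" using Exi.prems j by simp
  have 1: "\<exists>w\<in>fst H. ef_invariant \<alpha> \<tau> G H (t i) (insert x X) (\<sigma>(x := v)) (\<rho>(x := w))"
    if "v \<in> fst G" for v
    using ef_invariant_step[OF G H \<alpha> inv that Exi.prems(1) cX tk \<delta>[OF ik] gap[OF ik] kt[OF ik]] .
  have 2: "\<exists>w\<in>fst G. ef_invariant \<alpha> \<tau> G H (t i) (insert x X) (\<sigma>(x := w)) (\<rho>(x := v))"
    if vH: "v \<in> fst H" for v
  proof -
    obtain w where "w \<in> fst G" "ef_invariant \<alpha> \<tau> H G (t i) (insert x X) (\<rho>(x := v)) (\<sigma>(x := w))"
      using ef_invariant_step[OF H G \<alpha> ef_invariant_sym[OF inv] vH Exi.prems(1) cX tk \<delta>[OF ik]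
          gap[OF ik] kt[OF ik]] by auto
    then show ?thesis by (blast dest: ef_invariant_sym)
  qed
  show ?case
  proof
    assume "sat G \<sigma> (Exi x \<phi>)"
    then obtain v where v: "v \<in> fst G" "sat G (\<sigma>(x := v)) \<phi>" by auto
    from 1[OF v(1)] IH v(2) show "sat H \<rho> (Exi x \<phi>)" by auto
  next
    assume "sat H \<rho> (Exi x \<phi>)"
    then obtain v where v: "v \<in> fst H" "sat H (\<rho>(x := v)) \<phi>" by auto
    from 2[OF v(1)] IH v(2) show "sat G \<sigma> (Exi x \<phi>)" by auto
  qed
qed

lemma good_graphs_agree:
  assumes G: "good_graph \<alpha> \<tau> n G" and H: "good_graph \<alpha> \<tau> n H"
    and \<phi>: "sentence \<phi>" "qdepth \<phi> \<le> k"
  shows "holds G \<phi> \<longleftrightarrow> holds H \<phi>"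
proof -
  have "t_closed \<alpha> G (t k) {}" "t_closed \<alpha> H (t k) {}"
    using G H t by (auto simp: good_graph_def intro: t_closed_mono)
  \<comment> \<open>The value 0 is a dummy, not a vertex; with no variable in play the assignments
    are unconstrained.\<close>
  then have "ef_invariant \<alpha> \<tau> G H (t k) {} (\<lambda>_. 0) (\<lambda>_. 0)"
    unfolding ef_invariant_def by (intro exI[of _ "{}"] exI[of _ id]) auto
  then have "sat G (\<lambda>_. 0) \<phi> \<longleftrightarrow> sat H (\<lambda>_. 0) \<phi>"
    using ef_invariant_sat_iff[OF G H, where X = "{}" and j = k and \<phi> = \<phi>] \<phi>
    by (simp add: sentence_def)
  then show ?thesis using holds_iff_sat[OF \<phi>(1)] by metis
qed

text \<open>The successor matters: it later absorbs the rounding of the real bound down to the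
  integer \<open>k\<close>.\<close>

lemma good_graphs_distinguishability:
  assumes G: "good_graph \<alpha> \<tau> n G" and H: "good_graph \<alpha> \<tau> n H"
  shows "enat (Suc k) \<le> fo_distinguishability G H"
  unfolding fo_distinguishability_def
proof (rule Inf_greatest)
  fix x assume "x \<in> {enat (qdepth \<phi>) |\<phi>. sentence \<phi> \<and> holds G \<phi> \<noteq> holds H \<phi>}"
  then obtain \<phi> where \<phi>: "x = enat (qdepth \<phi>)" "sentence \<phi>" "holds G \<phi> \<noteq> holds H \<phi>" by blast
  have "\<not> qdepth \<phi> \<le> k"
    using good_graphs_agree[OF G H \<phi>(2)] \<phi>(3) by blast
  then show "enat (Suc k) \<le> x" using \<phi>(1) by simp
qed

end

section \<open>Random subsets\<close>

definition random_subset :: "'a set \<Rightarrow> real \<Rightarrow> 'a set pmf" where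
  "random_subset I p = map_pmf (\<lambda>X. {e \<in> I. X e}) (Pi_pmf I False (\<lambda>_. bernoulli_pmf p))"

lemma random_graph_conv_random_subset:
  "random_graph n p = map_pmf (Pair {1..n}) (random_subset (vertex_pairs n) p)"
  by (simp add: random_graph_def random_subset_def pmf.map_comp o_def)

lemma set_pmf_random_subset: "set_pmf (random_subset I p) \<subseteq> Pow I"
  by (auto simp: random_subset_def)

lemma finite_set_pmf_random_subset: "finite I \<Longrightarrow> finite (set_pmf (random_subset I p))"
  by (rule finite_subset[OF set_pmf_random_subset]) simp

lemma integrable_random_subset:
  fixes f :: "'a set \<Rightarrow> real"
  shows "finite I \<Longrightarrow> integrable (measure_pmf (random_subset I p)) f"
  by (simp add: integrable_measure_pmf_finite finite_set_pmf_random_subset)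

lemma random_subset_Un:
  assumes "finite A" "finite B" "A \<inter> B = {}"
  shows "random_subset (A \<union> B) p =
    map_pmf (\<lambda>(X, Y). X \<union> Y) (pair_pmf (random_subset A p) (random_subset B p))"
proof -
  have "random_subset (A \<union> B) p = map_pmf (\<lambda>(f, g). {e \<in> A. f e} \<union> {e \<in> B. g e})
      (pair_pmf (Pi_pmf A False (\<lambda>_. bernoulli_pmf p)) (Pi_pmf B False (\<lambda>_. bernoulli_pmf p)))"
    unfolding random_subset_def Pi_pmf_union[OF assms] pmf.map_comp
    using assms(3) by (intro map_pmf_cong) auto
  also have "\<dots> = map_pmf (\<lambda>(X, Y). X \<union> Y) (pair_pmf (random_subset A p) (random_subset B p))"
    unfolding random_subset_def pair_map_pmf1 pair_map_pmf2 pmf.map_comp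
    by (intro map_pmf_cong) auto
  finally show ?thesis .
qed

lemma prob_random_subset_superset:
  assumes I: "finite I" and K: "K \<subseteq> I" and p: "0 \<le> p" "p \<le> 1"
  shows "measure_pmf.prob (random_subset I p) {E. K \<subseteq> E} = p ^ card K"
proof -
  have "measure_pmf.prob (random_subset I p) {E. K \<subseteq> E} =
      measure_pmf.prob (Pi_pmf I False (\<lambda>_. bernoulli_pmf p)) (Pi I (\<lambda>e. if e \<in> K then {True} else UNIV))"
    unfolding random_subset_def measure_map_pmf
    by (rule arg_cong[where f = "measure_pmf.prob _"]) (use K in \<open>auto simp: Pi_def\<close>)
  also have "\<dots> = (\<Prod>e\<in>I. measure_pmf.prob (bernoulli_pmf p) (if e \<in> K then {True} else UNIV))"
    by (rule measure_Pi_pmf_Pi[OF I])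
  also have "\<dots> = (\<Prod>e\<in>I. if e \<in> K then p else 1)"
    using p by (intro prod.cong) (auto simp: measure_pmf_single)
  also have "\<dots> = p ^ card K"
    using I K by (simp add: prod.If_cases Int_absorb1)
  finally show ?thesis .
qed

lemma expectation_random_subset_superset:
  assumes "finite I" "K \<subseteq> I" "0 \<le> p" "p \<le> 1"
  shows "measure_pmf.expectation (random_subset I p) (\<lambda>E. of_bool (K \<subseteq> E)) = p ^ card K"
proof -
  have "(\<lambda>E. of_bool (K \<subseteq> E) :: real) = indicator {E. K \<subseteq> E}"
    by (auto simp: indicator_def)
  then show ?thesis using prob_random_subset_superset[OF assms] by simp
qed

lemma random_subset_indep2:
  assumes I: "finite I" and A: "A \<subseteq> I"
  shows "measure_pmf.prob (random_subset I p) {E. P (E \<inter> A) \<and> Q (E \<inter> (I - A))} =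
    measure_pmf.prob (random_subset I p) {E. P (E \<inter> A)} *
    measure_pmf.prob (random_subset I p) {E. Q (E \<inter> (I - A))}"
proof -
  let ?q = "pair_pmf (random_subset A p) (random_subset (I - A) p)"
  have fin: "finite A" "finite (I - A)" using I A finite_subset by auto
  have eq: "random_subset I p = map_pmf (\<lambda>(X, Y). X \<union> Y) ?q"
    using random_subset_Un[OF fin, of p] A by (simp add: Un_absorb1 Un_commute)
  have supp: "X \<subseteq> A \<and> Y \<subseteq> I - A" if "(X, Y) \<in> set_pmf ?q" for X Y
    using that set_pmf_random_subset by auto
  have *: "measure_pmf.prob (random_subset I p) {E. R (E \<inter> A) (E \<inter> (I - A))} =
      measure_pmf.prob ?q {(X, Y). R X Y}" for R
  \<comment> \<open>The union determines its two parts only on the support, where they lie in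
    \<open>A\<close> and in \<open>I - A\<close>; hence events are compared almost
    everywhere.\<close>
  proof -
    have mem: "z \<in> (\<lambda>(X, Y). X \<union> Y) -` {E. R (E \<inter> A) (E \<inter> (I - A))} \<longleftrightarrow> z \<in> {(X, Y). R X Y}"
      if z: "z \<in> set_pmf ?q" for z
    proof -
      obtain X Y where XY: "z = (X, Y)" by (cases z)
      then have "X \<subseteq> A" "Y \<subseteq> I - A" using supp z by blast+
      then have "(X \<union> Y) \<inter> A = X" "(X \<union> Y) \<inter> (I - A) = Y" by blast+
      then show ?thesis by (simp add: XY)
    qed
    show ?thesis
      unfolding eq measure_map_pmf
    proof (rule measure_pmf.finite_measure_eq_AE)
      show "AE z in measure_pmf ?q. z \<in> (\<lambda>(X, Y). X \<union> Y) -` {E. R (E \<inter> A) (E \<inter> (I - A))} \<longleftrightarrow>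
          z \<in> {(X, Y). R X Y}"
        unfolding AE_measure_pmf_iff using mem by blast
    qed simp_all
  qed
  have prod: "measure_pmf.prob ?q {(X, Y). P X \<and> Q Y} =
    measure_pmf.prob (random_subset A p) {X. P X} * measure_pmf.prob (random_subset (I - A) p) {Y. Q Y}"
    for P Q
  proof -
    have "measure_pmf.prob ?q {(X, Y). P X \<and> Q Y} = measure_pmf.prob ?q ({(X, Y). P X \<and> Q Y} \<inter> set_pmf ?q)"
      by (rule measure_Int_set_pmf[symmetric])
    also have "{(X, Y). P X \<and> Q Y} \<inter> set_pmf ?q =
        ({X. P X} \<inter> set_pmf (random_subset A p)) \<times> ({Y. Q Y} \<inter> set_pmf (random_subset (I - A) p))"
      by auto
    also have "measure_pmf.prob ?q \<dots> = measure_pmf.prob (random_subset A p) {X. P X} *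
        measure_pmf.prob (random_subset (I - A) p) {Y. Q Y}"
      by (subst measure_pmf_prob_product) (auto simp: measure_Int_set_pmf)
    finally show ?thesis .
  qed
  show ?thesis
    using *[of "\<lambda>X Y. P X \<and> Q Y"] *[of "\<lambda>X Y. P X"] *[of "\<lambda>X Y. Q Y"] prod[of P Q] prod[of P "\<lambda>_. True"]
      prod[of "\<lambda>_. True" Q] by simp
qed

lemma random_subset_indep:
  assumes I: "finite I" and J: "finite J" and sub: "\<And>j. j \<in> J \<Longrightarrow> B j \<subseteq> I"
    and disj: "\<And>i j. i \<in> J \<Longrightarrow> j \<in> J \<Longrightarrow> i \<noteq> j \<Longrightarrow> B i \<inter> B j = {}"
  shows "measure_pmf.prob (random_subset I p) {E. \<forall>j\<in>J. P j (E \<inter> B j)} =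
    (\<Prod>j\<in>J. measure_pmf.prob (random_subset I p) {E. P j (E \<inter> B j)})"
  using J sub disj
proof (induction J rule: finite_induct)
  case (insert j J)
  have *: "E \<inter> B i = E \<inter> (I - B j) \<inter> B i" if "i \<in> J" for E i
    using insert.prems(1)[of i] insert.prems(2)[of i j] insert.hyps that by auto
  have **: "(\<forall>i\<in>J. P i (E \<inter> B i)) \<longleftrightarrow> (\<forall>i\<in>J. P i (E \<inter> (I - B j) \<inter> B i))" for E
    by (rule ball_cong[OF refl], rule arg_cong[OF *])
  have "{E. \<forall>i\<in>insert j J. P i (E \<inter> B i)} =
      {E. P j (E \<inter> B j) \<and> (\<forall>i\<in>J. P i (E \<inter> (I - B j) \<inter> B i))}"
  proof (rule Collect_cong)
    show "(\<forall>i\<in>insert j J. P i (E \<inter> B i)) \<longleftrightarrow>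
        P j (E \<inter> B j) \<and> (\<forall>i\<in>J. P i (E \<inter> (I - B j) \<inter> B i))" for E
      using **[of E] by blast
  qed
  also have "measure_pmf.prob (random_subset I p) \<dots> = measure_pmf.prob (random_subset I p) {E. P j (E \<inter> B j)} *
     measure_pmf.prob (random_subset I p) {E. \<forall>i\<in>J. P i (E \<inter> (I - B j) \<inter> B i)}"
    by (rule random_subset_indep2[OF I, where P = "P j" and A = "B j" and Q = "\<lambda>F. \<forall>i\<in>J. P i (F \<inter> B i)"]) (use insert.prems(1) in blast)
  also have "{E. \<forall>i\<in>J. P i (E \<inter> (I - B j) \<inter> B i)} = {E. \<forall>i\<in>J. P i (E \<inter> B i)}"
    by (rule Collect_cong) (rule **[symmetric])
  also have "measure_pmf.prob (random_subset I p) \<dots> = (\<Prod>j\<in>J. measure_pmf.prob (random_subset I p) {E. P j (E \<inter> B j)})"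
    by (rule insert.IH) (use insert.prems in blast)+
  finally show ?case using insert.hyps by simp
qed simp

lemma prob_pmf_le_expectation:
  fixes Z :: "'a \<Rightarrow> real"
  assumes "integrable (measure_pmf M) Z" "\<And>x. 0 \<le> Z x" "\<And>x. x \<in> A \<Longrightarrow> 1 \<le> Z x"
  shows "measure_pmf.prob M A \<le> measure_pmf.expectation M Z"
proof -
  have "measure_pmf.expectation M (indicator A) \<le> measure_pmf.expectation M Z"
  proof (rule integral_mono)
    show "integrable (measure_pmf M) (indicator A :: 'a \<Rightarrow> real)"
      by (rule integrable_real_indicator) (auto simp: less_top[symmetric])
  qed (use assms in \<open>auto simp: indicator_def\<close>)
  then show ?thesis by simp
qed

text \<open>Chebyshev's inequality. Disjoint pairs contribute exactly what the square of the mean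
  subtracts, so only intersecting pairs are left, each exceeding the product of its probabilities by
  a factor 1/p per common element. The 4 comes from a deviation of half the mean.\<close>

lemma random_subset_second_moment:
  fixes K :: "'g \<Rightarrow> 'a set" and p \<eta> :: real
  assumes I: "finite I" and p: "0 < p" "p \<le> 1" and Gfin: "finite \<G>" "\<G> \<noteq> {}"
    and K: "\<And>g. g \<in> \<G> \<Longrightarrow> K g \<subseteq> I" "\<And>g. g \<in> \<G> \<Longrightarrow> card (K g) = e"
    and \<eta>: "\<And>g. g \<in> \<G> \<Longrightarrow>
      (\<Sum>h | h \<in> \<G> \<and> K g \<inter> K h \<noteq> {}. (1 / p) ^ card (K g \<inter> K h)) \<le> \<eta> * card \<G>"
  shows "measure_pmf.prob (random_subset I p)
    {E. real (card {g \<in> \<G>. K g \<subseteq> E}) \<le> card \<G> * p ^ e / 2} \<le> 4 * \<eta>"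
proof -
  let ?M = "random_subset I p"
  define N where "N E = (\<Sum>g\<in>\<G>. of_bool (K g \<subseteq> E) :: real)" for E
  define \<mu> where "\<mu> = card \<G> * p ^ e"
  have \<mu>: "\<mu> > 0" using Gfin p by (simp add: \<mu>_def card_gt_0_iff)
  have N: "real (card {g \<in> \<G>. K g \<subseteq> E}) = N E" for E
    using Gfin by (simp add: N_def of_bool_def sum.If_cases Int_def)
  have fin: "finite (K g)" if "g \<in> \<G>" for g using K(1)[OF that] I finite_subset by blast
  have ex: "measure_pmf.expectation ?M (\<lambda>E. of_bool (L \<subseteq> E)) = p ^ card L" if "L \<subseteq> I" for L
    using expectation_random_subset_superset[OF I that] p by simp
  note int = integrable_random_subset[OF I, of p]
  have EN: "measure_pmf.expectation ?M N = \<mu>"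
    unfolding N_def using K by (subst Bochner_Integration.integral_sum) (auto simp: int ex \<mu>_def)
  have ex2: "measure_pmf.expectation ?M (\<lambda>E. of_bool (K g \<subseteq> E \<and> K h \<subseteq> E)) = p ^ card (K g \<union> K h)"
    if "g \<in> \<G>" "h \<in> \<G>" for g h
    using ex[of "K g \<union> K h"] K(1) that by simp
  have "measure_pmf.expectation ?M (\<lambda>E. (N E)\<^sup>2) =
      measure_pmf.expectation ?M (\<lambda>E. \<Sum>g\<in>\<G>. \<Sum>h\<in>\<G>. of_bool (K g \<union> K h \<subseteq> E))"
    by (intro Bochner_Integration.integral_cong) (auto simp: N_def power2_eq_square sum_product of_bool_conj[symmetric] intro!: sum.cong)
  also have "\<dots> = (\<Sum>g\<in>\<G>. \<Sum>h\<in>\<G>. p ^ card (K g \<union> K h))"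
    by (simp add: int ex2)
  finally have EN2: "measure_pmf.expectation ?M (\<lambda>E. (N E)\<^sup>2) = (\<Sum>g\<in>\<G>. \<Sum>h\<in>\<G>. p ^ card (K g \<union> K h))" .
  have pair_le: "p ^ card (K g \<union> K h) \<le> p ^ (2 * e) +
      (if K g \<inter> K h \<noteq> {} then p ^ (2 * e) * (1 / p) ^ card (K g \<inter> K h) else 0)"
    if "g \<in> \<G>" "h \<in> \<G>" for g h
  proof -
    have "card (K g \<union> K h) + card (K g \<inter> K h) = 2 * e"
      using card_Un_Int[OF fin[OF that(1)] fin[OF that(2)]] K(2) that by simp
    then have "p ^ card (K g \<union> K h) * p ^ card (K g \<inter> K h) = p ^ (2 * e)" by (metis power_add)
    then have "p ^ card (K g \<union> K h) = p ^ (2 * e) * (1 / p) ^ card (K g \<inter> K h)"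
      using p by (simp add: field_simps power_divide)
    then show ?thesis using p by auto
  qed
  have "(\<Sum>g\<in>\<G>. \<Sum>h\<in>\<G>. p ^ card (K g \<union> K h)) \<le> (\<Sum>g\<in>\<G>. \<Sum>h\<in>\<G>. p ^ (2 * e) +
      (if K g \<inter> K h \<noteq> {} then p ^ (2 * e) * (1 / p) ^ card (K g \<inter> K h) else 0))"
    by (intro sum_mono pair_le)
  also have "\<dots> = \<mu>\<^sup>2 + p ^ (2 * e) *
      (\<Sum>g\<in>\<G>. \<Sum>h | h \<in> \<G> \<and> K g \<inter> K h \<noteq> {}. (1 / p) ^ card (K g \<inter> K h))"
    using Gfin by (simp add: sum.distrib \<mu>_def power_mult_distrib power_mult[symmetric] mult.commute
        sum.If_cases sum_distrib_left Int_def power2_eq_square mult_ac) (simp add: mult_2_right power_add)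
  also have "\<dots> \<le> \<mu>\<^sup>2 + p ^ (2 * e) * (\<Sum>g\<in>\<G>. \<eta> * card \<G>)"
    using p by (intro add_left_mono mult_left_mono sum_mono \<eta>) auto
  also have "\<dots> = (1 + \<eta>) * \<mu>\<^sup>2"
    by (simp add: \<mu>_def power_mult_distrib algebra_simps power2_eq_square) (simp add: mult_2_right power_add)
  finally have EN2': "measure_pmf.expectation ?M (\<lambda>E. (N E)\<^sup>2) \<le> (1 + \<eta>) * \<mu>\<^sup>2" unfolding EN2 .
  have "measure_pmf.expectation ?M (\<lambda>E. (N E - \<mu>)\<^sup>2) =
      measure_pmf.expectation ?M (\<lambda>E. (N E)\<^sup>2 - 2 * \<mu> * N E + \<mu>\<^sup>2)"
    by (intro Bochner_Integration.integral_cong) (auto simp: power2_eq_square algebra_simps)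
  also have "\<dots> = measure_pmf.expectation ?M (\<lambda>E. (N E)\<^sup>2) - 2 * \<mu> * \<mu> + \<mu>\<^sup>2"
    by (simp add: int EN)
  also have "\<dots> \<le> \<eta> * \<mu>\<^sup>2" using EN2' by (simp add: algebra_simps power2_eq_square)
  finally have var: "measure_pmf.expectation ?M (\<lambda>E. (N E - \<mu>)\<^sup>2) \<le> \<eta> * \<mu>\<^sup>2" .
  have "measure_pmf.prob ?M {E. N E \<le> \<mu> / 2} \<le>
      measure_pmf.expectation ?M (\<lambda>E. 4 / \<mu>\<^sup>2 * (N E - \<mu>)\<^sup>2)"
  proof (rule prob_pmf_le_expectation[OF int])
    fix E assume "E \<in> {E. N E \<le> \<mu> / 2}"
    then have "(\<mu> / 2)\<^sup>2 \<le> (\<mu> - N E)\<^sup>2" using \<mu> by (intro power_mono) auto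
    then show "1 \<le> 4 / \<mu>\<^sup>2 * (N E - \<mu>)\<^sup>2"
      using \<mu> by (simp add: field_simps power2_commute)
  qed simp
  also have "\<dots> \<le> 4 / \<mu>\<^sup>2 * (\<eta> * \<mu>\<^sup>2)" using var \<mu> by (simp add: int field_simps)
  also have "\<dots> = 4 * \<eta>" using \<mu> by simp
  finally show ?thesis unfolding N \<mu>_def by simp
qed

text \<open>Revealing the structures \<open>T\<close> one family at a time, only the edges not yet in \<open>U\<close> cost a factor
  \<open>p\<close>; the invariant \<open>P i U\<close> bounds the complexity of \<open>U\<close> after \<open>i\<close> steps.\<close>

lemma random_subset_product_moment:
  fixes K :: "'t \<Rightarrow> 'a set" and \<T> :: "nat \<Rightarrow> 't set" and p \<kappa> :: real
  assumes I: "finite I" and p: "0 \<le> p" "p \<le> 1" and \<kappa>: "0 \<le> \<kappa>"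
    and T: "\<And>j. finite (\<T> j)"
    and step: "\<And>i j U T. P i U \<Longrightarrow> T \<in> \<T> j \<Longrightarrow> P (Suc i) (U \<union> K T)"
    and PI: "\<And>i U. P i U \<Longrightarrow> U \<subseteq> I"
    and bound: "\<And>i j U. P i U \<Longrightarrow> i < m \<Longrightarrow> (\<Sum>T\<in>\<T> j. p ^ card (K T - U)) \<le> \<kappa>"
    and J: "finite J"
  shows "P i U \<Longrightarrow> i + card J \<le> m \<Longrightarrow>
    measure_pmf.expectation (random_subset I p)
      (\<lambda>E. of_bool (U \<subseteq> E) * (\<Prod>j\<in>J. real (card {T \<in> \<T> j. K T \<subseteq> E}))) \<le> \<kappa> ^ card J * p ^ card U"
  using J
proof (induction J arbitrary: i U rule: finite_induct)
  case empty
  then show ?case using expectation_random_subset_superset[OF I PI p] by simp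
next
  case (insert j J)
  let ?M = "random_subset I p"
  note int = integrable_random_subset[OF I, of p]
  let ?N = "\<lambda>E. \<Prod>j\<in>J. real (card {T \<in> \<T> j. K T \<subseteq> E})"
  have U: "U \<subseteq> I" using PI insert.prems by blast
  then have finU: "finite U" using I by (rule finite_subset)
  have "measure_pmf.expectation ?M (\<lambda>E. of_bool (U \<subseteq> E) * (\<Prod>j\<in>insert j J. real (card {T \<in> \<T> j. K T \<subseteq> E})))
    = measure_pmf.expectation ?M (\<lambda>E. \<Sum>T\<in>\<T> j. of_bool (U \<union> K T \<subseteq> E) * ?N E)"
  proof (intro Bochner_Integration.integral_cong refl)
    fix E
    have "real (card {T \<in> \<T> j. K T \<subseteq> E}) = (\<Sum>T\<in>\<T> j. of_bool (K T \<subseteq> E))"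
      using T by (simp add: of_bool_def sum.If_cases Int_def)
    then show "of_bool (U \<subseteq> E) * (\<Prod>j\<in>insert j J. real (card {T \<in> \<T> j. K T \<subseteq> E})) =
        (\<Sum>T\<in>\<T> j. of_bool (U \<union> K T \<subseteq> E) * ?N E)"
      using insert.hyps by (simp add: sum_distrib_left sum_distrib_right of_bool_conj mult_ac)
  qed
  also have "\<dots> = (\<Sum>T\<in>\<T> j. measure_pmf.expectation ?M (\<lambda>E. of_bool (U \<union> K T \<subseteq> E) * ?N E))"
    by (subst Bochner_Integration.integral_sum) (auto simp: int)
  also have "\<dots> \<le> (\<Sum>T\<in>\<T> j. \<kappa> ^ card J * p ^ card (U \<union> K T))"
    by (intro sum_mono insert.IH[of "Suc i"] step[OF insert.prems(1)]) (use insert in auto)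
  also have "\<dots> = \<kappa> ^ card J * p ^ card U * (\<Sum>T\<in>\<T> j. p ^ card (K T - U))"
    unfolding sum_distrib_left
  proof (intro sum.cong refl)
    fix T assume "T \<in> \<T> j"
    then have "U \<union> K T \<subseteq> I" by (intro PI[OF step[OF insert.prems(1)]])
    then have "finite (K T)" using I by (meson finite_subset le_sup_iff)
    then have "card (U \<union> K T) = card U + card (K T - U)"
      using card_Un_disjoint[of U "K T - U"] finU by auto
    then show "\<kappa> ^ card J * p ^ card (U \<union> K T) = \<kappa> ^ card J * p ^ card U * p ^ card (K T - U)"
      by (simp add: power_add)
  qed
  also have "\<dots> \<le> \<kappa> ^ card J * p ^ card U * \<kappa>"
    using insert p \<kappa> by (intro mult_left_mono bound[OF insert.prems(1)]) auto
  finally show ?case using insert.hyps by (simp add: mult_ac)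
qed

text \<open>Of \<open>2 * m\<close> indices at least \<open>m\<close> are of the same kind, so
  control of each kind separately suffices, whatever the dependence between the kinds. The factor
  4^m counts the subsets of indices.\<close>

lemma prob_all_disj_le:
  fixes M :: "'a pmf"
  assumes \<epsilon>: "0 \<le> \<epsilon>" "\<epsilon> \<le> 1"
    and A: "\<And>J. J \<subseteq> {..<2 * m} \<Longrightarrow> measure_pmf.prob M {x. \<forall>j\<in>J. A j x} \<le> \<epsilon> ^ card J"
    and B: "\<And>J. J \<subseteq> {..<2 * m} \<Longrightarrow> measure_pmf.prob M {x. \<forall>j\<in>J. B j x} \<le> \<epsilon> ^ card J"
  shows "measure_pmf.prob M {x. \<forall>j<2 * m. A j x \<or> B j x} \<le> (4 * \<epsilon>) ^ m"
proof -
  have "measure_pmf.prob M {x. \<forall>j<2 * m. A j x \<or> B j x} \<le>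
      measure_pmf.prob M (\<Union>J\<in>Pow {..<2 * m}. {x. \<forall>j\<in>J. A j x} \<inter> {x. \<forall>j\<in>{..<2 * m} - J. B j x})"
  proof (rule measure_pmf.finite_measure_mono)
    show "{x. \<forall>j<2 * m. A j x \<or> B j x} \<subseteq>
        (\<Union>J\<in>Pow {..<2 * m}. {x. \<forall>j\<in>J. A j x} \<inter> {x. \<forall>j\<in>{..<2 * m} - J. B j x})"
    proof
      fix x assume "x \<in> {x. \<forall>j<2 * m. A j x \<or> B j x}"
      then show "x \<in> (\<Union>J\<in>Pow {..<2 * m}. {x. \<forall>j\<in>J. A j x} \<inter> {x. \<forall>j\<in>{..<2 * m} - J. B j x})"
        by (intro UN_I[of "{j. j < 2 * m \<and> A j x}"]) auto
    qed
  qed simp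
  also have "\<dots> \<le> (\<Sum>J\<in>Pow {..<2 * m}. measure_pmf.prob M ({x. \<forall>j\<in>J. A j x} \<inter> {x. \<forall>j\<in>{..<2 * m} - J. B j x}))"
    by (rule measure_pmf.finite_measure_subadditive_finite) auto
  also have "\<dots> \<le> (\<Sum>J\<in>Pow {..<2 * m}. \<epsilon> ^ m)"
  proof (rule sum_mono)
    fix J assume "J \<in> Pow {..<2 * m}"
    then have J: "J \<subseteq> {..<2 * m}" "finite J" using finite_subset by auto
    have "card J + card ({..<2 * m} - J) = 2 * m"
      using J by (metis card_Diff_subset card_lessThan card_mono finite_lessThan le_add_diff_inverse)
    then consider "card J \<ge> m" | "card ({..<2 * m} - J) \<ge> m" by linarith
    then show "measure_pmf.prob M ({x. \<forall>j\<in>J. A j x} \<inter> {x. \<forall>j\<in>{..<2 * m} - J. B j x}) \<le> \<epsilon> ^ m"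
    proof cases
      case 1
      have "measure_pmf.prob M ({x. \<forall>j\<in>J. A j x} \<inter> {x. \<forall>j\<in>{..<2 * m} - J. B j x})
          \<le> measure_pmf.prob M {x. \<forall>j\<in>J. A j x}"
        by (rule measure_pmf.finite_measure_mono) auto
      also have "\<dots> \<le> \<epsilon> ^ card J" by (rule A[OF J(1)])
      also have "\<dots> \<le> \<epsilon> ^ m" using 1 \<epsilon> by (rule power_decreasing)
      finally show ?thesis .
    next
      case 2
      have "measure_pmf.prob M ({x. \<forall>j\<in>J. A j x} \<inter> {x. \<forall>j\<in>{..<2 * m} - J. B j x})
          \<le> measure_pmf.prob M {x. \<forall>j\<in>{..<2 * m} - J. B j x}"
        by (rule measure_pmf.finite_measure_mono) auto
      also have "\<dots> \<le> \<epsilon> ^ card ({..<2 * m} - J)" by (rule B) auto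
      also have "\<dots> \<le> \<epsilon> ^ m" using 2 \<epsilon> by (rule power_decreasing)
      finally show ?thesis .
    qed
  qed
  also have "\<dots> = (4 * \<epsilon>) ^ m" by (simp add: card_Pow power_mult power_mult_distrib)
  finally show ?thesis .
qed

section \<open>A single extension problem\<close>

lemma finite_vertex_pairs: "finite (vertex_pairs n)"
  by (rule finite_subset[of _ "Pow {1..n}"]) (auto simp: vertex_pairs_def)

lemma card_pairs_le:
  assumes "finite S"
  shows "card {e. e \<subseteq> S \<and> card e = 2} \<le> (card S)\<^sup>2"
proof -
  have "card {e. e \<subseteq> S \<and> card e = 2} = card S choose 2"
    by (rule n_subsets[OF assms])
  also have "\<dots> \<le> (card S)\<^sup>2"
  proof (cases "2 \<le> card S")
    case True
    then show ?thesis by (rule binomial_le_pow)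
  qed (simp add: binomial_eq_0)
  finally show ?thesis .
qed

text \<open>The weight is a product over the labels, so the sum over all maps factorises.
  \<open>P x y\<close> stands for a coincidence: with a fixed embedding in the second moment, with
  an already covered vertex in the joint moment.\<close>

lemma sum_PiE_power_agree_le:
  fixes c b :: real
  assumes W: "finite W" and B: "\<And>x. x \<in> W \<Longrightarrow> finite (B x)" and c: "c \<ge> 0" "b \<ge> 0"
    and bound: "\<And>x. x \<in> W \<Longrightarrow> (\<Sum>y\<in>B x. if P x y then c else 1) \<le> b"
  shows "(\<Sum>h\<in>PiE W B. c ^ card {x \<in> W. P x (h x)}) \<le> b ^ card W"
proof -
  have "(\<Sum>h\<in>PiE W B. c ^ card {x \<in> W. P x (h x)}) =
      (\<Sum>h\<in>PiE W B. \<Prod>x\<in>W. if P x (h x) then c else 1)"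
    using W by (intro sum.cong refl) (simp add: prod.If_cases Int_def)
  also have "\<dots> = (\<Prod>x\<in>W. \<Sum>y\<in>B x. if P x y then c else 1)"
    by (rule prod_sum_PiE[symmetric, OF W B])
  also have "\<dots> \<le> (\<Prod>x\<in>W. b)"
    using c bound by (intro prod_mono conjI sum_nonneg) auto
  finally show ?thesis by simp
qed

text \<open>A vertex of \<open>D\<close> outside \<open>A\<close> weighs 1/n and one in
  \<open>A\<close> weighs 1, so the sum over all \<open>D\<close> is the product of 1 + weight over
  the vertices: at most 2^a from \<open>A\<close>, and at most (1 + 1/n)^n \<le> e < 4 from the
  others. \<open>A = {}\<close> serves plain counting of small sets.\<close>

lemma sum_Pow_weight_le:
  fixes n a :: nat
  assumes n: "n \<ge> 1" and A: "card (A \<inter> {1..n}) \<le> a"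
  shows "(\<Sum>D\<in>Pow {1..n}. real n ^ card (D \<inter> A) / real n ^ card D) \<le> 4 * 2 ^ a"
proof -
  have "(\<Sum>D\<in>Pow {1..n}. real n ^ card (D \<inter> A) / real n ^ card D) =
      (\<Sum>D\<in>Pow {1..n}. \<Prod>y\<in>D. if y \<in> A then 1 else 1 / real n)"
  proof (intro sum.cong refl)
    fix D assume "D \<in> Pow {1..n}"
    then have fin: "finite D" using finite_subset by auto
    have "card D = card (D \<inter> A) + card (D - A)" using card_Int_Diff[OF fin] by simp
    then show "real n ^ card (D \<inter> A) / real n ^ card D = (\<Prod>y\<in>D. if y \<in> A then 1 else 1 / real n)"
      using n fin by (simp add: prod.If_cases power_add power_divide Diff_eq)
  qed
  also have "\<dots> = (\<Prod>y\<in>{1..n}. (if y \<in> A then 1 else 1 / real n) + 1)"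
    by (subst prod_add) auto
  also have "\<dots> = (\<Prod>y\<in>{1..n}. if y \<in> A then 2 else 1 + 1 / real n)"
    by (intro prod.cong) auto
  also have "\<dots> = 2 ^ card ({1..n} \<inter> A) * (1 + 1 / real n) ^ card ({1..n} \<inter> - A)"
    by (simp add: prod.If_cases)
  also have "\<dots> \<le> 2 ^ a * (1 + 1 / real n) ^ n"
  proof (intro mult_mono power_increasing)
    show "card ({1..n} \<inter> A) \<le> a" using A by (simp add: Int_commute)
    show "card ({1..n} \<inter> - A) \<le> n" using card_mono[of "{1..n}" "{1..n} \<inter> - A"] by simp
  qed auto
  also have "(1 + 1 / real n) ^ n \<le> exp 1"
    using exp_ge_one_plus_x_over_n_power_n[of n 1] n by simp
  also have "exp 1 \<le> (4 :: real)" using exp_le by simp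
  finally show ?thesis by (simp add: mult.commute)
qed

text \<open>The label \<open>x\<close> of a new vertex is sought in the block \<open>B j x\<close>, so that embeddings are injective
  for free and embeddings of different families \<open>j\<close> use disjoint sets of edges.\<close>

locale extension_instance =
  fixes n \<tau> u m b :: nat and \<alpha> \<delta> :: real and L W :: "nat set" and F :: "nat set set"
    and f :: "nat \<Rightarrow> nat" and B :: "nat \<Rightarrow> nat \<Rightarrow> nat set"
  assumes n: "n \<ge> 1" and \<alpha>: "\<alpha> > 0" and \<delta>: "\<delta> > 0"
    and finL: "finite L" and finW: "finite W" and LW: "L \<inter> W = {}" and W0: "W \<noteq> {}"
    and F: "\<And>e. e \<in> F \<Longrightarrow> e \<subseteq> L \<union> W \<and> card e = 2 \<and> \<not> e \<subseteq> L"
    and f: "inj_on f L" "f ` L \<subseteq> {1..n}"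
    and cardL: "card L \<le> \<tau>" and cardW: "card W + u \<le> \<tau>"
    and gap: "\<And>v e :: nat. v \<le> \<tau> \<Longrightarrow> (v, e) \<noteq> (0, 0) \<Longrightarrow> \<delta> \<le> \<bar>real v - \<alpha> * real e\<bar>"
    and safe: "\<And>S. S \<subseteq> W \<Longrightarrow> S \<noteq> {} \<Longrightarrow> \<alpha> * card {e \<in> F. e \<subseteq> L \<union> S} < card S"
    and B: "\<And>j x. x \<in> W \<Longrightarrow> B j x \<subseteq> {1..n} - f ` L"
    and Bdisj: "\<And>j x i y. x \<in> W \<Longrightarrow> y \<in> W \<Longrightarrow> (j, x) \<noteq> (i, y) \<Longrightarrow> B j x \<inter> B i y = {}"
    and cardB: "\<And>j x. x \<in> W \<Longrightarrow> j < 2 * b \<Longrightarrow> card (B j x) = m" and m: "m \<ge> 1"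
begin

section \<open>Embeddings into the blocks and their second moment\<close>

definition R where "R = f ` L"
definition p where "p = real n powr (- \<alpha>)"
definition ext where "ext g x = (if x \<in> W then g x else f x)"
definition K where "K g = (`) (ext g) ` F"
definition maps where "maps j = PiE W (B j)"
definition \<mu> where "\<mu> = real m ^ card W * p ^ card F"
definition hits where "hits j E = card {g \<in> maps j. K g \<subseteq> E}"

lemma p: "0 < p" "p \<le> 1"
proof -
  show "0 < p" using n by (simp add: p_def)
  have "real n powr (- \<alpha>) \<le> real n powr 0" using n \<alpha> by (intro powr_mono) auto
  then show "p \<le> 1" using n by (simp add: p_def)
qed

lemma p_power: "p ^ k = real n powr (- \<alpha> * real k)"
  using n by (simp add: p_def powr_powr[symmetric] powr_realpow[symmetric] powr_powr)

lemma finF: "finite F"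
  by (rule finite_subset[of _ "Pow (L \<union> W)"]) (use F finL finW in auto)

lemma finR: "finite R" and cardR: "card R \<le> \<tau>"
  using finL cardL card_image_le[OF finL, of f] by (auto simp: R_def)

lemma finB: "x \<in> W \<Longrightarrow> finite (B j x)"
  using B by (meson finite_Diff finite_atLeastAtMost finite_subset)

lemma fin_maps: "finite (maps j)"
  unfolding maps_def by (intro finite_PiE finW finB)

lemma mapsD:
  assumes "g \<in> maps j" "x \<in> W"
  shows "g x \<in> B j x" "g x \<in> {1..n}" "g x \<notin> R"
proof -
  show *: "g x \<in> B j x" using assms by (auto simp: maps_def)
  show "g x \<in> {1..n}" "g x \<notin> R" using * B[OF assms(2), of j] by (auto simp: R_def)
qed

lemma inj_on_maps: "g \<in> maps j \<Longrightarrow> inj_on g W"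
  using mapsD(1) Bdisj by (metis Pair_inject disjoint_iff inj_onI)

lemma ext_inj: assumes g: "g \<in> maps j" shows "inj_on (ext g) (L \<union> W)"
proof (rule inj_onI)
  fix x y assume xy: "x \<in> L \<union> W" "y \<in> L \<union> W" "ext g x = ext g y"
  show "x = y"
  proof (cases "x \<in> W"; cases "y \<in> W")
    assume "x \<in> W" "y \<in> W"
    then show ?thesis using xy inj_on_maps[OF g] by (auto simp: ext_def inj_on_def)
  next
    assume *: "x \<in> W" "y \<notin> W"
    then have "g x \<in> R" using xy by (auto simp: ext_def R_def)
    then show ?thesis using mapsD(3)[OF g *(1)] by simp
  next
    assume *: "x \<notin> W" "y \<in> W"
    then have "g y = f x" "x \<in> L" using xy by (auto simp: ext_def)
    then have "g y \<in> R" by (simp add: R_def)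
    then show ?thesis using mapsD(3)[OF g *(2)] by simp
  next
    assume "x \<notin> W" "y \<notin> W"
    then show ?thesis using xy f by (auto simp: ext_def inj_on_def)
  qed
qed

lemma ext_image: "ext g ` (L \<union> W) = R \<union> g ` W"
proof -
  have "ext g ` L = R" using LW unfolding R_def by (intro image_cong refl) (auto simp: ext_def)
  moreover have "ext g ` W = g ` W" by (intro image_cong refl) (simp add: ext_def)
  ultimately show ?thesis by (simp add: image_Un)
qed

lemma ext_range: "g \<in> maps j \<Longrightarrow> ext g ` (L \<union> W) \<subseteq> {1..n}"
  using mapsD(2) f(2) unfolding ext_image R_def by blast

lemma K_edge:
  assumes g: "g \<in> maps j" and e: "e \<in> K g"
  shows "e \<in> vertex_pairs n" "e \<subseteq> R \<union> g ` W" "\<not> e \<subseteq> R"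
proof -
  obtain e' where e': "e' \<in> F" "e = ext g ` e'" using e by (auto simp: K_def)
  have sub: "e' \<subseteq> L \<union> W" and c: "card e' = 2" and nL: "\<not> e' \<subseteq> L" using F e' by auto
  show "e \<subseteq> R \<union> g ` W" using sub e'(2) ext_image[of g] by blast
  have "card e = 2" using c e'(2) card_image[OF inj_on_subset[OF ext_inj[OF g] sub]] by simp
  moreover have "e \<subseteq> {1..n}" using sub e'(2) ext_range[OF g] by blast
  ultimately show "e \<in> vertex_pairs n" by (simp add: vertex_pairs_def)
  obtain x where "x \<in> e'" "x \<in> W" using sub nL by blast
  then have "g x \<in> e" "g x \<notin> R" using e'(2) mapsD(3)[OF g] by (auto simp: ext_def)
  then show "\<not> e \<subseteq> R" by blast
qed

lemma K_sub: "g \<in> maps j \<Longrightarrow> K g \<subseteq> vertex_pairs n"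
  using K_edge(1) by blast

lemma card_K: assumes "g \<in> maps j" shows "card (K g) = card F"
  unfolding K_def
proof (rule card_image)
  have "inj_on ((`) (ext g)) (Pow (L \<union> W))" by (rule inj_on_image_Pow[OF ext_inj[OF assms]])
  then show "inj_on ((`) (ext g)) F" by (rule inj_on_subset) (use F in auto)
qed

lemma card_maps: "j < 2 * b \<Longrightarrow> card (maps j) = m ^ card W"
  unfolding maps_def using finW by (simp add: card_PiE cardB)

lemma m_le_n: "0 < b \<Longrightarrow> m \<le> n"
proof -
  assume "0 < b"
  obtain x where x: "x \<in> W" using W0 by blast
  have "card (B 0 x) \<le> card {1..n}" using B[OF x, of 0] by (intro card_mono) auto
  then show ?thesis using cardB[OF x, of 0] \<open>0 < b\<close> by simp
qed

text \<open>Disjointness of the blocks forces a common edge to come from pattern edges on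
  \<open>L\<close> and the labels where \<open>g\<close> and \<open>h\<close> agree. If these labels
  form \<open>S\<close>, \<open>safe\<close> and \<open>gap\<close> give \<alpha> times the overlap
  \<le> |S| - \<delta>. Agreement on \<open>S\<close> costs about n^|S| in the number of choices for
  \<open>h\<close>, so the \<delta> is a net gain.\<close>

lemma card_K_Int_le:
  assumes g: "g \<in> maps j" and h: "h \<in> maps j" and ne: "K g \<inter> K h \<noteq> {}"
  shows "(1 / p) ^ card (K g \<inter> K h) \<le> real n powr (- \<delta>) * real n ^ card {x \<in> W. g x = h x}"
proof -
  let ?S = "{x \<in> W. g x = h x}"
  have sub: "K g \<inter> K h \<subseteq> (`) (ext g) ` {e \<in> F. e \<subseteq> L \<union> ?S}"
  proof
    fix e assume "e \<in> K g \<inter> K h"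
    then obtain e1 e2 where e: "e1 \<in> F" "e = ext g ` e1" "e2 \<in> F" "e = ext h ` e2"
      by (auto simp: K_def)
    have "e1 \<subseteq> L \<union> ?S"
    proof
      fix x assume x: "x \<in> e1"
      show "x \<in> L \<union> ?S"
      proof (cases "x \<in> L")
        case False
        then have xW: "x \<in> W" using F[OF e(1)] x by blast
        have "ext g x \<in> ext h ` e2" using e x by blast
        then obtain y where y: "y \<in> e2" "ext g x = ext h y" by blast
        have "g x = ext h y" using y xW by (simp add: ext_def)
        have yW: "y \<in> W"
        proof (rule ccontr)
          assume "y \<notin> W"
          then have "ext h y \<in> R" using F[OF e(3)] y by (auto simp: ext_def R_def)
          then show False using mapsD(3)[OF g xW] \<open>g x = ext h y\<close> by simp
        qed
        then have eq: "g x = h y" using \<open>g x = ext h y\<close> by (simp add: ext_def)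
        then have "x = y" using mapsD(1)[OF g xW] mapsD(1)[OF h yW] Bdisj[OF xW yW, of j j] by auto
        then show ?thesis using xW eq by simp
      qed simp
    qed
    then show "e \<in> (`) (ext g) ` {e \<in> F. e \<subseteq> L \<union> ?S}" using e by blast
  qed
  let ?c = "card {e \<in> F. e \<subseteq> L \<union> ?S}"
  have c: "card (K g \<inter> K h) \<le> ?c"
    using surj_card_le[OF _ sub] finF by simp
  \<comment> \<open>A common edge cannot come from \<open>L\<close> alone, because every edge of
    \<open>F\<close> meets \<open>W\<close>.\<close>
  have "?S \<noteq> {}"
  proof
    assume S: "?S = {}"
    obtain e where "e \<in> F" "e \<subseteq> L \<union> ?S" using ne sub by blast
    then show False using F[of e] unfolding S by simp
  qed
  then have lt: "\<alpha> * ?c < card ?S" using safe[of ?S] by blast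
  have cS: "card ?S \<le> \<tau>" "card ?S > 0"
    using card_mono[OF finW, of ?S] cardW \<open>?S \<noteq> {}\<close> finW by (auto simp: card_gt_0_iff)
  have le: "\<alpha> * ?c \<le> card ?S - \<delta>" using gap[of "card ?S" ?c] cS lt by auto
  have "(1 / p) ^ card (K g \<inter> K h) \<le> (1 / p) ^ ?c"
    using p c by (intro power_increasing) auto
  also have "\<dots> = real n powr (\<alpha> * ?c)"
    unfolding power_divide p_power by (simp add: powr_minus field_simps)
  also have "\<dots> \<le> real n powr (card ?S - \<delta>)"
    using le n by (intro powr_mono) auto
  also have "\<dots> = real n powr (- \<delta>) * real n ^ card ?S"
    using n by (simp add: powr_diff powr_minus powr_realpow divide_inverse mult.commute)
  finally show ?thesis .
qed

lemma prob_few_hits: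
  assumes j: "j < 2 * b" and c0: "real n \<le> c0 * real m"
  shows "measure_pmf.prob (random_subset (vertex_pairs n) p) {E. real (hits j E) \<le> \<mu> / 2}
    \<le> 4 * (real n powr (- \<delta>) * (2 * c0) ^ card W)"
proof -
  have b: "0 < b" using j by simp
  have "measure_pmf.prob (random_subset (vertex_pairs n) p)
    {E. real (card {g \<in> maps j. K g \<subseteq> E}) \<le> card (maps j) * p ^ card F / 2}
      \<le> 4 * (real n powr (- \<delta>) * (2 * c0) ^ card W)"
  proof (rule random_subset_second_moment[OF finite_vertex_pairs p fin_maps])
    have "card (maps j) > 0" using card_maps[OF j] m by simp
    then show "maps j \<noteq> {}" by auto
    fix g assume g: "g \<in> maps j"
    show "K g \<subseteq> vertex_pairs n" "card (K g) = card F" using K_sub card_K g by auto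
    have "(\<Sum>h | h \<in> maps j \<and> K g \<inter> K h \<noteq> {}. (1 / p) ^ card (K g \<inter> K h))
      \<le> (\<Sum>h | h \<in> maps j \<and> K g \<inter> K h \<noteq> {}. real n powr (- \<delta>) * real n ^ card {x \<in> W. g x = h x})"
      using g by (intro sum_mono card_K_Int_le) auto
    also have "\<dots> \<le> (\<Sum>h\<in>maps j. real n powr (- \<delta>) * real n ^ card {x \<in> W. g x = h x})"
      using fin_maps by (intro sum_mono2) auto
    also have "\<dots> = real n powr (- \<delta>) * (\<Sum>h\<in>PiE W (B j). real n ^ card {x \<in> W. g x = h x})"
      by (simp add: sum_distrib_left maps_def)
    \<comment> \<open>Per label, the one coinciding vertex contributes n and the others of the block
      at most m \<le> n. The factor \<open>c0\<close> then turns powers of n into powers of the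
      block size m.\<close>
    also have "(\<Sum>h\<in>PiE W (B j). real n ^ card {x \<in> W. g x = h x}) \<le> (2 * real n) ^ card W"
    proof (rule sum_PiE_power_agree_le[OF finW finB])
      fix x assume x: "x \<in> W"
      have "(\<Sum>y\<in>B j x. if g x = y then real n else 1) \<le> (\<Sum>y\<in>B j x. (if g x = y then real n else 0) + 1)"
        by (intro sum_mono) auto
      also have "\<dots> \<le> real n + real (card (B j x))"
        using finB[OF x, of j] by (simp add: sum.distrib)
      also have "\<dots> \<le> 2 * real n" using cardB[OF x j] m_le_n[OF b] by simp
      finally show "(\<Sum>y\<in>B j x. if g x = y then real n else 1) \<le> 2 * real n" .
    qed auto
    also have "(2 * real n) ^ card W \<le> (2 * c0 * real m) ^ card W"
      using c0 by (intro power_mono) auto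
    also have "\<dots> = (2 * c0) ^ card W * card (maps j)"
      by (simp add: card_maps[OF j] power_mult_distrib)
    finally show "(\<Sum>h | h \<in> maps j \<and> K g \<inter> K h \<noteq> {}. (1 / p) ^ card (K g \<inter> K h)) \<le>
        real n powr (- \<delta>) * (2 * c0) ^ card W * real (card (maps j))"
      by (simp add: mult_left_mono mult.assoc)
  qed
  then show ?thesis by (simp add: hits_def \<mu>_def card_maps[OF j])
qed

text \<open>\<open>hits j\<close> depends only on the edges that embeddings of family
  \<open>j\<close> can use. Such an edge has an endpoint in a block of family \<open>j\<close> and
  lies within \<open>R\<close> and these blocks, so different families look at disjoint edge sets
  and are independent.\<close>

lemma prob_all_few_hits:
  assumes J: "J \<subseteq> {..<2 * b}" and c0: "real n \<le> c0 * real m"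
  shows "measure_pmf.prob (random_subset (vertex_pairs n) p) {E. \<forall>j\<in>J. real (hits j E) \<le> \<mu> / 2}
    \<le> (4 * (real n powr (- \<delta>) * (2 * c0) ^ card W)) ^ card J"
proof -
  define I where "I j = (\<Union>g\<in>maps j. K g)" for j
  have hits_I: "hits j (E \<inter> I j) = hits j E" for j E
    unfolding hits_def by (rule arg_cong[where f = card]) (auto simp: I_def)
  have finJ: "finite J" using J finite_subset by blast
  have blocks: "\<exists>x\<in>W. e \<inter> B j x \<noteq> {}" and blocks': "e \<subseteq> R \<union> (\<Union>x\<in>W. B j x)" if "e \<in> I j" for e j
  proof -
    obtain g where g: "g \<in> maps j" "e \<in> K g" using \<open>e \<in> I j\<close> by (auto simp: I_def)
    then show "\<exists>x\<in>W. e \<inter> B j x \<noteq> {}" using K_edge(2,3)[OF g] mapsD(1)[OF g(1)] by blast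
    show "e \<subseteq> R \<union> (\<Union>x\<in>W. B j x)" using K_edge(2)[OF g] mapsD(1)[OF g(1)] by blast
  qed
  have disj: "I i \<inter> I j = {}" if "i \<noteq> j" for i j
  proof (rule ccontr)
    assume "I i \<inter> I j \<noteq> {}"
    then obtain e where e: "e \<in> I i" "e \<in> I j" by blast
    obtain x z where x: "x \<in> W" "z \<in> e" "z \<in> B i x" using blocks[OF e(1)] by blast
    have "z \<notin> R" using B[OF x(1), of i] x(3) by (auto simp: R_def)
    then obtain y where y: "y \<in> W" "z \<in> B j y" using blocks'[OF e(2)] x(2) by blast
    show False using Bdisj[OF x(1) y(1), of i j] that x(3) y(2) by blast
  qed
  have "measure_pmf.prob (random_subset (vertex_pairs n) p) {E. \<forall>j\<in>J. real (hits j E) \<le> \<mu> / 2} =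
    measure_pmf.prob (random_subset (vertex_pairs n) p) {E. \<forall>j\<in>J. real (hits j (E \<inter> I j)) \<le> \<mu> / 2}"
    by (simp add: hits_I)
  also have "\<dots> = (\<Prod>j\<in>J. measure_pmf.prob (random_subset (vertex_pairs n) p)
      {E. real (hits j (E \<inter> I j)) \<le> \<mu> / 2})"
  proof (rule random_subset_indep[OF finite_vertex_pairs finJ])
    show "I j \<subseteq> vertex_pairs n" for j using K_sub by (auto simp: I_def)
  qed (rule disj)
  also have "\<dots> \<le> (\<Prod>j\<in>J. 4 * (real n powr (- \<delta>) * (2 * c0) ^ card W))"
    unfolding hits_I using J by (intro prod_mono conjI prob_few_hits c0) auto
  finally show ?thesis by simp
qed

section \<open>Witnesses against an embedding and their joint moment\<close>

definition pairs_in :: "nat set \<Rightarrow> nat set set" where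
  "pairs_in S = {e. e \<subseteq> S \<and> card e = 2}"

text \<open>A witness for \<open>g\<close> not being a suitable extension: vertices \<open>D\<close> and edges \<open>Q\<close> (possibly
  \<open>D = {}\<close> and a single superfluous edge) that make the extension denser. The last condition is
  what closedness of \<open>R\<close> gives; it controls the overlaps between witnesses.\<close>

definition bad :: "nat \<Rightarrow> ((nat \<Rightarrow> nat) \<times> nat set \<times> nat set set) set" where
  "bad j = {(g, D, Q). g \<in> maps j \<and> D \<subseteq> {1..n} - (R \<union> g ` W) \<and> card D \<le> u \<and>
     Q \<subseteq> pairs_in (R \<union> g ` W \<union> D) \<and> (\<forall>e\<in>Q. \<not> e \<subseteq> R) \<and> Q \<inter> K g = {} \<and>
     real (card D) + \<delta> \<le> \<alpha> * card Q \<and>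
     (\<forall>S. S \<subseteq> g ` W \<union> D \<and> S \<noteq> {} \<longrightarrow> \<alpha> * card {e \<in> K g \<union> Q. e \<subseteq> R \<union> S} \<le> card S)}"

definition KB where "KB T = (case T of (g, D, Q) \<Rightarrow> K g \<union> Q)"

definition bads where "bads j E = card {T \<in> bad j. KB T \<subseteq> E}"

text \<open>A superset of the possible \<open>Q\<close>, empty for large \<open>D\<close>, so that
  the sum may run over all \<open>D\<close> while each fibre still has a uniformly bounded
  size.\<close>

definition Qs where "Qs g D = (if card D \<le> u then Pow (pairs_in (R \<union> g ` W \<union> D)) else {})"

lemma finite_pairs_in: "finite S \<Longrightarrow> finite (pairs_in S)"
  by (rule finite_subset[of _ "Pow S"]) (auto simp: pairs_in_def)

lemma finite_Qs: "D \<subseteq> {1..n} \<Longrightarrow> finite (Qs g D)"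
  using finR finW finite_subset[of D "{1..n}"] by (auto simp: Qs_def intro!: finite_pairs_in)

lemma card_Qs: assumes D: "D \<subseteq> {1..n}" shows "card (Qs g D) \<le> 2 ^ (4 * \<tau>\<^sup>2)"
proof (cases "card D \<le> u")
  case True
  let ?V = "R \<union> g ` W \<union> D"
  have finV: "finite ?V" using finR finW D finite_subset by auto
  have "card ?V \<le> card R + card (g ` W) + card D"
    by (meson add_le_mono card_Un_le le_refl le_trans)
  also have "\<dots> \<le> \<tau> + card W + u"
    using cardR card_image_le[OF finW, of g] True by linarith
  also have "\<dots> \<le> 2 * \<tau>" using cardW by simp
  finally have "(card ?V)\<^sup>2 \<le> (2 * \<tau>)\<^sup>2" by (rule power_mono) simp
  then have "card (pairs_in ?V) \<le> 4 * \<tau>\<^sup>2"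
    using card_pairs_le[OF finV] by (simp add: pairs_in_def power_mult_distrib)
  then show ?thesis
    using True finite_pairs_in[OF finV] by (simp add: Qs_def card_Pow power_increasing)
qed (simp add: Qs_def)

lemma bad_sub: "bad j \<subseteq> (SIGMA g : maps j. SIGMA D : Pow {1..n}. Qs g D)"
  by (auto simp: bad_def Qs_def)

lemma fin_bad: "finite (bad j)"
  by (rule finite_subset[OF bad_sub]) (auto intro!: finite_SigmaI fin_maps finite_Qs)

lemma KB_edge:
  assumes "(g, D, Q) \<in> bad j" "e \<in> K g \<union> Q"
  shows "e \<in> vertex_pairs n" "e \<subseteq> R \<union> (g ` W \<union> D)" "\<not> e \<subseteq> R"
proof -
  have g: "g \<in> maps j" and D: "D \<subseteq> {1..n}" and Q: "Q \<subseteq> pairs_in (R \<union> g ` W \<union> D)" "\<forall>e\<in>Q. \<not> e \<subseteq> R"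
    using assms(1) by (auto simp: bad_def)
  have "R \<union> g ` W \<subseteq> {1..n}" using ext_range[OF g] by (simp add: ext_image)
  then have VD: "R \<union> g ` W \<union> D \<subseteq> {1..n}" using D by blast
  from assms(2) have "e \<in> vertex_pairs n \<and> e \<subseteq> R \<union> (g ` W \<union> D) \<and> \<not> e \<subseteq> R"
  proof
    assume "e \<in> K g"
    from K_edge[OF g this] show ?thesis by blast
  next
    assume e: "e \<in> Q"
    then have "e \<subseteq> R \<union> g ` W \<union> D" "card e = 2" using Q(1) by (auto simp: pairs_in_def)
    moreover from this have "e \<subseteq> {1..n}" using VD by (metis order_trans)
    ultimately show ?thesis using Q(2) e by (simp add: vertex_pairs_def Un_assoc)
  qed
  then show "e \<in> vertex_pairs n" "e \<subseteq> R \<union> (g ` W \<union> D)" "\<not> e \<subseteq> R" by blast+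
qed

text \<open>Edges of the witness that are already in \<open>U\<close> are free. They lie on
  \<open>R\<close> and on the set \<open>S\<close> of witness vertices covered by \<open>U\<close>,
  so admissibility bounds \<alpha> times their number by |S|: overlap gains at most a factor n per
  reused vertex. This is what reusing a vertex loses in choices, up to the number of covered
  vertices. The excess \<delta> of the witness survives as the factor n^(-\<delta>).\<close>

lemma p_power_bad_le:
  assumes T: "(g, D, Q) \<in> bad j" and U: "U \<subseteq> vertex_pairs n" and A: "A = \<Union>U - R"
  shows "p ^ card (K g \<union> Q - U) \<le> real n powr (- \<alpha> * card F - \<delta>) *
    real n ^ card {x \<in> W. g x \<in> A} * (real n ^ card (D \<inter> A) / real n ^ card D)"
proof -
  have g: "g \<in> maps j" and D: "D \<subseteq> {1..n} - (R \<union> g ` W)"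
    and QK: "Q \<inter> K g = {}" and Q: "real (card D) + \<delta> \<le> \<alpha> * card Q"
    and adm: "\<And>S. S \<subseteq> g ` W \<union> D \<Longrightarrow> S \<noteq> {} \<Longrightarrow> \<alpha> * card {e \<in> K g \<union> Q. e \<subseteq> R \<union> S} \<le> card S"
    using T by (auto simp: bad_def)
  have finKQ: "finite (K g \<union> Q)"
    by (rule finite_subset[OF _ finite_vertex_pairs[of n]]) (use KB_edge(1)[OF T] in blast)
  have finD: "finite D" using D by (meson finite_Diff finite_atLeastAtMost finite_subset)
  define S where "S = (g ` W \<union> D) \<inter> A"
  have cS: "card S = card {x \<in> W. g x \<in> A} + card (D \<inter> A)"
  proof -
    have "S = g ` {x \<in> W. g x \<in> A} \<union> (D \<inter> A)" by (auto simp: S_def)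
    moreover have "card (g ` {x \<in> W. g x \<in> A}) = card {x \<in> W. g x \<in> A}"
      by (rule card_image) (rule inj_on_subset[OF inj_on_maps[OF g]], auto)
    ultimately show ?thesis
      using D finW finD card_Un_disjoint[of "g ` {x \<in> W. g x \<in> A}" "D \<inter> A"] by auto
  qed
  have sub: "(K g \<union> Q) \<inter> U \<subseteq> {e \<in> K g \<union> Q. e \<subseteq> R \<union> S}"
    using KB_edge(2)[OF T] by (auto simp: S_def A)
  have SU: "\<alpha> * card ((K g \<union> Q) \<inter> U) \<le> card S"
  proof (cases "S = {}")
    case True
    have "(K g \<union> Q) \<inter> U = {}" using sub KB_edge(3)[OF T] unfolding True by auto
    then show ?thesis by simp
  next
    case False
    have "\<alpha> * card ((K g \<union> Q) \<inter> U) \<le> \<alpha> * card {e \<in> K g \<union> Q. e \<subseteq> R \<union> S}"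
      using \<alpha> card_mono[OF _ sub] finKQ by simp
    also have "\<dots> \<le> card S" using False by (intro adm) (auto simp: S_def)
    finally show ?thesis .
  qed
  have "card (K g \<union> Q) = card F + card Q"
    using card_Un_disjoint[of "K g" Q] QK finKQ card_K[OF g] by auto
  moreover have "card (K g \<union> Q) = card ((K g \<union> Q) \<inter> U) + card (K g \<union> Q - U)"
    using card_Int_Diff[OF finKQ] by simp
  ultimately have c: "real (card (K g \<union> Q - U)) =
      real (card F) + real (card Q) - real (card ((K g \<union> Q) \<inter> U))" by simp
  have "- \<alpha> * card (K g \<union> Q - U) = - \<alpha> * card F - \<alpha> * card Q + \<alpha> * card ((K g \<union> Q) \<inter> U)"
    unfolding c by (simp add: algebra_simps)
  also have "\<dots> \<le> - \<alpha> * card F - \<delta> + card {x \<in> W. g x \<in> A} + card (D \<inter> A) - card D"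
    using SU cS Q by simp
  finally have "p ^ card (K g \<union> Q - U) \<le>
      real n powr (- \<alpha> * card F - \<delta> + card {x \<in> W. g x \<in> A} + card (D \<inter> A) - card D)"
    unfolding p_power using n by (intro powr_mono) auto
  also have "\<dots> = real n powr (- \<alpha> * card F - \<delta>) * real n ^ card {x \<in> W. g x \<in> A} *
      (real n ^ card (D \<inter> A) / real n ^ card D)"
    using n unfolding powr_diff[of _ _ "real (card D)"] powr_add by (simp add: powr_realpow)
  finally show ?thesis .
qed

text \<open>With at most \<open>a\<close> covered vertices: a power of 2 for the choices of
  \<open>Q\<close>; per label n free choices or \<open>a\<close> covered ones, each of weight n; and
  the bound for the sum over \<open>D\<close>. Compared with \<mu> this is n^(-\<delta>) up to
  combinatorial factors.\<close>

definition \<kappa> where "\<kappa> a = real n powr (- \<alpha> * card F - \<delta>) * 2 ^ (4 * \<tau>\<^sup>2) *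
    (real n * (1 + real a)) ^ card W * (4 * 2 ^ a)"

lemma sum_bad_le:
  assumes U: "U \<subseteq> vertex_pairs n" and a: "card (\<Union>U - R) \<le> a"
  shows "(\<Sum>T\<in>bad j. p ^ card (KB T - U)) \<le> \<kappa> a"
proof -
  define A where "A = \<Union>U - R"
  define C where "C = real n powr (- \<alpha> * card F - \<delta>)"
  define w1 where "w1 g = real n ^ card {x \<in> W. g x \<in> A}" for g
  define w2 where "w2 D = real n ^ card (D \<inter> A) / real n ^ card D" for D
  have nonneg: "C \<ge> 0" "w1 g \<ge> 0" "w2 D \<ge> 0" for g D by (auto simp: C_def w1_def w2_def)
  have An: "A \<subseteq> {1..n}" using U by (auto simp: A_def vertex_pairs_def)
  then have finA: "finite A" using finite_subset by blast
  have cA: "card A \<le> a" using a by (simp add: A_def)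
  have "(\<Sum>T\<in>bad j. p ^ card (KB T - U)) \<le> (\<Sum>T\<in>bad j. case T of (g, D, Q) \<Rightarrow> C * w1 g * w2 D)"
  proof (rule sum_mono)
    fix T assume T: "T \<in> bad j"
    obtain g D Q where [simp]: "T = (g, D, Q)" by (cases T)
    show "p ^ card (KB T - U) \<le> (case T of (g, D, Q) \<Rightarrow> C * w1 g * w2 D)"
      using p_power_bad_le[OF _ U A_def, of g D Q j] T by (simp add: KB_def C_def w1_def w2_def)
  qed
  also have "\<dots> \<le> (\<Sum>T\<in>(SIGMA g : maps j. SIGMA D : Pow {1..n}. Qs g D). case T of (g, D, Q) \<Rightarrow> C * w1 g * w2 D)"
    by (intro sum_mono2 bad_sub finite_SigmaI fin_maps finite_Qs) (auto simp: nonneg)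
  also have "\<dots> = (\<Sum>g\<in>maps j. \<Sum>D\<in>Pow {1..n}. \<Sum>Q\<in>Qs g D. C * w1 g * w2 D)"
    by (subst sum.Sigma[symmetric], simp add: fin_maps, intro ballI finite_SigmaI finite_Qs, auto)
      (intro sum.cong refl, subst sum.Sigma[symmetric], auto intro!: finite_Qs)
  also have "\<dots> \<le> (\<Sum>g\<in>maps j. \<Sum>D\<in>Pow {1..n}. 2 ^ (4 * \<tau>\<^sup>2) * (C * w1 g * w2 D))"
  proof (intro sum_mono)
    fix g D assume D: "D \<in> Pow {1..n}"
    have "real (card (Qs g D)) \<le> 2 ^ (4 * \<tau>\<^sup>2)"
      using card_Qs[of D g] D by (metis PowD of_nat_le_iff of_nat_numeral of_nat_power)
    then show "(\<Sum>Q\<in>Qs g D. C * w1 g * w2 D) \<le> 2 ^ (4 * \<tau>\<^sup>2) * (C * w1 g * w2 D)"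
      using nonneg by (simp add: mult_right_mono)
  qed
  also have "\<dots> = C * 2 ^ (4 * \<tau>\<^sup>2) * (\<Sum>g\<in>maps j. w1 g) * (\<Sum>D\<in>Pow {1..n}. w2 D)"
    by (simp add: sum_distrib_left sum_distrib_right mult_ac)
  also have "\<dots> \<le> C * 2 ^ (4 * \<tau>\<^sup>2) * (real n * (1 + real a)) ^ card W * (4 * 2 ^ a)"
  proof (intro mult_mono mult_left_mono)
    show "(\<Sum>g\<in>maps j. w1 g) \<le> (real n * (1 + real a)) ^ card W"
      unfolding w1_def maps_def
    proof (rule sum_PiE_power_agree_le[OF finW finB])
      fix x assume x: "x \<in> W"
      have "(\<Sum>y\<in>B j x. if y \<in> A then real n else 1) \<le> (\<Sum>y\<in>{1..n}. if y \<in> A then real n else 1)"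
        using B[OF x] by (intro sum_mono2) auto
      also have "\<dots> \<le> (\<Sum>y\<in>{1..n}. (if y \<in> A then real n else 0) + 1)"
        by (intro sum_mono) auto
      also have "\<dots> = real n * card A + real n"
        using An by (simp add: sum.distrib sum.If_cases Int_absorb1 mult.commute)
      also have "\<dots> \<le> real n * (1 + real a)" using cA n by (simp add: algebra_simps)
      finally show "(\<Sum>y\<in>B j x. if y \<in> A then real n else 1) \<le> real n * (1 + real a)" .
    qed auto
    show "(\<Sum>D\<in>Pow {1..n}. w2 D) \<le> 4 * 2 ^ a"
      unfolding w2_def using cA An n by (intro sum_Pow_weight_le) (auto simp: Int_absorb2)
  qed (auto intro!: sum_nonneg simp: nonneg)
  finally show ?thesis by (simp add: \<kappa>_def C_def)
qed

lemma \<mu>_pos: "\<mu> > 0"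
  using m p by (simp add: \<mu>_def)

text \<open>Markov's inequality for the product of the counts. A witness covers at most
  \<open>card W + u \<le> \<tau>\<close> vertices outside \<open>R\<close>, so at most
  \<open>2 * b\<close> of them cover \<open>2 * b * \<tau>\<close>; the vertices of \<open>R\<close>
  are never charged.\<close>

lemma prob_many_bads:
  assumes J: "J \<subseteq> {..<2 * b}"
  shows "measure_pmf.prob (random_subset (vertex_pairs n) p) {E. \<forall>j\<in>J. \<mu> / 2 \<le> real (bads j E)}
    \<le> (2 * \<kappa> (2 * b * \<tau>) / \<mu>) ^ card J"
proof -
  let ?M = "random_subset (vertex_pairs n) p"
  let ?k = "\<kappa> (2 * b * \<tau>)"
  define P where "P i U \<longleftrightarrow> U \<subseteq> vertex_pairs n \<and> card (\<Union>U - R) \<le> i * \<tau>" for i U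
  have finJ: "finite J" using J finite_subset by blast
  have cJ: "card J \<le> 2 * b" using card_mono[OF _ J] by simp
  have k0: "?k \<ge> 0" by (simp add: \<kappa>_def)
  have mom: "measure_pmf.expectation ?M
      (\<lambda>E. of_bool ({} \<subseteq> E) * (\<Prod>j\<in>J. real (card {T \<in> bad j. KB T \<subseteq> E}))) \<le> ?k ^ card J * p ^ card ({} :: nat set set)"
  proof (rule random_subset_product_moment[where P = P and m = "2 * b" and i = 0])
    show "P (Suc i) (U \<union> KB T)" if "P i U" "T \<in> bad j" for i j U T
    proof -
      obtain g D Q where T: "T = (g, D, Q)" by (cases T)
      then have bad: "(g, D, Q) \<in> bad j" using that by simp
      have D: "D \<subseteq> {1..n}" "card D \<le> u" using bad by (auto simp: bad_def)
      have finD: "finite D" using D(1) finite_subset by blast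
      have finU: "finite (\<Union>U - R)"
        by (rule finite_subset[of _ "{1..n}"]) (use that in \<open>auto simp: P_def vertex_pairs_def\<close>)
      have "\<Union>(U \<union> KB T) - R \<subseteq> (\<Union>U - R) \<union> (g ` W \<union> D)"
        using KB_edge(2)[OF bad] by (auto simp: T KB_def)
      then have "card (\<Union>(U \<union> KB T) - R) \<le> card ((\<Union>U - R) \<union> (g ` W \<union> D))"
        using finU finW finD by (intro card_mono) auto
      also have "\<dots> \<le> card (\<Union>U - R) + card (g ` W \<union> D)" by (rule card_Un_le)
      also have "card (g ` W \<union> D) \<le> card W + u"
        using card_Un_le[of "g ` W" D] card_image_le[OF finW, of g] D(2) by linarith
      also have "card (\<Union>U - R) + (card W + u) \<le> Suc i * \<tau>"
        using that(1) cardW by (simp add: P_def)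
      finally show ?thesis
        using that(1) KB_edge(1)[OF bad] unfolding P_def T KB_def by auto
    qed
    show "(\<Sum>T\<in>bad j. p ^ card (KB T - U)) \<le> ?k" if "P i U" "i < 2 * b" for i j U
    proof (rule sum_bad_le)
      show "U \<subseteq> vertex_pairs n" using that by (simp add: P_def)
      have "card (\<Union>U - R) \<le> i * \<tau>" using that by (simp add: P_def)
      also have "\<dots> \<le> 2 * b * \<tau>" using that(2) by (intro mult_right_mono) auto
      finally show "card (\<Union>U - R) \<le> 2 * b * \<tau>" .
    qed
  qed (use p k0 finJ cJ in \<open>auto simp: finite_vertex_pairs fin_bad P_def\<close>)
  have "measure_pmf.prob ?M {E. \<forall>j\<in>J. \<mu> / 2 \<le> real (bads j E)} \<le>
      measure_pmf.expectation ?M (\<lambda>E. (2 / \<mu>) ^ card J * (\<Prod>j\<in>J. real (bads j E)))"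
  proof (rule prob_pmf_le_expectation)
    show "integrable (measure_pmf ?M) (\<lambda>E. (2 / \<mu>) ^ card J * (\<Prod>j\<in>J. real (bads j E)))"
      by (rule integrable_random_subset[OF finite_vertex_pairs])
    show "0 \<le> (2 / \<mu>) ^ card J * (\<Prod>j\<in>J. real (bads j E))" for E
      using \<mu>_pos by (simp add: prod_nonneg)
    fix E assume E: "E \<in> {E. \<forall>j\<in>J. \<mu> / 2 \<le> real (bads j E)}"
    have "(\<Prod>j\<in>J. 1 :: real) \<le> (\<Prod>j\<in>J. 2 / \<mu> * real (bads j E))"
      using E \<mu>_pos by (intro prod_mono) (auto simp: field_simps)
    then show "1 \<le> (2 / \<mu>) ^ card J * (\<Prod>j\<in>J. real (bads j E))"
      by (simp only: prod.distrib prod_constant) simp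
  qed
  also have "\<dots> = (2 / \<mu>) ^ card J * measure_pmf.expectation ?M (\<lambda>E. \<Prod>j\<in>J. real (bads j E))"
    by simp
  also have "\<dots> \<le> (2 / \<mu>) ^ card J * ?k ^ card J"
    using mom \<mu>_pos by (intro mult_left_mono) (auto simp: bads_def)
  also have "\<dots> = (2 * ?k / \<mu>) ^ card J" by (simp flip: power_mult_distrib)
  finally show ?thesis .
qed

section \<open>From failed extensions to witnesses\<close>

definition extends :: "nat set set \<Rightarrow> (nat \<Rightarrow> nat) \<Rightarrow> bool" where
  "extends E g \<longleftrightarrow> (\<forall>x\<in>L. g x = f x) \<and> inj_on g (L \<union> W) \<and> g ` (L \<union> W) \<subseteq> {1..n} \<and>
     (\<forall>x\<in>W. \<forall>y\<in>L \<union> W. {g x, g y} \<in> E \<longleftrightarrow> {x, y} \<in> F) \<and>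
     t_closed \<alpha> ({1..n}, E) u (g ` (L \<union> W))"

lemma bad_witness:
  assumes E: "E \<subseteq> vertex_pairs n" and cl: "t_closed \<alpha> ({1..n}, E) (card W + u) R"
    and g: "g \<in> maps j" and Kg: "K g \<subseteq> E" and no: "\<not> extends E (ext g)"
  shows "\<exists>D Q. (g, D, Q) \<in> bad j \<and> K g \<union> Q \<subseteq> E"
proof -
  have gn: "g ` W \<subseteq> {1..n} - R" using mapsD[OF g] by blast
  have finE: "finite E" using E finite_vertex_pairs finite_subset by blast
  have adm: "\<alpha> * card {e \<in> K g \<union> Q. e \<subseteq> R \<union> S} \<le> card S"
    if "Q \<subseteq> E" "\<forall>e\<in>Q. \<not> e \<subseteq> R" "D \<subseteq> {1..n} - (R \<union> g ` W)" "card D \<le> u" "S \<subseteq> g ` W \<union> D" "S \<noteq> {}"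
    for D Q S
  proof -
    have finD: "finite D" using that(3) by (meson finite_Diff finite_atLeastAtMost finite_subset)
    have "card S \<le> card (g ` W \<union> D)" using that(5) finW finD by (intro card_mono) auto
    also have "\<dots> \<le> card W + u"
      using card_Un_le[of "g ` W" D] card_image_le[OF finW, of g] that(4) by linarith
    finally have "card S \<le> card W + u" .
    moreover have "S \<subseteq> {1..n} - R" using that(3,5) gn by blast
    ultimately have "\<alpha> * card (ext_edges E R (R \<union> S)) < card S"
      using cl[unfolded t_closed_def, rule_format, of S] that(6) by simp
    moreover have "card {e \<in> K g \<union> Q. e \<subseteq> R \<union> S} \<le> card (ext_edges E R (R \<union> S))"
    proof (rule card_mono)
      show "finite (ext_edges E R (R \<union> S))" by (rule finite_ext_edges[OF finE])
      show "{e \<in> K g \<union> Q. e \<subseteq> R \<union> S} \<subseteq> ext_edges E R (R \<union> S)"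
        using that(1,2) Kg K_edge(3)[OF g] by (auto simp: ext_edges_def)
    qed
    ultimately show ?thesis using \<alpha> by (smt (verit) mult_left_mono of_nat_mono)
  qed
  have "(\<exists>x\<in>W. \<exists>y\<in>L \<union> W. ({ext g x, ext g y} \<in> E) \<noteq> ({x, y} \<in> F)) \<or>
      \<not> t_closed \<alpha> ({1..n}, E) u (R \<union> g ` W)"
  proof -
    have "\<forall>x\<in>L. ext g x = f x" using LW by (auto simp: ext_def)
    then show ?thesis
      using no ext_inj[OF g] ext_range[OF g] unfolding extends_def ext_image by blast
  qed
  then consider (extra) x y where "x \<in> W" "y \<in> L \<union> W" "({ext g x, ext g y} \<in> E) \<noteq> ({x, y} \<in> F)"
    | (dense) "\<not> t_closed \<alpha> ({1..n}, E) u (R \<union> g ` W)" by blast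
  then show ?thesis
  proof cases
    case extra
    have "{ext g x, ext g y} \<in> K g" if "{x, y} \<in> F"
      unfolding K_def by (rule image_eqI[OF _ that]) simp
    then have e: "{ext g x, ext g y} \<in> E" "{x, y} \<notin> F" using extra Kg by auto
    let ?e = "{ext g x, ext g y}"
    have xW: "ext g x = g x" using extra by (simp add: ext_def)
    have nK: "?e \<notin> K g"
    proof
      assume "?e \<in> K g"
      then obtain e' where e': "e' \<in> F" "ext g ` {x, y} = ext g ` e'" by (auto simp: K_def)
      have "{x, y} = e'"
        using inj_on_image_eq_iff[OF ext_inj[OF g], of "{x, y}" e'] e' F[OF e'(1)] extra by auto
      then show False using e e' by simp
    qed
    have "\<delta> \<le> \<bar>real 0 - \<alpha> * real 1\<bar>" by (rule gap) auto
    then have "\<delta> \<le> \<alpha>" using \<alpha> by simp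
    have eR: "?e \<subseteq> R \<union> g ` W" using extra ext_image[of g] by blast
    have nR: "\<not> ?e \<subseteq> R" using mapsD(3)[OF g extra(1)] xW by auto
    have "?e \<in> pairs_in (R \<union> g ` W \<union> {})"
      using e(1) E eR by (auto simp: pairs_in_def vertex_pairs_def)
    moreover have adm1: "\<forall>S. S \<subseteq> g ` W \<union> {} \<and> S \<noteq> {} \<longrightarrow>
        \<alpha> * card {e \<in> K g \<union> {?e}. e \<subseteq> R \<union> S} \<le> card S"
      by (intro allI impI adm[of "{?e}" "{}"]) (use nR e(1) in simp_all)
    ultimately have "(g, {}, {?e}) \<in> bad j"
      unfolding bad_def using g nK \<open>\<delta> \<le> \<alpha>\<close> nR adm1 by (simp del: Un_insert_right)
    then show ?thesis using e(1) Kg by blast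
  next
    case dense
    then obtain D where D: "D \<subseteq> {1..n} - (R \<union> g ` W)" "D \<noteq> {}" "card D \<le> u"
      and le: "real (card D) \<le> \<alpha> * card (ext_edges E (R \<union> g ` W) (R \<union> g ` W \<union> D))"
      unfolding t_closed_def by (auto simp: not_less)
    let ?Q = "ext_edges E (R \<union> g ` W) (R \<union> g ` W \<union> D)"
    have finD: "finite D" using D(1) by (meson finite_Diff finite_atLeastAtMost finite_subset)
    have cD: "0 < card D" "card D \<le> \<tau>" using D finD cardW by (auto simp: card_gt_0_iff)
    \<comment> \<open>The gap turns the bare failure of closedness into a margin of
      \<delta>.\<close>
    have "real (card D) + \<delta> \<le> \<alpha> * card ?Q" using gap[of "card D" "card ?Q"] cD le by auto
    moreover have QE: "?Q \<subseteq> E" and QR: "\<forall>e\<in>?Q. \<not> e \<subseteq> R" by (auto simp: ext_edges_def)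
    moreover have "?Q \<subseteq> pairs_in (R \<union> g ` W \<union> D)"
      using E by (auto simp: ext_edges_def pairs_in_def vertex_pairs_def)
    moreover have "?Q \<inter> K g = {}" using K_edge(2)[OF g] by (auto simp: ext_edges_def)
    moreover have "\<forall>S. S \<subseteq> g ` W \<union> D \<and> S \<noteq> {} \<longrightarrow>
        \<alpha> * card {e \<in> K g \<union> ?Q. e \<subseteq> R \<union> S} \<le> card S"
      using adm[OF QE QR D(1,3)] by blast
    ultimately have "(g, D, ?Q) \<in> bad j"
      unfolding bad_def using g D by blast
    then show ?thesis using QE Kg by blast
  qed
qed

lemma hits_le_bads:
  assumes E: "E \<subseteq> vertex_pairs n" and cl: "t_closed \<alpha> ({1..n}, E) (card W + u) R"
    and no: "\<not> (\<exists>g. extends E g)"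
  shows "hits j E \<le> bads j E"
proof -
  have "{g \<in> maps j. K g \<subseteq> E} \<subseteq> fst ` {T \<in> bad j. KB T \<subseteq> E}"
  proof
    fix g assume "g \<in> {g \<in> maps j. K g \<subseteq> E}"
    then obtain D Q where "(g, D, Q) \<in> bad j" "K g \<union> Q \<subseteq> E"
      using bad_witness[OF E cl] no by blast
    then show "g \<in> fst ` {T \<in> bad j. KB T \<subseteq> E}"
      by (intro image_eqI[of _ _ "(g, D, Q)"]) (auto simp: KB_def)
  qed
  then show ?thesis unfolding hits_def bads_def
    by (rule surj_card_le[rotated]) (simp add: fin_bad)
qed

text \<open>If no copy works, every hit has a witness, so in each family
  \<open>hits \<le> bads\<close> and the threshold \<mu>/2 separates them: too few hits or too many
  witnesses. Closedness of \<open>R\<close> is part of the event, so nothing is conditioned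
  on.\<close>

lemma prob_no_extension:
  assumes c0: "real n \<le> c0 * real m" and \<epsilon>: "\<epsilon> \<le> 1"
    and \<epsilon>1: "4 * (real n powr (- \<delta>) * (2 * c0) ^ card W) \<le> \<epsilon>"
    and \<epsilon>2: "2 * \<kappa> (2 * b * \<tau>) / \<mu> \<le> \<epsilon>"
  shows "measure_pmf.prob (random_subset (vertex_pairs n) p)
    {E. t_closed \<alpha> ({1..n}, E) (card W + u) R \<and> \<not> (\<exists>g. extends E g)} \<le> (4 * \<epsilon>) ^ b"
proof -
  let ?M = "random_subset (vertex_pairs n) p"
  have k0: "\<kappa> (2 * b * \<tau>) \<ge> 0" by (simp add: \<kappa>_def)
  have \<epsilon>0: "0 \<le> \<epsilon>" using order_trans[OF _ \<epsilon>2] k0 \<mu>_pos by simp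
  have c0': "0 \<le> c0" using c0 n m by (smt (verit) mult_nonneg_nonneg mult_neg_pos of_nat_0_le_iff of_nat_0_less_iff less_le_trans zero_less_one)
  have "measure_pmf.prob ?M {E. t_closed \<alpha> ({1..n}, E) (card W + u) R \<and> \<not> (\<exists>g. extends E g)} =
     measure_pmf.prob ?M ({E. t_closed \<alpha> ({1..n}, E) (card W + u) R \<and> \<not> (\<exists>g. extends E g)} \<inter> set_pmf ?M)"
    by (rule measure_Int_set_pmf[symmetric])
  also have "\<dots> \<le> measure_pmf.prob ?M {E. \<forall>j<2 * b. real (hits j E) \<le> \<mu> / 2 \<or> \<mu> / 2 \<le> real (bads j E)}"
  proof (rule measure_pmf.finite_measure_mono)
    have "real (hits j E) \<le> \<mu> / 2 \<or> \<mu> / 2 \<le> real (bads j E)"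
      if "t_closed \<alpha> ({1..n}, E) (card W + u) R" "\<not> (\<exists>g. extends E g)" "E \<in> set_pmf ?M" for j E
    proof -
      have "E \<subseteq> vertex_pairs n" using that(3) set_pmf_random_subset by blast
      from hits_le_bads[OF this that(1,2)] have "real (hits j E) \<le> real (bads j E)" by simp
      then show ?thesis by linarith
    qed
    then show "{E. t_closed \<alpha> ({1..n}, E) (card W + u) R \<and> \<not> (\<exists>g. extends E g)} \<inter> set_pmf ?M
      \<subseteq> {E. \<forall>j<2 * b. real (hits j E) \<le> \<mu> / 2 \<or> \<mu> / 2 \<le> real (bads j E)}" by blast
  qed simp
  also have "\<dots> \<le> (4 * \<epsilon>) ^ b"
  proof (rule prob_all_disj_le[OF \<epsilon>0 \<epsilon>])
    fix J assume J: "J \<subseteq> {..<2 * b}"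
    have "measure_pmf.prob ?M {E. \<forall>j\<in>J. real (hits j E) \<le> \<mu> / 2}
        \<le> (4 * (real n powr (- \<delta>) * (2 * c0) ^ card W)) ^ card J"
      by (rule prob_all_few_hits[OF J c0])
    also have "\<dots> \<le> \<epsilon> ^ card J" using \<epsilon>1 c0' by (intro power_mono) auto
    finally show "measure_pmf.prob ?M {E. \<forall>j\<in>J. real (hits j E) \<le> \<mu> / 2} \<le> \<epsilon> ^ card J" .
    have "measure_pmf.prob ?M {E. \<forall>j\<in>J. \<mu> / 2 \<le> real (bads j E)} \<le> (2 * \<kappa> (2 * b * \<tau>) / \<mu>) ^ card J"
      by (rule prob_many_bads[OF J])
    also have "\<dots> \<le> \<epsilon> ^ card J" using \<epsilon>2 k0 \<mu>_pos by (intro power_mono) auto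
    finally show "measure_pmf.prob ?M {E. \<forall>j\<in>J. \<mu> / 2 \<le> real (bads j E)} \<le> \<epsilon> ^ card J" .
  qed
  finally show ?thesis .
qed

end

section \<open>All extension problems at once\<close>

lemma nat_le_two_power: "real k \<le> 2 ^ k"
  by (metis of_nat_le_iff of_nat_numeral of_nat_power less_exp less_imp_le)

lemma card_small_subsets_le:
  assumes n: "n \<ge> 1"
  shows "real (card {D. D \<subseteq> {1..n} \<and> card D \<le> \<tau>}) \<le> 4 * real n ^ \<tau>"
proof -
  let ?S = "{D. D \<subseteq> {1..n} \<and> card D \<le> \<tau>}"
  have "real (card ?S) = (\<Sum>D\<in>?S. 1)" by simp
  also have "\<dots> \<le> (\<Sum>D\<in>?S. real n ^ \<tau> * (real n ^ card (D \<inter> {}) / real n ^ card D))"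
  proof (rule sum_mono)
    fix D assume "D \<in> ?S"
    then have "real n ^ card D \<le> real n ^ \<tau>" using n by (intro power_increasing) auto
    then show "1 \<le> real n ^ \<tau> * (real n ^ card (D \<inter> {}) / real n ^ card D)"
      using n by (simp add: field_simps)
  qed
  also have "\<dots> \<le> (\<Sum>D\<in>Pow {1..n}. real n ^ \<tau> * (real n ^ card (D \<inter> {}) / real n ^ card D))"
    by (intro sum_mono2) auto
  also have "\<dots> = real n ^ \<tau> * (\<Sum>D\<in>Pow {1..n}. real n ^ card (D \<inter> {}) / real n ^ card D)"
    by (simp add: sum_distrib_left)
  also have "\<dots> \<le> real n ^ \<tau> * (4 * 2 ^ 0)"
    by (intro mult_left_mono sum_Pow_weight_le n) auto
  finally show ?thesis by simp
qed

text \<open>First moment: by the gap, a dense set on v vertices carries edges of total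
  \<alpha>-weight at least v + \<delta>, so a fixed choice has probability at most n^(-v-\<delta>),
  and the n^(-v) is absorbed by the sum over the sets.\<close>

lemma prob_not_t_closed_empty:
  assumes n: "n \<ge> 1" and \<alpha>: "\<alpha> > 0"
    and gap: "\<And>v e :: nat. v \<le> \<tau> \<Longrightarrow> (v, e) \<noteq> (0, 0) \<Longrightarrow> \<delta> \<le> \<bar>real v - \<alpha> * real e\<bar>"
  shows "measure_pmf.prob (random_subset (vertex_pairs n) (real n powr (- \<alpha>)))
    {E. E \<subseteq> vertex_pairs n \<and> \<not> t_closed \<alpha> ({1..n}, E) \<tau> {}} \<le> 4 * 2 ^ (\<tau>\<^sup>2) * real n powr (- \<delta>)"
proof -
  define p where "p = real n powr (- \<alpha>)"
  have p: "0 \<le> p" "p \<le> 1"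
  proof -
    have "real n powr (- \<alpha>) \<le> real n powr 0" using n \<alpha> by (intro powr_mono) auto
    then show "0 \<le> p" "p \<le> 1" using n by (auto simp: p_def)
  qed
  have p_power: "p ^ k = real n powr (- \<alpha> * real k)" for k
    using n by (simp add: p_def powr_powr[symmetric] powr_realpow[symmetric] powr_powr)
  let ?M = "random_subset (vertex_pairs n) p"
  define \<D> where "\<D> = {D. D \<subseteq> {1..n} \<and> card D \<le> \<tau>}"
  define \<K> where "\<K> D = {K. K \<subseteq> {e. e \<subseteq> D \<and> card e = 2} \<and> real (card D) + \<delta> \<le> \<alpha> * card K}" for D :: "nat set"
  have fin\<D>: "finite \<D>" by (rule finite_subset[of _ "Pow {1..n}"]) (auto simp: \<D>_def)
  have finD: "finite D" if "D \<in> \<D>" for D using that finite_subset by (auto simp: \<D>_def)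
  have finP: "finite {e. e \<subseteq> D \<and> card e = 2}" if "D \<in> \<D>" for D
    by (rule finite_subset[of _ "Pow D"]) (use finD[OF that] in auto)
  have fin\<K>: "finite (\<K> D)" if "D \<in> \<D>" for D
    by (rule finite_subset[of _ "Pow {e. e \<subseteq> D \<and> card e = 2}"]) (use finP[OF that] in \<open>auto simp: \<K>_def\<close>)
  have sub: "{E. E \<subseteq> vertex_pairs n \<and> \<not> t_closed \<alpha> ({1..n}, E) \<tau> {}} \<subseteq> (\<Union>D\<in>\<D>. \<Union>K\<in>\<K> D. {E. K \<subseteq> E})"
  proof
    fix E assume "E \<in> {E. E \<subseteq> vertex_pairs n \<and> \<not> t_closed \<alpha> ({1..n}, E) \<tau> {}}"
    then have E: "E \<subseteq> vertex_pairs n" and "\<not> t_closed \<alpha> ({1..n}, E) \<tau> {}" by auto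
    then obtain D where D: "D \<subseteq> {1..n}" "D \<noteq> {}" "card D \<le> \<tau>"
      and le: "real (card D) \<le> \<alpha> * card (ext_edges E {} D)"
      unfolding t_closed_def by (auto simp: not_less)
    have "finite D" using D finite_subset by blast
    then have "0 < card D" using D by (simp add: card_gt_0_iff)
    then have "real (card D) + \<delta> \<le> \<alpha> * card (ext_edges E {} D)"
      using gap[of "card D" "card (ext_edges E {} D)"] D le by auto
    moreover have "ext_edges E {} D \<subseteq> {e. e \<subseteq> D \<and> card e = 2}"
      using E by (auto simp: ext_edges_def vertex_pairs_def)
    ultimately have "ext_edges E {} D \<in> \<K> D" by (simp add: \<K>_def)
    moreover have "ext_edges E {} D \<subseteq> E" by (auto simp: ext_edges_def)
    moreover have "D \<in> \<D>" using D by (simp add: \<D>_def)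
    ultimately show "E \<in> (\<Union>D\<in>\<D>. \<Union>K\<in>\<K> D. {E. K \<subseteq> E})" by blast
  qed
  have "measure_pmf.prob ?M {E. E \<subseteq> vertex_pairs n \<and> \<not> t_closed \<alpha> ({1..n}, E) \<tau> {}} \<le>
      measure_pmf.prob ?M (\<Union>D\<in>\<D>. \<Union>K\<in>\<K> D. {E. K \<subseteq> E})"
    by (rule measure_pmf.finite_measure_mono[OF sub]) simp
  also have "\<dots> \<le> (\<Sum>D\<in>\<D>. measure_pmf.prob ?M (\<Union>K\<in>\<K> D. {E. K \<subseteq> E}))"
    by (rule measure_pmf.finite_measure_subadditive_finite[OF fin\<D>]) simp
  also have "\<dots> \<le> (\<Sum>D\<in>\<D>. \<Sum>K\<in>\<K> D. measure_pmf.prob ?M {E. K \<subseteq> E})"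
    by (intro sum_mono measure_pmf.finite_measure_subadditive_finite fin\<K>) auto
  also have "\<dots> \<le> (\<Sum>D\<in>\<D>. \<Sum>K\<in>\<K> D. real n powr (- \<delta>) * (1 / real n ^ card D))"
  proof (intro sum_mono)
    fix D K assume DK: "D \<in> \<D>" "K \<in> \<K> D"
    then have "K \<subseteq> vertex_pairs n" by (auto simp: \<D>_def \<K>_def vertex_pairs_def)
    then have "measure_pmf.prob ?M {E. K \<subseteq> E} = p ^ card K"
      by (rule prob_random_subset_superset[OF finite_vertex_pairs _ p])
    also have "\<dots> \<le> real n powr (- \<delta> - card D)"
      unfolding p_power using DK n by (intro powr_mono) (auto simp: \<K>_def)
    also have "\<dots> = real n powr (- \<delta>) * (1 / real n ^ card D)"
      using n by (simp add: powr_diff powr_realpow)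
    finally show "measure_pmf.prob ?M {E. K \<subseteq> E} \<le> real n powr (- \<delta>) * (1 / real n ^ card D)" .
  qed
  also have "\<dots> \<le> (\<Sum>D\<in>\<D>. 2 ^ (\<tau>\<^sup>2) * (real n powr (- \<delta>) * (real n ^ card (D \<inter> {}) / real n ^ card D)))"
  proof (intro sum_mono)
    fix D assume D: "D \<in> \<D>"
    have "card (\<K> D) \<le> card (Pow {e. e \<subseteq> D \<and> card e = 2})"
      by (rule card_mono) (use finP[OF D] in \<open>auto simp: \<K>_def\<close>)
    also have "\<dots> = 2 ^ card {e. e \<subseteq> D \<and> card e = 2}" by (rule card_Pow[OF finP[OF D]])
    also have "\<dots> \<le> 2 ^ ((card D)\<^sup>2)"
      by (rule power_increasing[OF card_pairs_le[OF finD[OF D]]]) simp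
    also have "\<dots> \<le> 2 ^ (\<tau>\<^sup>2)" using D by (intro power_increasing power_mono) (auto simp: \<D>_def)
    finally have "real (card (\<K> D)) \<le> 2 ^ (\<tau>\<^sup>2)"
      by (metis of_nat_le_iff of_nat_numeral of_nat_power)
    then show "(\<Sum>K\<in>\<K> D. real n powr (- \<delta>) * (1 / real n ^ card D)) \<le>
        2 ^ (\<tau>\<^sup>2) * (real n powr (- \<delta>) * (real n ^ card (D \<inter> {}) / real n ^ card D))"
      unfolding sum_constant by (intro mult_mono) auto
  qed
  also have "\<dots> \<le> (\<Sum>D\<in>Pow {1..n}. 2 ^ (\<tau>\<^sup>2) * (real n powr (- \<delta>) * (real n ^ card (D \<inter> {}) / real n ^ card D)))"
    by (intro sum_mono2) (auto simp: \<D>_def)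
  also have "\<dots> = 2 ^ (\<tau>\<^sup>2) * (real n powr (- \<delta>) * (\<Sum>D\<in>Pow {1..n}. real n ^ card (D \<inter> {}) / real n ^ card D))"
    by (simp add: sum_distrib_left)
  also have "\<dots> \<le> 2 ^ (\<tau>\<^sup>2) * (real n powr (- \<delta>) * (4 * 2 ^ 0))"
    by (intro mult_left_mono sum_Pow_weight_le n) auto
  finally show ?thesis by (simp add: p_def mult_ac)
qed

lemma disjoint_blocks_exist:
  fixes X :: "'a set"
  assumes W: "finite W" and X: "k * card W * m \<le> card X" and fX: "finite X"
  obtains B :: "nat \<Rightarrow> 'w \<Rightarrow> 'a set" where
    "\<And>j x. x \<in> W \<Longrightarrow> B j x \<subseteq> X"
    "\<And>j x i y. x \<in> W \<Longrightarrow> y \<in> W \<Longrightarrow> (j, x) \<noteq> (i, y) \<Longrightarrow> B j x \<inter> B i y = {}"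
    "\<And>j x. x \<in> W \<Longrightarrow> j < k \<Longrightarrow> card (B j x) = m"
proof -
  let ?I = "{..<k} \<times> W \<times> {..<m}"
  have "card ?I \<le> card X" using X by (simp add: card_cartesian_product mult.assoc)
  then obtain \<iota> where \<iota>: "\<iota> ` ?I \<subseteq> X" "inj_on \<iota> ?I"
    using card_le_inj[of ?I X] W fX by auto
  define B where "B j x = (if j < k \<and> x \<in> W then \<iota> ` ({j} \<times> {x} \<times> {..<m}) else {})" for j x
  show thesis
  proof
    show "B j x \<subseteq> X" for j x using \<iota>(1) by (auto simp: B_def)
    show "B j x \<inter> B i y = {}" if "(j, x) \<noteq> (i, y)" for j x i y
    proof (rule ccontr)
      assume "B j x \<inter> B i y \<noteq> {}"
      then obtain l l' where "j < k" "i < k" "x \<in> W" "y \<in> W" "l < m" "l' < m" "\<iota> (j, x, l) = \<iota> (i, y, l')"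
        by (auto simp: B_def split: if_splits)
      then have "(j, x, l) = (i, y, l')" by (intro inj_onD[OF \<iota>(2)]) auto
      then show False using that by simp
    qed
    show "card (B j x) = m" if "x \<in> W" "j < k" for j x
    proof -
      have "inj_on \<iota> ({j} \<times> {x} \<times> {..<m})" by (rule inj_on_subset[OF \<iota>(2)]) (use that in auto)
      then show ?thesis using that by (simp add: B_def card_image card_cartesian_product)
    qed
  qed
qed

lemma card_Sigma_le:
  assumes "finite A" "\<And>a. a \<in> A \<Longrightarrow> finite (B a)" "\<And>a. a \<in> A \<Longrightarrow> real (card (B a)) \<le> k"
    "real (card A) \<le> l" "0 \<le> k"
  shows "real (card (Sigma A B)) \<le> l * k"
proof -
  have "real (card (Sigma A B)) = (\<Sum>a\<in>A. real (card (B a)))"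
    using assms(1,2) by (simp add: card_SigmaI)
  also have "\<dots> \<le> (\<Sum>a\<in>A. k)" by (intro sum_mono assms(3))
  also have "\<dots> \<le> l * k" using assms(4,5) by (simp add: mult_right_mono)
  finally show ?thesis .
qed

text \<open>With failure probability at most n^(-\<delta>/2) per family pair,
  \<open>10 * real \<tau> \<le> \<delta> * real b\<close> gives n^(-5\<tau>) for one pattern, enough
  against n^(3\<tau>) patterns. The exponent 22 b \<tau>^2 is a common bound for all combinatorial
  factors.\<close>

locale gnp_params =
  fixes n \<tau> b :: nat and \<alpha> \<delta> :: real
  assumes n: "n \<ge> 2" and \<tau>: "\<tau> \<ge> 1" and \<alpha>: "\<alpha> > 0" and \<delta>: "\<delta> > 0"
    and gap: "\<And>v e :: nat. v \<le> \<tau> \<Longrightarrow> (v, e) \<noteq> (0, 0) \<Longrightarrow> \<delta> \<le> \<bar>real v - \<alpha> * real e\<bar>"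
    and b: "b \<ge> 1" "10 * real \<tau> \<le> \<delta> * real b"
    and big: "2 ^ (22 * b * \<tau>\<^sup>2) \<le> real n powr (\<delta> / 2)"
begin

lemma \<delta>_le_1: "\<delta> \<le> 1"
  using gap[of 1 0] \<tau> by simp

lemma powr_\<delta>_le: "real n powr (\<delta> / 2) \<le> real n"
proof -
  have "real n powr (\<delta> / 2) \<le> real n powr 1" using n \<delta>_le_1 by (intro powr_mono) auto
  then show ?thesis using n by simp
qed

lemma b_\<tau>_le: "b * \<tau> \<le> b * \<tau>\<^sup>2" "\<tau>\<^sup>2 \<le> b * \<tau>\<^sup>2" "1 \<le> b * \<tau>\<^sup>2" "\<tau> \<le> \<tau>\<^sup>2"
  using \<tau> b by (auto simp: power2_eq_square)

lemma n_ge: "8 * (b * \<tau>) \<le> n"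
proof -
  have "real (8 * (b * \<tau>)) \<le> 2 ^ (8 * (b * \<tau>))" by (rule nat_le_two_power)
  also have "\<dots> \<le> 2 ^ (22 * b * \<tau>\<^sup>2)" using b_\<tau>_le(1) by (intro power_increasing) auto
  also have "\<dots> \<le> real n" using big powr_\<delta>_le by linarith
  finally show ?thesis by (simp only: of_nat_le_iff)
qed

text \<open>\<open>2 * b\<close> families of at most \<tau> blocks fill at most half of the
  vertices, which leaves room for the image of \<open>L\<close>.\<close>

definition m where "m = n div (4 * b * \<tau>)"

lemma m_ge_1: "m \<ge> 1"
proof -
  have "4 * b * \<tau> \<le> n" using n_ge by simp
  then show ?thesis unfolding m_def using b \<tau> by (simp add: Suc_leI div_greater_zero_iff)
qed

lemma m_upper: "2 * b * \<tau> * m + \<tau> \<le> n"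
proof -
  have "4 * b * \<tau> * m \<le> n" unfolding m_def by (rule times_div_less_eq_dividend)
  moreover have "\<tau> \<le> b * \<tau>" using b by simp
  then have "2 * \<tau> \<le> n" using n_ge by linarith
  ultimately show ?thesis by linarith
qed

lemma m_lower: "real n \<le> real (8 * b * \<tau>) * real m"
proof -
  have pos: "0 < 4 * b * \<tau>" using b \<tau> by simp
  have "n < 4 * b * \<tau> * (m + 1)"
    unfolding m_def using dividend_less_div_times[OF pos, of n] by (simp add: algebra_simps)
  also have "\<dots> \<le> 4 * b * \<tau> * (m + m)" using m_ge_1 by (intro mult_left_mono) auto
  finally have "n \<le> 8 * b * \<tau> * m" by (simp add: algebra_simps)
  then show ?thesis by (metis of_nat_le_iff of_nat_mult)
qed

text \<open>One bound for both failure modes, few hits and many witnesses; 20 leaves 2 of the 22 for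
  the factor 4 from choosing which families fail how.\<close>

definition \<epsilon> where "\<epsilon> = real n powr (- \<delta>) * 2 ^ (20 * b * \<tau>\<^sup>2)"

lemma four_\<epsilon>_le: "4 * \<epsilon> \<le> real n powr (- \<delta> / 2)"
proof -
  have "4 * \<epsilon> = real n powr (- \<delta>) * 2 ^ (20 * b * \<tau>\<^sup>2 + 2)" by (simp add: \<epsilon>_def power_add)
  also have "\<dots> \<le> real n powr (- \<delta>) * 2 ^ (22 * b * \<tau>\<^sup>2)"
    using b_\<tau>_le(3) by (intro mult_left_mono power_increasing) auto
  also have "\<dots> \<le> real n powr (- \<delta>) * real n powr (\<delta> / 2)" by (intro mult_left_mono big) auto
  also have "\<dots> = real n powr (- \<delta> / 2)" by (simp flip: powr_add)
  finally show ?thesis .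
qed

lemma \<epsilon>_le_1: "\<epsilon> \<le> 1"
proof -
  have "real n powr (- \<delta> / 2) \<le> real n powr 0" using n \<delta> by (intro powr_mono) auto
  moreover have "\<epsilon> \<ge> 0" by (simp add: \<epsilon>_def)
  ultimately show ?thesis using four_\<epsilon>_le n by simp
qed

lemma prob_extension_fails:
  assumes L: "L \<subseteq> {1..n}" "card L \<le> \<tau>" and W: "W \<subseteq> {1..n}" "W \<noteq> {}" and LW: "L \<inter> W = {}"
    and cW: "card W + u \<le> \<tau>"
    and F: "\<And>e. e \<in> F \<Longrightarrow> e \<subseteq> L \<union> W \<and> card e = 2 \<and> \<not> e \<subseteq> L"
    and f: "inj_on f L" "f ` L \<subseteq> {1..n}"
    and safe: "\<And>S. S \<subseteq> W \<Longrightarrow> S \<noteq> {} \<Longrightarrow> \<alpha> * card {e \<in> F. e \<subseteq> L \<union> S} < card S"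
  shows "measure_pmf.prob (random_subset (vertex_pairs n) (real n powr (- \<alpha>)))
    {E. t_closed \<alpha> ({1..n}, E) (card W + u) (f ` L) \<and>
      \<not> (\<exists>g. (\<forall>x\<in>L. g x = f x) \<and> inj_on g (L \<union> W) \<and> g ` (L \<union> W) \<subseteq> {1..n} \<and>
        (\<forall>x\<in>W. \<forall>y\<in>L \<union> W. {g x, g y} \<in> E \<longleftrightarrow> {x, y} \<in> F) \<and>
        t_closed \<alpha> ({1..n}, E) u (g ` (L \<union> W)))} \<le> (4 * \<epsilon>) ^ b"
proof -
  have finL: "finite L" and finW: "finite W" using L W finite_subset by auto
  have "card (f ` L) \<le> \<tau>" using card_image_le[OF finL, of f] L by linarith
  then have "n - \<tau> \<le> card ({1..n} - f ` L)" using f(2) finL by (simp add: card_Diff_subset)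
  moreover have "2 * b * card W * m \<le> 2 * b * \<tau> * m" using cW by (intro mult_right_mono mult_left_mono) auto
  ultimately have "2 * b * card W * m \<le> card ({1..n} - f ` L)" using m_upper by linarith
  then obtain B where B: "\<And>j x. x \<in> W \<Longrightarrow> B j x \<subseteq> {1..n} - f ` L"
    "\<And>j x i y. x \<in> W \<Longrightarrow> y \<in> W \<Longrightarrow> (j, x) \<noteq> (i, y) \<Longrightarrow> B j x \<inter> B i y = {}"
    "\<And>j x. x \<in> W \<Longrightarrow> j < 2 * b \<Longrightarrow> card (B j x) = m"
    using disjoint_blocks_exist[OF finW, of "2 * b" m "{1..n} - f ` L"] by auto
  have n1: "n \<ge> 1" using n by simp
  interpret ei: extension_instance n \<tau> u m b \<alpha> \<delta> L W F f B
    by (rule extension_instance.intro)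
      (fact n1 \<alpha> \<delta> finL finW LW W(2) F f(1) f(2) L(2) cW gap safe B(1) B(2) B(3) m_ge_1)+
  let ?c = "real (8 * b * \<tau>)"
  have c1: "1 \<le> ?c" using b \<tau> by (metis One_nat_def Suc_leI mult_pos_pos of_nat_1 of_nat_le_iff zero_less_numeral less_le_trans zero_less_one)
  have cW': "card W \<le> \<tau>" using cW by simp
  have "(2 * ?c) ^ card W \<le> (2 * ?c) ^ \<tau>" using c1 cW' by (intro power_increasing) auto
  also have "\<dots> \<le> (2 ^ (16 * b * \<tau>)) ^ \<tau>"
    using nat_le_two_power[of "16 * b * \<tau>"] by (intro power_mono) auto
  finally have e1: "(2 * ?c) ^ card W \<le> 2 ^ (16 * b * \<tau>\<^sup>2)"
    by (simp add: power_mult[symmetric] power2_eq_square mult_ac)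
  have \<epsilon>1: "4 * (real n powr (- \<delta>) * (2 * ?c) ^ card W) \<le> \<epsilon>"
  proof -
    have "4 * (real n powr (- \<delta>) * (2 * ?c) ^ card W) \<le> 4 * (real n powr (- \<delta>) * 2 ^ (16 * b * \<tau>\<^sup>2))"
      by (intro mult_left_mono e1) auto
    also have "\<dots> = real n powr (- \<delta>) * 2 ^ (16 * b * \<tau>\<^sup>2 + 2)" by (simp add: power_add)
    also have "\<dots> \<le> \<epsilon>" unfolding \<epsilon>_def using b_\<tau>_le(3) by (intro mult_left_mono power_increasing) auto
    finally show ?thesis .
  qed
  let ?a = "2 * b * \<tau>"
  have "(1 + real ?a) ^ card W \<le> (1 + real ?a) ^ \<tau>" using cW' by (intro power_increasing) auto
  also have "\<dots> \<le> (2 ^ ?a) ^ \<tau>"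
  proof (intro power_mono)
    have "Suc ?a \<le> 2 ^ ?a" by (rule Suc_leI[OF less_exp])
    then have "real (Suc ?a) \<le> 2 ^ ?a" by (metis of_nat_le_iff of_nat_numeral of_nat_power)
    then show "1 + real ?a \<le> 2 ^ ?a" by simp
  qed simp
  finally have e2: "(1 + real ?a) ^ card W \<le> 2 ^ (2 * b * \<tau>\<^sup>2)"
    by (simp add: power_mult[symmetric] power2_eq_square mult_ac)
  have "?c ^ card W \<le> ?c ^ \<tau>" using c1 cW' by (intro power_increasing) auto
  also have "\<dots> \<le> (2 ^ (8 * b * \<tau>)) ^ \<tau>"
    using nat_le_two_power[of "8 * b * \<tau>"] by (intro power_mono) auto
  finally have e3: "?c ^ card W \<le> 2 ^ (8 * b * \<tau>\<^sup>2)"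
    by (simp add: power_mult[symmetric] power2_eq_square mult_ac)
  have \<epsilon>2: "2 * ei.\<kappa> ?a / ei.\<mu> \<le> \<epsilon>"
  proof -
    \<comment> \<open>The summands belong, in this order, to the constant 8, the choices of
      \<open>Q\<close>, the ratio n/m per label, the factor 1 + a per label, and 2^a.\<close>
    have expo: "3 + 4 * \<tau>\<^sup>2 + 8 * b * \<tau>\<^sup>2 + 2 * b * \<tau>\<^sup>2 + ?a \<le> 20 * b * \<tau>\<^sup>2"
      using b_\<tau>_le unfolding mult.assoc by linarith
    have m0: "real m ^ card W > 0" using m_ge_1 by simp
    have nm: "real n ^ card W / real m ^ card W \<le> ?c ^ card W"
    proof -
      have "real n ^ card W \<le> (?c * real m) ^ card W" by (intro power_mono m_lower) auto
      then show ?thesis using m0 by (simp add: power_mult_distrib field_simps)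
    qed
    have pF: "ei.p ^ card F = real n powr (- \<alpha> * card F)" by (rule ei.p_power)
    have "real n powr (- \<alpha> * card F - \<delta>) = real n powr (- \<alpha> * card F) * real n powr (- \<delta>)"
      by (simp flip: powr_add)
    then have "2 * ei.\<kappa> ?a / ei.\<mu> = real n powr (- \<delta>) * (8 * 2 ^ (4 * \<tau>\<^sup>2)) *
        (real n ^ card W / real m ^ card W) * (1 + real ?a) ^ card W * 2 ^ ?a"
      unfolding ei.\<kappa>_def ei.\<mu>_def pF using n by (simp add: power_mult_distrib)
    also have "\<dots> \<le> real n powr (- \<delta>) * (8 * 2 ^ (4 * \<tau>\<^sup>2)) * 2 ^ (8 * b * \<tau>\<^sup>2) * 2 ^ (2 * b * \<tau>\<^sup>2) * 2 ^ ?a"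
      by (intro mult_mono order_trans[OF nm e3] e2) auto
    also have "\<dots> = real n powr (- \<delta>) * 2 ^ (3 + 4 * \<tau>\<^sup>2 + 8 * b * \<tau>\<^sup>2 + 2 * b * \<tau>\<^sup>2 + ?a)"
      by (simp only: power_add) simp
    also have "\<dots> \<le> \<epsilon>"
      unfolding \<epsilon>_def by (intro mult_left_mono power_increasing expo) auto
    finally show ?thesis .
  qed
  from ei.prob_no_extension[OF m_lower \<epsilon>_le_1 \<epsilon>1 \<epsilon>2] show ?thesis
    unfolding ei.extends_def ei.R_def ei.p_def by simp
qed

lemma prob_not_extension_property:
  "measure_pmf.prob (random_subset (vertex_pairs n) (real n powr (- \<alpha>)))
    {E. \<not> extension_property \<alpha> \<tau> n ({1..n}, E)}
    \<le> 16 * real n ^ (3 * \<tau>) * 2 ^ (4 * \<tau>\<^sup>2) * real (\<tau> + 1) * (4 * \<epsilon>) ^ b"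
proof -
  let ?M = "random_subset (vertex_pairs n) (real n powr (- \<alpha>))"
  \<comment> \<open>The deterministic conditions go to \<open>C\<close> and those depending on the
    edges, closedness of the base included, to \<open>X\<close>, so that the union bound runs over a
    fixed index set. There L, W and f account for n^\<tau> each, up to constants.\<close>
  define C where "C L W F f u \<longleftrightarrow> L \<subseteq> {1..n} \<and> W \<subseteq> {1..n} \<and> L \<inter> W = {} \<and> card L \<le> \<tau> \<and> card W + u \<le> \<tau> \<and>
      (\<forall>e\<in>F. e \<subseteq> L \<union> W \<and> card e = 2 \<and> \<not> e \<subseteq> L) \<and> inj_on f L \<and> f ` L \<subseteq> {1..n} \<and>
      (\<forall>S. S \<subseteq> W \<and> S \<noteq> {} \<longrightarrow> \<alpha> * card {e \<in> F. e \<subseteq> L \<union> S} < card S)"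
    for L W :: "nat set" and F and f :: "nat \<Rightarrow> nat" and u
  define X where "X L W F f u E \<longleftrightarrow> t_closed \<alpha> ({1..n}, E) (card W + u) (f ` L) \<and>
      \<not> (\<exists>g. (\<forall>x\<in>L. g x = f x) \<and> inj_on g (L \<union> W) \<and> g ` (L \<union> W) \<subseteq> {1..n} \<and>
        (\<forall>x\<in>W. \<forall>y\<in>L \<union> W. {g x, g y} \<in> E \<longleftrightarrow> {x, y} \<in> F) \<and>
        t_closed \<alpha> ({1..n}, E) u (g ` (L \<union> W)))"
    for L W :: "nat set" and F and f :: "nat \<Rightarrow> nat" and u E
  define \<D> where "\<D> = {D. D \<subseteq> {1..n} \<and> card D \<le> \<tau>}"
  define \<I> where "\<I> = (SIGMA L : \<D>. SIGMA W : \<D>. SIGMA F : Pow {e. e \<subseteq> L \<union> W \<and> card e = 2}.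
      SIGMA f : PiE L (\<lambda>_. {1..n}). {..\<tau>})"
  define Ev where "Ev = (\<lambda>(L, W, F, f, u). {E. C L W F f u \<and> X L W F f u E})"
  have fin\<D>: "finite \<D>" by (rule finite_subset[of _ "Pow {1..n}"]) (auto simp: \<D>_def)
  have finD: "finite D" "card D \<le> \<tau>" if "D \<in> \<D>" for D using that finite_subset by (auto simp: \<D>_def)
  have finP: "finite {e. e \<subseteq> L \<union> W \<and> card e = 2}" if "L \<in> \<D>" "W \<in> \<D>" for L W
    by (rule finite_subset[of _ "Pow (L \<union> W)"]) (use finD that in auto)
  have finf: "finite (PiE L (\<lambda>_. {1..n}))" if "L \<in> \<D>" for L
    by (rule finite_PiE) (use finD that in auto)
  have cP: "real (card (Pow {e. e \<subseteq> L \<union> W \<and> card e = 2})) \<le> 2 ^ (4 * \<tau>\<^sup>2)" if LW: "L \<in> \<D>" "W \<in> \<D>" for L W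
  proof -
    have "card (L \<union> W) \<le> 2 * \<tau>" using card_Un_le[of L W] finD[OF LW(1)] finD[OF LW(2)] by linarith
    then have "(card (L \<union> W))\<^sup>2 \<le> (2 * \<tau>)\<^sup>2" by (rule power_mono) simp
    then have "card {e. e \<subseteq> L \<union> W \<and> card e = 2} \<le> 4 * \<tau>\<^sup>2"
      using card_pairs_le[of "L \<union> W"] finD[OF LW(1)] finD[OF LW(2)] by (simp add: power_mult_distrib)
    then have "(2::real) ^ card {e. e \<subseteq> L \<union> W \<and> card e = 2} \<le> 2 ^ (4 * \<tau>\<^sup>2)"
      by (rule power_increasing) simp
    then show ?thesis using finP[OF LW] by (simp add: card_Pow)
  qed
  have cf: "real (card (PiE L (\<lambda>_. {1..n}))) \<le> real n ^ \<tau>" if "L \<in> \<D>" for L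
    using finD[OF that] n by (simp add: card_PiE power_increasing)
  have c\<D>: "real (card \<D>) \<le> 4 * real n ^ \<tau>"
    unfolding \<D>_def by (rule card_small_subsets_le) (use n in simp)
  have fin\<I>: "finite \<I>" unfolding \<I>_def by (intro finite_SigmaI fin\<D> finf) (auto intro!: finP)
  have c\<I>: "real (card \<I>) \<le> 4 * real n ^ \<tau> * (4 * real n ^ \<tau> * (2 ^ (4 * \<tau>\<^sup>2) * (real n ^ \<tau> * real (\<tau> + 1))))"
    unfolding \<I>_def by (intro card_Sigma_le c\<D> cP cf fin\<D> finf finite_SigmaI) (auto intro!: finP finf)
  have sub: "{E. \<not> extension_property \<alpha> \<tau> n ({1..n}, E)} \<subseteq> (\<Union>i\<in>\<I>. Ev i)"
  proof
    fix E assume "E \<in> {E. \<not> extension_property \<alpha> \<tau> n ({1..n}, E)}"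
    then obtain L W F f u where C: "C L W F f u" and X: "X L W F f u E"
      unfolding extension_property_def C_def X_def by auto
    \<comment> \<open>Only values on \<open>L\<close> matter; restricting puts \<open>f\<close> into
      the finite set \<open>PiE L (\<lambda>_. {1..n})\<close>.\<close>
    let ?f = "restrict f L"
    have "C L W F ?f u" using C unfolding C_def by simp
    moreover have "X L W F ?f u E" using X unfolding X_def by simp
    moreover have "(L, W, F, ?f, u) \<in> \<I>"
    proof -
      have "card W \<le> \<tau>" "u \<le> \<tau>" using C by (auto simp: C_def)
      then show ?thesis using C unfolding \<I>_def \<D>_def C_def by auto
    qed
    ultimately show "E \<in> (\<Union>i\<in>\<I>. Ev i)" unfolding Ev_def by blast
  qed
  have Ev_le: "measure_pmf.prob ?M (Ev i) \<le> (4 * \<epsilon>) ^ b" for i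
  proof -
    obtain L W F f u where i: "i = (L, W, F, f, u)" by (cases i)
    have nn: "0 \<le> (4 * \<epsilon>) ^ b" by (simp add: \<epsilon>_def)
    show ?thesis
    proof (cases "C L W F f u")
      case False
      then show ?thesis using nn by (simp add: i Ev_def)
    next
      case C: True
      show ?thesis
      \<comment> \<open>Without new vertices \<open>f\<close> itself is the extension, so failure is
        impossible.\<close>
      proof (cases "W = {}")
        case True
        have "\<not> X L W F f u E" for E
          using C unfolding X_def C_def True by auto
        then show ?thesis using nn by (simp add: i Ev_def)
      next
        case False
        have "measure_pmf.prob ?M {E. X L W F f u E} \<le> (4 * \<epsilon>) ^ b"
          unfolding X_def by (rule prob_extension_fails) (use C False in \<open>auto simp: C_def\<close>)
        then show ?thesis using C by (simp add: i Ev_def)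
      qed
    qed
  qed
  have "measure_pmf.prob ?M {E. \<not> extension_property \<alpha> \<tau> n ({1..n}, E)} \<le> measure_pmf.prob ?M (\<Union>i\<in>\<I>. Ev i)"
    by (rule measure_pmf.finite_measure_mono[OF sub]) simp
  also have "\<dots> \<le> (\<Sum>i\<in>\<I>. measure_pmf.prob ?M (Ev i))"
    by (rule measure_pmf.finite_measure_subadditive_finite[OF fin\<I>]) simp
  also have "\<dots> \<le> real (card \<I>) * (4 * \<epsilon>) ^ b" using sum_bounded_above[of \<I>, OF Ev_le] by simp
  also have "\<dots> \<le> 4 * real n ^ \<tau> * (4 * real n ^ \<tau> * (2 ^ (4 * \<tau>\<^sup>2) * (real n ^ \<tau> * real (\<tau> + 1)))) * (4 * \<epsilon>) ^ b"
    by (intro mult_right_mono c\<I>) (simp add: \<epsilon>_def)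
  also have "\<dots> = 16 * real n ^ (3 * \<tau>) * 2 ^ (4 * \<tau>\<^sup>2) * real (\<tau> + 1) * (4 * \<epsilon>) ^ b"
    by (simp add: power_mult power3_eq_cube power_mult_distrib mult_ac)
  finally show ?thesis .
qed

lemma prob_not_good_graph:
  "measure_pmf.prob (random_graph n (real n powr (- \<alpha>))) {G. \<not> good_graph \<alpha> \<tau> n G}
    \<le> 2 * real n powr (- \<delta> / 2)"
proof -
  let ?M = "random_subset (vertex_pairs n) (real n powr (- \<alpha>))"
  let ?A = "{E. E \<subseteq> vertex_pairs n \<and> \<not> t_closed \<alpha> ({1..n}, E) \<tau> {}}"
  let ?B = "{E. \<not> extension_property \<alpha> \<tau> n ({1..n}, E)}"
  have n1: "1 \<le> n" using n by simp
  have expo1: "\<tau>\<^sup>2 + 2 \<le> 22 * b * \<tau>\<^sup>2" and expo2: "4 + 4 * \<tau>\<^sup>2 + \<tau> \<le> 22 * b * \<tau>\<^sup>2"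
    using b_\<tau>_le unfolding mult.assoc by linarith+
  have nd: "real n powr (- \<delta>) * real n powr (\<delta> / 2) = real n powr (- \<delta> / 2)"
    by (simp flip: powr_add)
  have "measure_pmf.prob ?M ?A \<le> 4 * 2 ^ (\<tau>\<^sup>2) * real n powr (- \<delta>)"
    by (rule prob_not_t_closed_empty[OF n1 \<alpha> gap])
  also have "\<dots> = real n powr (- \<delta>) * 2 ^ (\<tau>\<^sup>2 + 2)" by (simp add: power_add)
  also have "\<dots> \<le> real n powr (- \<delta>) * 2 ^ (22 * b * \<tau>\<^sup>2)"
    by (intro mult_left_mono power_increasing expo1) auto
  also have "\<dots> \<le> real n powr (- \<delta>) * real n powr (\<delta> / 2)" by (intro mult_left_mono big) auto
  finally have A: "measure_pmf.prob ?M ?A \<le> real n powr (- \<delta> / 2)" unfolding nd .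
  have "(4 * \<epsilon>) ^ b \<le> (real n powr (- \<delta> / 2)) ^ b"
    by (intro power_mono four_\<epsilon>_le) (simp add: \<epsilon>_def)
  also have "\<dots> = real n powr (- \<delta> * b / 2)"
    using n by (simp add: powr_realpow[symmetric] powr_powr)
  also have "\<dots> \<le> real n powr (- 5 * \<tau>)" using b(2) n by (intro powr_mono) auto
  finally have eb: "(4 * \<epsilon>) ^ b \<le> real n powr (- 5 * \<tau>)" .
  have "16 * 2 ^ (4 * \<tau>\<^sup>2) * real (\<tau> + 1) \<le> 2 ^ 4 * 2 ^ (4 * \<tau>\<^sup>2) * 2 ^ \<tau>"
  proof (intro mult_mono)
    have "\<tau> + 1 \<le> 2 ^ \<tau>" unfolding Suc_eq_plus1[symmetric] by (rule Suc_leI[OF less_exp])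
    then show "real (\<tau> + 1) \<le> 2 ^ \<tau>" by (metis of_nat_le_iff of_nat_numeral of_nat_power)
  qed auto
  also have "\<dots> = 2 ^ (4 + 4 * \<tau>\<^sup>2 + \<tau>)" by (simp add: power_add)
  also have "\<dots> \<le> 2 ^ (22 * b * \<tau>\<^sup>2)"
    by (intro power_increasing expo2) auto
  also have "\<dots> \<le> real n powr 1"
    using order_trans[OF big powr_\<delta>_le] by (simp only: powr_one of_nat_0_le_iff)
  finally have const: "16 * 2 ^ (4 * \<tau>\<^sup>2) * real (\<tau> + 1) \<le> real n powr 1" .
  have "measure_pmf.prob ?M ?B \<le> 16 * real n ^ (3 * \<tau>) * 2 ^ (4 * \<tau>\<^sup>2) * real (\<tau> + 1) * (4 * \<epsilon>) ^ b"
    by (rule prob_not_extension_property)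
  also have "\<dots> = (16 * 2 ^ (4 * \<tau>\<^sup>2) * real (\<tau> + 1)) * real n powr (3 * \<tau>) * (4 * \<epsilon>) ^ b"
    using n by (simp add: powr_realpow[symmetric] mult_ac)
  also have "\<dots> \<le> real n powr 1 * real n powr (3 * \<tau>) * real n powr (- 5 * \<tau>)"
    by (intro mult_mono const eb) (auto simp: \<epsilon>_def)
  \<comment> \<open>1 for the constants, 3\<tau> for the patterns, -5\<tau> for one failure; with
    \<tau> \<ge> 1 and \<delta> \<le> 1 this is at most -\<delta>/2.\<close>
  also have "\<dots> = real n powr (1 - 2 * real \<tau>)" unfolding powr_add[symmetric] by simp
  also have "\<dots> \<le> real n powr (- \<delta> / 2)"
    using n \<tau> \<delta>_le_1 by (intro powr_mono) auto
  finally have B: "measure_pmf.prob ?M ?B \<le> real n powr (- \<delta> / 2)" .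
  have "measure_pmf.prob (random_graph n (real n powr (- \<alpha>))) {G. \<not> good_graph \<alpha> \<tau> n G} =
      measure_pmf.prob ?M {E. \<not> good_graph \<alpha> \<tau> n ({1..n}, E)}"
    by (simp add: random_graph_conv_random_subset vimage_def)
  also have "\<dots> = measure_pmf.prob ?M ({E. \<not> good_graph \<alpha> \<tau> n ({1..n}, E)} \<inter> set_pmf ?M)"
    by (rule measure_Int_set_pmf[symmetric])
  also have "\<dots> \<le> measure_pmf.prob ?M (?A \<union> ?B)"
  proof (rule measure_pmf.finite_measure_mono)
    show "{E. \<not> good_graph \<alpha> \<tau> n ({1..n}, E)} \<inter> set_pmf ?M \<subseteq> ?A \<union> ?B"
    proof
      fix E assume E: "E \<in> {E. \<not> good_graph \<alpha> \<tau> n ({1..n}, E)} \<inter> set_pmf ?M"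
      then have EV: "E \<subseteq> vertex_pairs n" using set_pmf_random_subset by blast
      then have "finite_simple_graph ({1..n}, E)"
        by (auto simp: finite_simple_graph_def vertex_pairs_def)
      then show "E \<in> ?A \<union> ?B" using E EV by (auto simp: good_graph_def)
    qed
  qed simp
  also have "\<dots> \<le> measure_pmf.prob ?M ?A + measure_pmf.prob ?M ?B"
    by (rule measure_Un_le) simp_all
  finally show ?thesis using A B by linarith
qed

end

section \<open>Diophantine input and asymptotics\<close>

text \<open>Multiplying an approximation bound e^(-d) by the denominator e gives the exponent 1 - d.
  Finitely many exceptional fractions are absorbed in \<open>c0\<close>, positive by irrationality.
  For many edges, \<alpha> e \<ge> t + 1, the weight is at most -1; otherwise e \<le> 2t/\<alpha>,
  so e can be traded for t.\<close>

lemma irrationality_measure_gap: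
  fixes \<alpha> d\<^sub>0 :: real
  assumes "d\<^sub>0 > 2" and \<alpha>: "\<alpha> > 0" "\<alpha> \<notin> \<rat>" and im: "irrationality_measure \<alpha> < ereal d\<^sub>0"
  obtains c d where "0 < c" "2 \<le> d" "d < d\<^sub>0"
    "\<And>t v e. 1 \<le> t \<Longrightarrow> real v \<le> t \<Longrightarrow> (v, e) \<noteq> (0, 0) \<Longrightarrow>
       c * t powr (1 - d) \<le> \<bar>real v - \<alpha> * real e\<bar>"
proof -
  define S where "S d = {(p :: int, q :: int). q > 0 \<and>
     \<bar>\<alpha> - real_of_int p / real_of_int q\<bar> \<le> real_of_int q powr (- d)}" for d
  obtain d' where d': "d' > 0" "finite (S d')" "d' < d\<^sub>0"
    using im unfolding irrationality_measure_def Inf_less_iff S_def by auto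
  define d where "d = max d' 2"
  have d: "2 \<le> d" "d' \<le> d" "d < d\<^sub>0" using d' assms(1) by (auto simp: d_def)
  have "S d \<subseteq> S d'"
  proof -
    have "real_of_int q powr (- d) \<le> real_of_int q powr (- d')" if "q > 0" for q :: int
      using that d(2) by (intro powr_mono) auto
    then show ?thesis unfolding S_def by (auto intro: order_trans)
  qed
  then have finS: "finite (S d)" using d'(2) finite_subset by blast
  define c0 where "c0 = Min (insert 1 ((\<lambda>(p, q). \<bar>real_of_int p - \<alpha> * real_of_int q\<bar>) ` S d))"
  have irr: "\<bar>real_of_int p - \<alpha> * real_of_int q\<bar> > 0" if "q > 0" for p q :: int
  proof -
    have "\<alpha> \<noteq> real_of_int p / real_of_int q" using \<alpha>(2) by auto
    then show ?thesis using that by (auto simp: field_simps)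
  qed
  have c0_pos: "c0 > 0"
    unfolding c0_def using finS irr by (subst Min_gr_iff) (auto simp: S_def)
  have c0_le: "c0 \<le> 1" unfolding c0_def using finS by (intro Min_le) auto
  have c0: "c0 * real e powr (1 - d) \<le> \<bar>real v - \<alpha> * real e\<bar>" if e: "e > 0" for v e :: nat
  proof (cases "(int v, int e) \<in> S d")
    case True
    have "real e powr (1 - d) \<le> real e powr 0" using e d by (intro powr_mono) auto
    then have "c0 * real e powr (1 - d) \<le> c0" using c0_pos e by simp
    also have "c0 \<le> \<bar>real v - \<alpha> * real e\<bar>"
      unfolding c0_def using finS True by (intro Min_le) force+
    finally show ?thesis .
  next
    case False
    then have gt: "real e powr (- d) < \<bar>\<alpha> - real v / real e\<bar>" using e by (simp add: S_def)
    have "c0 * real e powr (1 - d) \<le> 1 * real e powr (1 - d)"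
      by (intro mult_right_mono c0_le) auto
    also have "\<dots> = real e * real e powr (- d)" using e by (simp add: powr_diff powr_minus divide_inverse)
    also have "\<dots> \<le> real e * \<bar>\<alpha> - real v / real e\<bar>" using gt by (intro mult_left_mono) auto
    also have "\<dots> = \<bar>real e * (\<alpha> - real v / real e)\<bar>" by (simp add: abs_mult)
    also have "real e * (\<alpha> - real v / real e) = - (real v - \<alpha> * real e)" using e by (simp add: field_simps)
    finally show ?thesis by simp
  qed
  define c where "c = c0 * min 1 ((2 / \<alpha>) powr (1 - d))"
  have c_pos: "c > 0" using c0_pos \<alpha> by (simp add: c_def)
  have "min 1 ((2 / \<alpha>) powr (1 - d)) \<ge> 0" by simp
  then have c_le: "c \<le> c0" "c \<le> c0 * (2 / \<alpha>) powr (1 - d)" "c \<le> 1"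
    using c0_pos c0_le mult_mono[of c0 1 "min 1 ((2 / \<alpha>) powr (1 - d))" 1]
    by (auto simp: c_def mult_le_cancel_left1 min_def)
  have gap: "c * t powr (1 - d) \<le> \<bar>real v - \<alpha> * real e\<bar>"
    if t: "1 \<le> t" "real v \<le> t" and ne: "(v, e) \<noteq> (0, 0)" for t :: real and v e :: nat
  proof -
    have "t powr (1 - d) \<le> t powr 0" using t d by (intro powr_mono) auto
    then have le1: "c * t powr (1 - d) \<le> 1"
      using c_pos c_le(3) t mult_mono[of c 1 "t powr (1 - d)" 1] by simp
    show ?thesis
    proof (cases "e = 0")
      case True
      then have "v \<ge> 1" using ne by simp
      then show ?thesis using le1 True by simp
    next
      case False
      show ?thesis
      proof (cases "\<alpha> * real e \<ge> t + 1")
        case True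
        then show ?thesis using le1 t by linarith
      next
        case le: False
        have "real e \<le> 2 / \<alpha> * t" using le t \<alpha> by (simp add: field_simps)
        then have "(2 / \<alpha> * t) powr (1 - d) \<le> real e powr (1 - d)"
          using False d by (intro powr_mono2') auto
        moreover have "(2 / \<alpha> * t) powr (1 - d) = (2 / \<alpha>) powr (1 - d) * t powr (1 - d)"
          by (rule powr_mult)
        ultimately have *: "(2 / \<alpha>) powr (1 - d) * t powr (1 - d) \<le> real e powr (1 - d)" by simp
        have "c * t powr (1 - d) \<le> c0 * (2 / \<alpha>) powr (1 - d) * t powr (1 - d)"
          by (intro mult_right_mono c_le) auto
        also have "\<dots> \<le> c0 * real e powr (1 - d)" using mult_left_mono[OF *, of c0] c0_pos by (simp add: mult_ac)
        also have "\<dots> \<le> \<bar>real v - \<alpha> * real e\<bar>" by (rule c0) (use False in simp)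
        finally show ?thesis .
      qed
    qed
  qed
  show thesis by (rule that[OF c_pos d(1,3) gap])
qed

text \<open>The schedule needs T(j+1) \<ge> K T(j)^d. The exponents d^j - 1 satisfy this, since 1 +
  (d^j - 1) d \<le> d^(j+1) - 1 for d \<ge> 2, and start at scale 1. The 2 in \<open>k + 2\<close>
  pays for the summand T(j) and for rounding down.\<close>

lemma ef_schedule_powr:
  fixes \<alpha> c d :: real and k :: nat
  defines "K \<equiv> (real k + 2) * (1 + 1 / c)"
  defines "T \<equiv> \<lambda>j. K powr (d ^ j - 1)"
  assumes \<alpha>: "\<alpha> > 0" and c: "0 < c" and d: "2 \<le> d"
    and gap: "\<And>t v e. 1 \<le> t \<Longrightarrow> real v \<le> t \<Longrightarrow> (v, e) \<noteq> (0, 0) \<Longrightarrow>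
       c * t powr (1 - d) \<le> \<bar>real v - \<alpha> * real e\<bar>"
  shows "ef_schedule \<alpha> (nat \<lfloor>T k\<rfloor>) k (\<lambda>j. nat \<lfloor>T j\<rfloor>) (\<lambda>j. c * T j powr (1 - d))"
proof
  have K: "K \<ge> 1"
  proof -
    have "1 * 1 \<le> (real k + 2) * (1 + 1 / c)" using c by (intro mult_mono) auto
    then show ?thesis by (simp add: K_def)
  qed
  have dj: "1 \<le> d ^ j" for j using d by simp
  have T1: "1 \<le> T j" for j
    unfolding T_def using K dj by (simp add: ge_one_powr_ge_zero)
  have Tnat: "1 \<le> nat \<lfloor>T j\<rfloor>" "real (nat \<lfloor>T j\<rfloor>) \<le> T j" "T j - 1 \<le> real (nat \<lfloor>T j\<rfloor>)" for j
  proof -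
    have "1 \<le> \<lfloor>T j\<rfloor>" using T1[of j] by (simp add: le_floor_iff)
    then show "1 \<le> nat \<lfloor>T j\<rfloor>" "real (nat \<lfloor>T j\<rfloor>) \<le> T j" "T j - 1 \<le> real (nat \<lfloor>T j\<rfloor>)"
      by linarith+
  qed
  show "\<alpha> > 0" by fact
  show "1 \<le> nat \<lfloor>T j\<rfloor> \<and> nat \<lfloor>T j\<rfloor> \<le> nat \<lfloor>T k\<rfloor>" if "j \<le> k" for j
  proof -
    have "d ^ j \<le> d ^ k" using d that by (intro power_increasing) auto
    then have "T j \<le> T k" unfolding T_def using K by (intro powr_mono) auto
    then show ?thesis using Tnat(1) by (simp add: floor_mono nat_mono)
  qed
  show "0 < c * T j powr (1 - d)" for j using c T1[of j] by simp
  show "c * T j powr (1 - d) \<le> \<bar>real v - \<alpha> * real e\<bar>"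
    if "v \<le> nat \<lfloor>T j\<rfloor>" "(v, e) \<noteq> (0, 0)" for j v e
    by (rule gap[OF T1]) (use that Tnat(2)[of j] in auto)
  show "real k * (1 + real (nat \<lfloor>T j\<rfloor>) / (c * T j powr (1 - d))) + real (nat \<lfloor>T j\<rfloor>) \<le> real (nat \<lfloor>T (Suc j)\<rfloor>)" for j
  proof -
    have pos: "T j > 0" using T1[of j] by simp
    have Td: "T j / (c * T j powr (1 - d)) = T j powr d / c"
      using pos by (simp add: powr_diff)
    have "T j powr 1 \<le> T j powr d" using T1[of j] d by (intro powr_mono) auto
    then have Tle: "T j \<le> T j powr d" "1 \<le> T j powr d" using T1[of j] by auto
    have "real k * (1 + real (nat \<lfloor>T j\<rfloor>) / (c * T j powr (1 - d))) + real (nat \<lfloor>T j\<rfloor>)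
        \<le> real k * (1 + T j / (c * T j powr (1 - d))) + T j"
      using Tnat(2)[of j] c pos by (intro add_mono mult_left_mono divide_right_mono) auto
    also have "\<dots> = real k + real k / c * T j powr d + T j" unfolding Td by (simp add: algebra_simps)
    also have "\<dots> \<le> K * T j powr d - 1"
    proof -
      have "real k * 1 \<le> real k * T j powr d" using Tle by (intro mult_left_mono) auto
      moreover have "0 \<le> 2 / c * T j powr d" using c by simp
      ultimately show ?thesis using Tle by (simp add: K_def algebra_simps add_divide_distrib)
    qed
    also have "K * T j powr d = K powr (1 + (d ^ j - 1) * d)"
      unfolding T_def powr_powr powr_add using K by simp
    also have "\<dots> \<le> T (Suc j)"
      unfolding T_def using K d by (intro powr_mono) (auto simp: algebra_simps)
    also have "T (Suc j) - 1 \<le> real (nat \<lfloor>T (Suc j)\<rfloor>)" by (rule Tnat(3))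
    finally show ?thesis by simp
  qed
qed

lemma eventually_powr_ln_le:
  fixes \<theta> l q C D :: real
  assumes \<theta>: "\<theta> < 1" and l: "l > 0" and q: "q > 0" and D: "D \<ge> 0"
  shows "eventually (\<lambda>y. C + D * (y powr \<theta> * ln ((ln y / l + 2) * q)) \<le> y / 2) at_top"
proof -
  \<comment> \<open>Half of the room below exponent 1 bounds the logarithm by a power y^s; the other
    half beats the constants, as \<theta> + s = 1 - s.\<close>
  define s where "s = (1 - \<theta>) / 2"
  have s: "s > 0" using \<theta> by (simp add: s_def)
  have "((\<lambda>y. q / l * (ln y / y) + 2 * q * (1 / y)) \<longlongrightarrow> q / l * 0 + 2 * q * 0) at_top"
    by (intro tendsto_intros) real_asymp+
  then have "eventually (\<lambda>y. q / l * (ln y / y) + 2 * q * (1 / y) < 1) at_top"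
    by (rule order_tendstoD) simp
  moreover have "eventually (\<lambda>y::real. y powr s \<ge> 4 * D / s) at_top"
    using real_powr_at_top[OF s] by (simp add: filterlim_at_top)
  moreover have "eventually (\<lambda>y::real. y \<ge> max 1 (4 * C)) at_top" by (rule eventually_ge_at_top)
  ultimately show ?thesis
  proof eventually_elim
    case (elim y)
    have y: "y \<ge> 1" "C \<le> y / 4" using elim(3) by auto
    have "(ln y / l + 2) * q \<le> y" using elim(1) y l by (simp add: field_simps)
    moreover have pos: "(ln y / l + 2) * q > 0" using y l q by (simp add: add_nonneg_pos)
    ultimately have "ln ((ln y / l + 2) * q) \<le> ln y" using y by (subst ln_le_cancel_iff) auto
    also have "ln y \<le> y powr s / s" by (rule ln_powr_bound[OF y(1) s])
    finally have "D * (y powr \<theta> * ln ((ln y / l + 2) * q)) \<le> D * (y powr \<theta> * (y powr s / s))"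
      using D by (intro mult_left_mono) auto
    also have "\<dots> = D / s * y powr (1 - s)"
    proof -
      have "\<theta> + s = 1 - s" by (simp add: s_def field_simps)
      then have "y powr \<theta> * y powr s = y powr (1 - s)" by (simp only: powr_add[symmetric])
      then show ?thesis by simp
    qed
    also have "\<dots> \<le> y powr s / 4 * y powr (1 - s)"
      using elim(2) by (intro mult_right_mono) (auto simp: field_simps)
    also have "\<dots> = y / 4" using y by (simp flip: powr_add)
    finally show ?case using y by linarith
  qed
qed

text \<open>With y = ln ln n, k \<le> ln y / \<open>ln d\<^sub>0\<close> makes d^k at most
  y^\<theta>, where \<theta> < 1 because \<open>d < d\<^sub>0\<close>. The left side then has
  logarithm O(y^\<theta> ln ln y) = o(y), and the right side is exp (y/2).\<close>

lemma eventually_schedule_bound: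
  fixes c d d\<^sub>0 C :: real
  assumes c: "c > 0" and d: "2 \<le> d" "d < d\<^sub>0" and C: "C > 0"
  shows "eventually (\<lambda>n :: nat. let k = nat \<lfloor>1 / ln d\<^sub>0 * ln (ln (ln (real n)))\<rfloor> in
    C * (((real k + 2) * (1 + 1 / c)) powr (d ^ k - 1)) powr (2 * d + 1) \<le> sqrt (ln (real n))) sequentially"
proof -
  define \<theta> where "\<theta> = ln d / ln d\<^sub>0"
  have lnd: "0 < ln d" "0 < ln d\<^sub>0" "ln d < ln d\<^sub>0" using d by auto
  have \<theta>: "\<theta> < 1" using lnd by (simp add: \<theta>_def)
  have flt: "filterlim (\<lambda>n. ln (ln (real n))) at_top sequentially" by real_asymp
  have "eventually (\<lambda>y. ln C + (2 * d + 1) * (y powr \<theta> * ln ((ln y / ln d\<^sub>0 + 2) * (1 + 1 / c))) \<le> y / 2) at_top"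
    by (rule eventually_powr_ln_le) (use \<theta> lnd c d in \<open>auto intro: add_pos_pos\<close>)
  then have "eventually (\<lambda>n. ln C + (2 * d + 1) * (ln (ln (real n)) powr \<theta> *
      ln ((ln (ln (ln (real n))) / ln d\<^sub>0 + 2) * (1 + 1 / c))) \<le> ln (ln (real n)) / 2) sequentially"
    by (rule eventually_compose_filterlim[OF _ flt])
  moreover have "eventually (\<lambda>n. ln (ln (real n)) \<ge> 1) sequentially"
    using flt by (simp add: filterlim_at_top)
  moreover have "eventually (\<lambda>n. ln (real n) > 0) sequentially" by real_asymp
  ultimately show ?thesis
  proof eventually_elim
    case (elim n)
    define y where "y = ln (ln (real n))"
    define k where "k = nat \<lfloor>1 / ln d\<^sub>0 * ln y\<rfloor>"
    define K where "K = (real k + 2) * (1 + 1 / c)"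
    define Q where "Q = (ln y / ln d\<^sub>0 + 2) * (1 + 1 / c)"
    have y: "y \<ge> 1" using elim(2) by (simp add: y_def)
    have k: "real k \<le> ln y / ln d\<^sub>0"
    proof -
      have "0 \<le> 1 / ln d\<^sub>0 * ln y" using y lnd by simp
      then have "real k \<le> 1 / ln d\<^sub>0 * ln y" unfolding k_def by linarith
      then show ?thesis by simp
    qed
    have K1: "1 \<le> K"
    proof -
      have "1 * 1 \<le> (real k + 2) * (1 + 1 / c)" using c by (intro mult_mono) auto
      then show ?thesis by (simp add: K_def)
    qed
    have KQ: "K \<le> Q" unfolding K_def Q_def using k c by (intro mult_right_mono) auto
    have "d ^ k = d powr real k" using d by (simp add: powr_realpow)
    also have "\<dots> \<le> d powr (ln y / ln d\<^sub>0)" using d k by (intro powr_mono) auto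
    also have "\<dots> = y powr \<theta>" using d y by (simp add: powr_def \<theta>_def)
    finally have dk: "d ^ k - 1 \<le> y powr \<theta>" by simp
    have "K powr (d ^ k - 1) \<le> K powr (y powr \<theta>)" using K1 dk by (intro powr_mono) auto
    also have "\<dots> \<le> Q powr (y powr \<theta>)" using K1 KQ by (intro powr_mono2) auto
    finally have "(K powr (d ^ k - 1)) powr (2 * d + 1) \<le> (Q powr (y powr \<theta>)) powr (2 * d + 1)"
      using d by (intro powr_mono2) auto
    also have "\<dots> = exp ((2 * d + 1) * (y powr \<theta> * ln Q))"
      using K1 KQ by (simp add: powr_powr powr_def mult_ac)
    finally have "C * (K powr (d ^ k - 1)) powr (2 * d + 1) \<le> C * exp ((2 * d + 1) * (y powr \<theta> * ln Q))"
      using C by simp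
    also have "\<dots> = exp (ln C + (2 * d + 1) * (y powr \<theta> * ln Q))" using C by (simp add: exp_add)
    also have "\<dots> \<le> exp (y / 2)" using elim(1) by (simp add: y_def Q_def)
    also have "\<dots> = sqrt (ln (real n))"
    proof (rule real_sqrt_unique[symmetric])
      show "(exp (y / 2))\<^sup>2 = ln (real n)" using elim(3) by (simp add: y_def flip: exp_double)
    qed simp
    finally show ?case unfolding Let_def K_def k_def y_def .
  qed
qed

lemma prob_pair_pmf_ge:
  assumes "measure_pmf.prob M (- A) \<le> x" "measure_pmf.prob N (- B) \<le> y" "A \<times> B \<subseteq> S"
  shows "1 - x - y \<le> measure_pmf.prob (pair_pmf M N) S"
proof -
  let ?P = "pair_pmf M N"
  have "measure_pmf.prob ?P (- S) \<le> measure_pmf.prob ?P (fst -` (- A) \<union> snd -` (- B))"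
  proof (rule measure_pmf.finite_measure_mono)
    show "- S \<subseteq> fst -` (- A) \<union> snd -` (- B)"
    proof
      fix z assume "z \<in> - S"
      then have "z \<notin> A \<times> B" using assms(3) by blast
      then show "z \<in> fst -` (- A) \<union> snd -` (- B)" by (auto simp: mem_Times_iff)
    qed
  qed simp
  also have "\<dots> \<le> measure_pmf.prob ?P (fst -` (- A)) + measure_pmf.prob ?P (snd -` (- B))"
    by (rule measure_Un_le) simp_all
  also have "measure_pmf.prob ?P (fst -` (- A)) = measure_pmf.prob (map_pmf fst ?P) (- A)"
    by (simp only: measure_map_pmf)
  also have "measure_pmf.prob ?P (snd -` (- B)) = measure_pmf.prob (map_pmf snd ?P) (- B)"
    by (simp only: measure_map_pmf)
  finally have "measure_pmf.prob ?P (- S) \<le> x + y"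
    using assms(1,2) by (simp add: map_fst_pair_pmf map_snd_pair_pmf)
  moreover have "measure_pmf.prob ?P (- S) = 1 - measure_pmf.prob ?P S"
    using measure_pmf.prob_compl[of S ?P] by (simp add: Compl_eq_Diff_UNIV)
  ultimately show ?thesis by linarith
qed

abbreviation dist_prob :: "nat \<Rightarrow> real \<Rightarrow> real \<Rightarrow> real" where
  "dist_prob n \<alpha> x \<equiv> measure_pmf.prob
     (pair_pmf (random_graph n (real n powr (- \<alpha>))) (random_graph n (real n powr (- \<alpha>))))
     {(G\<^sub>1, G\<^sub>2). ereal_of_enat (fo_distinguishability G\<^sub>1 G\<^sub>2) \<ge> ereal x}"

text \<open>Here b is about (10/c) \<tau>^d and \<delta> = c \<tau>^(1-d), so 22 b \<tau>^2 \<le>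
  (\<delta>/2) ln n becomes a bound on \<tau>^(2d+1). In \<open>big\<close> the term with 44 = 2 *
  22 serves this, and 2/c gives (\<delta>/2) ln n \<ge> sqrt (ln n), the exponent of the
  error.\<close>

lemma dist_prob_lower_bound:
  fixes \<alpha> c d :: real and n k :: nat
  defines "T \<equiv> ((real k + 2) * (1 + 1 / c)) powr (d ^ k - 1)"
  assumes \<alpha>: "\<alpha> > 0" and c: "0 < c" and d: "2 \<le> d" and n: "n \<ge> 2" and x: "x \<le> real k + 1"
    and gap: "\<And>t v e. 1 \<le> t \<Longrightarrow> real v \<le> t \<Longrightarrow> (v, e) \<noteq> (0, 0) \<Longrightarrow>
       c * t powr (1 - d) \<le> \<bar>real v - \<alpha> * real e\<bar>"
    and big: "(44 * (10 / c + 1) / c + 2 / c) * T powr (2 * d + 1) \<le> sqrt (ln (real n))"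
    and n1: "1 \<le> ln (real n)"
  shows "1 - 4 * exp (- sqrt (ln (real n))) \<le> dist_prob n \<alpha> x"
proof -
  define \<tau> where "\<tau> = nat \<lfloor>T\<rfloor>"
  define \<delta> where "\<delta> = c * real \<tau> powr (1 - d)"
  define b where "b = nat \<lceil>10 / c * real \<tau> powr d\<rceil>"
  interpret sched: ef_schedule \<alpha> \<tau> k "\<lambda>j. nat \<lfloor>((real k + 2) * (1 + 1 / c)) powr (d ^ j - 1)\<rfloor>"
    "\<lambda>j. c * (((real k + 2) * (1 + 1 / c)) powr (d ^ j - 1)) powr (1 - d)"
    unfolding \<tau>_def T_def by (rule ef_schedule_powr[OF \<alpha> c d gap])
  have \<tau>1: "\<tau> \<ge> 1" using sched.t[of k] by (simp add: \<tau>_def T_def)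
  then have \<tau>T: "real \<tau> \<le> T" unfolding \<tau>_def by linarith
  have \<delta>: "\<delta> > 0" using c \<tau>1 by (simp add: \<delta>_def)
  define s where "s = sqrt (ln (real n))"
  have s: "s \<ge> 1" "s * s = ln (real n)" using n1 by (auto simp: s_def)
  then have ss: "s \<le> s * s" by (metis mult_left_mono mult.right_neutral order_trans zero_le_one)
  have "real \<tau> powr (2 * d + 1) \<le> T powr (2 * d + 1)" using \<tau>T d by (intro powr_mono2) auto
  then have "(44 * (10 / c + 1) / c + 2 / c) * real \<tau> powr (2 * d + 1) \<le> (44 * (10 / c + 1) / c + 2 / c) * T powr (2 * d + 1)"
    using c by (intro mult_left_mono) auto
  then have big1: "44 * (10 / c + 1) / c * real \<tau> powr (2 * d + 1) + 2 / c * real \<tau> powr (2 * d + 1) \<le> s"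
    using big by (simp add: s_def algebra_simps)
  have nn: "0 \<le> 44 * (10 / c + 1) / c * real \<tau> powr (2 * d + 1)" "0 \<le> 2 / c * real \<tau> powr (2 * d + 1)"
    using c by auto
  have bigA: "44 * (10 / c + 1) / c * real \<tau> powr (2 * d + 1) \<le> s"
    and bigB: "2 / c * real \<tau> powr (2 * d + 1) \<le> s" using big1 nn by linarith+
  have \<tau>p: "1 \<le> real \<tau> powr y" if "y \<ge> 0" for y using \<tau>1 that by (simp add: ge_one_powr_ge_zero)
  have \<delta>ln: "\<delta> / 2 * ln (real n) = c / 2 * (s * s) / real \<tau> powr (d - 1)"
  proof -
    have "real \<tau> powr (1 - d) = 1 / real \<tau> powr (d - 1)"
      using powr_minus_divide[of "real \<tau>" "d - 1"] by simp
    then show ?thesis by (simp add: \<delta>_def s(2))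
  qed
  have lnS: "s \<le> \<delta> / 2 * ln (real n)"
  proof -
    have "real \<tau> powr (d - 1) \<le> real \<tau> powr (2 * d + 1)" using \<tau>1 d by (intro powr_mono) auto
    also have "\<dots> \<le> c / 2 * s" using bigB c by (simp add: field_simps)
    finally have "s * real \<tau> powr (d - 1) \<le> s * (c / 2 * s)" using s by (intro mult_left_mono) auto
    then show ?thesis unfolding \<delta>ln using \<tau>1 by (simp add: field_simps)
  qed
  have b_ge: "10 / c * real \<tau> powr d \<le> real b" unfolding b_def by linarith
  have "0 < 10 / c * real \<tau> powr d" using c \<tau>1 by simp
  then have b_le: "real b \<le> 10 / c * real \<tau> powr d + 1" unfolding b_def by linarith
  have b1: "b \<ge> 1" using b_ge \<open>0 < 10 / c * real \<tau> powr d\<close> by linarith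
  have ln_big: "real (22 * b * \<tau>\<^sup>2) * ln 2 \<le> \<delta> / 2 * ln (real n)"
  proof -
    have "real b \<le> (10 / c + 1) * real \<tau> powr d" using b_le \<tau>p[of d] d by (simp add: algebra_simps)
    then have "real b * real \<tau> powr 2 * real \<tau> powr (d - 1) \<le> (10 / c + 1) * real \<tau> powr d * real \<tau> powr 2 * real \<tau> powr (d - 1)"
      by (intro mult_right_mono) auto
    also have "\<dots> = (10 / c + 1) * real \<tau> powr (2 * d + 1)" 
      by (simp only: mult.assoc powr_add[symmetric]) (simp add: algebra_simps)
    also have "\<dots> \<le> c / 44 * s" using bigA c by (simp add: field_simps)
    also have "\<dots> \<le> c / 44 * (s * s)" using ss c by (intro mult_left_mono) auto
    finally have *: "real b * real \<tau> powr 2 * real \<tau> powr (d - 1) \<le> c / 44 * (s * s)" .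
    have "real (22 * b * \<tau>\<^sup>2) * ln 2 \<le> real (22 * b * \<tau>\<^sup>2) * 1" using ln_2_less_1 by (intro mult_left_mono) auto
    also have "\<dots> = 22 * (real b * real \<tau> powr 2)" using \<tau>1 by (simp add: powr_numeral)
    also have "\<dots> \<le> c / 2 * (s * s) / real \<tau> powr (d - 1)" using * \<tau>1 by (simp add: field_simps)
    finally show ?thesis unfolding \<delta>ln .
  qed
  interpret gp: gnp_params n \<tau> b \<alpha> \<delta>
  proof
    show "\<delta> \<le> \<bar>real v - \<alpha> * real e\<bar>" if "v \<le> \<tau>" "(v, e) \<noteq> (0, 0)" for v e :: nat
      unfolding \<delta>_def by (rule gap) (use that \<tau>1 in auto)
    have "10 * real \<tau> = \<delta> * (10 / c * real \<tau> powr d)"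
      using c \<tau>1 by (simp add: \<delta>_def mult_ac flip: powr_add)
    also have "\<dots> \<le> \<delta> * real b" using b_ge \<delta> by (intro mult_left_mono) auto
    finally show "10 * real \<tau> \<le> \<delta> * real b" .
    have "2 ^ (22 * b * \<tau>\<^sup>2) = exp (real (22 * b * \<tau>\<^sup>2) * ln 2)"
      by (simp only: exp_of_nat_mult) simp
    also have "\<dots> \<le> exp (\<delta> / 2 * ln (real n))" using ln_big by simp
    also have "\<dots> = real n powr (\<delta> / 2)" using n by (simp add: powr_def)
    finally show "2 ^ (22 * b * \<tau>\<^sup>2) \<le> real n powr (\<delta> / 2)" .
  qed (use n \<tau>1 \<alpha> \<delta> b1 in auto)
  have "real n powr (- \<delta> / 2) = exp (- (\<delta> / 2 * ln (real n)))" using n by (simp add: powr_def)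
  also have "\<dots> \<le> exp (- s)" using lnS by simp
  finally have bad: "measure_pmf.prob (random_graph n (real n powr (- \<alpha>))) (- {G. good_graph \<alpha> \<tau> n G}) \<le> 2 * exp (- s)"
    using gp.prob_not_good_graph by (simp add: Collect_neg_eq)
  have "1 - 2 * exp (- s) - 2 * exp (- s) \<le> dist_prob n \<alpha> x"
  proof (rule prob_pair_pmf_ge[OF bad bad], safe)
    fix G\<^sub>1 G\<^sub>2 assume "good_graph \<alpha> \<tau> n G\<^sub>1" "good_graph \<alpha> \<tau> n G\<^sub>2"
    then have "ereal_of_enat (enat (Suc k)) \<le> ereal_of_enat (fo_distinguishability G\<^sub>1 G\<^sub>2)"
      unfolding ereal_of_enat_le_iff by (rule sched.good_graphs_distinguishability)
    moreover have "ereal x \<le> ereal_of_enat (enat (Suc k))" using x by simp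
    ultimately show "ereal x \<le> ereal_of_enat (fo_distinguishability G\<^sub>1 G\<^sub>2)" by (rule order_trans[rotated])
  qed
  then show ?thesis by (simp add: s_def)
qed

lemma dist_prob_tendsto_1:
  fixes d\<^sub>0 \<alpha> :: real
  assumes "d\<^sub>0 > 2" "0 < \<alpha>" "\<alpha> \<notin> \<rat>" "irrationality_measure \<alpha> < ereal d\<^sub>0"
  shows "(\<lambda>n. dist_prob n \<alpha> (1 / ln d\<^sub>0 * ln (ln (ln (real n))))) \<longlonglongrightarrow> 1"
proof -
  obtain c d where c: "0 < c" and d: "2 \<le> d" "d < d\<^sub>0" and gap:
    "\<And>t v e. 1 \<le> t \<Longrightarrow> real v \<le> t \<Longrightarrow> (v, e) \<noteq> (0, 0) \<Longrightarrow>
       c * t powr (1 - d) \<le> \<bar>real v - \<alpha> * real e\<bar>"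
    using irrationality_measure_gap[OF assms] by blast
  have "0 < 44 * (10 / c + 1) / c + 2 / c" using c by (intro add_pos_pos divide_pos_pos) (auto intro: add_pos_pos)
  from eventually_schedule_bound[OF c d this]
  have ev: "eventually (\<lambda>n. 1 - 4 * exp (- sqrt (ln (real n))) \<le> dist_prob n \<alpha> (1 / ln d\<^sub>0 * ln (ln (ln (real n))))) sequentially"
    using eventually_ge_at_top[of "2::nat"] eventually_ge_at_top[of "nat \<lceil>exp (1 :: real)\<rceil>"]
  proof eventually_elim
    case (elim n)
    have "exp 1 \<le> real n" using elim(3) by linarith
    then have ln1: "1 \<le> ln (real n)" using elim(2) by (simp add: ln_ge_iff)
    let ?k = "nat \<lfloor>1 / ln d\<^sub>0 * ln (ln (ln (real n)))\<rfloor>"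
    \<comment> \<open>Here the successor from the game makes up for the floor.\<close>
    have "1 / ln d\<^sub>0 * ln (ln (ln (real n))) \<le> real ?k + 1" by linarith
    then show ?case
      using dist_prob_lower_bound[OF assms(2) c d(1) elim(2) _ gap elim(1)[unfolded Let_def] ln1] by simp
  qed
  have lim: "(\<lambda>n. 1 - 4 * exp (- sqrt (ln (real n)))) \<longlonglongrightarrow> 1" by real_asymp
  show ?thesis
    by (rule tendsto_sandwich[OF ev always_eventually lim tendsto_const]) simp
qed

section \<open>Almost every exponent\<close>

text \<open>Borel-Cantelli: denominator q has O(q) relevant numerators and intervals of length 2
  q^(-d), in total O(q^(1-d)), which is summable exactly for d > 2.\<close>

lemma AE_finite_approximations:
  fixes d :: real
  assumes d: "d > 2"
  shows "AE \<alpha> in (lebesgue :: real measure). 0 < \<alpha> \<and> \<alpha> < 1 \<longrightarrow>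
    finite {(p :: int, q :: int). q > 0 \<and> \<bar>\<alpha> - real_of_int p / real_of_int q\<bar> \<le> real_of_int q powr (- d)}"
proof -
  define B where "B q p = {real_of_int p / real q - real q powr (- d) .. real_of_int p / real q + real q powr (- d)}"
    for q :: nat and p :: int
  \<comment> \<open>For \<alpha> in (0,1) an approximation has error at most 1, which confines p to
    this range.\<close>
  define A where "A q = (\<Union>p\<in>{- int q..2 * int q}. B q p)" for q :: nat
  have A_sets: "A q \<in> sets lebesgue" for q unfolding A_def B_def by (intro sets.finite_UN) auto
  have A_le: "emeasure lebesgue (A q) \<le> ennreal ((3 * real q + 1) * (2 * real q powr (- d)))" for q
  proof -
    have "emeasure lebesgue (A q) \<le> (\<Sum>p\<in>{- int q..2 * int q}. emeasure lebesgue (B q p))"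
      unfolding A_def B_def by (intro emeasure_subadditive_finite) auto
    also have "\<dots> = (\<Sum>p\<in>{- int q..2 * int q}. ennreal (2 * real q powr (- d)))"
      unfolding B_def by (intro sum.cong refl) simp
    also have "\<dots> = ennreal ((3 * real q + 1) * (2 * real q powr (- d)))"
      by (simp add: ennreal_mult' ennreal_of_nat_eq_real_of_nat flip: ennreal_mult)
    finally show ?thesis .
  qed
  have fin: "emeasure lebesgue (A q) < \<infinity>" for q
    using A_le[of q] by (rule le_less_trans) simp
  have meas: "measure lebesgue (A q) \<le> 8 * real q powr (1 - d)" for q
  proof (cases "q = 0")
    case True
    have "emeasure lebesgue (A q) \<le> 0" using A_le[of q] True by simp
    then show ?thesis by (simp add: measure_def True)
  next
    case False
    have "measure lebesgue (A q) \<le> (3 * real q + 1) * (2 * real q powr (- d))"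
      unfolding measure_def using A_le[of q] by (intro enn2real_leI) auto
    also have "\<dots> \<le> (4 * real q) * (2 * real q powr (- d))"
      using False by (intro mult_right_mono) auto
    also have "\<dots> = 8 * real q powr (1 - d)"
      using False by (simp add: powr_diff powr_minus divide_inverse)
    finally show ?thesis .
  qed
  have "summable (\<lambda>q. 8 * real q powr (1 - d))"
    using d by (intro summable_mult) (simp add: summable_real_powr_iff)
  then have "summable (\<lambda>q. measure lebesgue (A q))"
    by (rule summable_comparison_test'[where N = 0]) (use meas in auto)
  from borel_cantelli_AE1[OF A_sets fin this]
  have "AE \<alpha> in lebesgue. eventually (\<lambda>q. \<alpha> \<in> space lebesgue - A q) sequentially" .
  then show ?thesis
  proof eventually_elim
    case (elim \<alpha>)
    show ?case
    proof
      assume \<alpha>: "0 < \<alpha> \<and> \<alpha> < 1"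
      obtain N where N: "\<And>q. q \<ge> N \<Longrightarrow> \<alpha> \<notin> A q" using elim by (auto simp: eventually_sequentially)
      let ?S = "{(p :: int, q :: int). q > 0 \<and> \<bar>\<alpha> - real_of_int p / real_of_int q\<bar> \<le> real_of_int q powr (- d)}"
      have "?S \<subseteq> {- int N..2 * int N} \<times> {0..int N}"
      proof safe
        fix p q :: int assume q: "q > 0" and le: "\<bar>\<alpha> - real_of_int p / real_of_int q\<bar> \<le> real_of_int q powr (- d)"
        have "real_of_int q powr (- d) \<le> real_of_int q powr 0" using q d by (intro powr_mono) auto
        then have "\<bar>\<alpha> - real_of_int p / real_of_int q\<bar> \<le> 1" using le q by simp
        then have "real_of_int q * \<bar>\<alpha> - real_of_int p / real_of_int q\<bar> \<le> real_of_int q * 1"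
          using q by (intro mult_left_mono) auto
        then have "\<bar>real_of_int q * (\<alpha> - real_of_int p / real_of_int q)\<bar> \<le> real_of_int q"
          using q by (simp add: abs_mult)
        then have "\<bar>\<alpha> * real_of_int q - real_of_int p\<bar> \<le> real_of_int q" using q by (simp add: algebra_simps)
        moreover have "0 \<le> \<alpha> * real_of_int q" "\<alpha> * real_of_int q \<le> real_of_int q" using \<alpha> q by auto
        ultimately have p: "- q \<le> p" "p \<le> 2 * q" by linarith+
        have "\<alpha> \<in> A (nat q)"
          unfolding A_def B_def using q p le by (intro UN_I[of p]) (auto simp: abs_le_iff)
        then have qN: "q < int N" using N[of "nat q"] by linarith
        show "p \<in> {- int N..2 * int N}" "q \<in> {0..int N}" using p q qN by auto
      qed
      then show "finite ?S" by (rule finite_subset) simp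
    qed
  qed
qed

lemma AE_irrationality_measure_le_2:
  "AE \<alpha> in (lebesgue :: real measure). 0 < \<alpha> \<and> \<alpha> < 1 \<longrightarrow> irrationality_measure \<alpha> \<le> 2"
proof -
  have "AE \<alpha> in (lebesgue :: real measure). \<forall>i :: nat. 0 < \<alpha> \<and> \<alpha> < 1 \<longrightarrow>
    finite {(p :: int, q :: int). q > 0 \<and>
      \<bar>\<alpha> - real_of_int p / real_of_int q\<bar> \<le> real_of_int q powr (- (2 + 1 / (real i + 1)))}"
    unfolding AE_all_countable by (intro allI AE_finite_approximations) simp
  then show ?thesis
  proof eventually_elim
    case (elim \<alpha>)
    show ?case
    proof
      assume \<alpha>: "0 < \<alpha> \<and> \<alpha> < 1"
      have le: "irrationality_measure \<alpha> \<le> ereal (2 + 1 / (real i + 1))" for i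
        unfolding irrationality_measure_def
        using elim[rule_format, OF \<alpha>, of i] by (intro Inf_lower CollectI exI[of _ "2 + 1 / (real i + 1)"]) (auto intro: add_pos_pos)
      have "(\<lambda>i. ereal (2 + 1 / (real i + 1))) \<longlonglongrightarrow> ereal 2"
        unfolding lim_ereal by real_asymp
      then have "irrationality_measure \<alpha> \<le> ereal 2"
        by (rule LIMSEQ_le_const) (use le in auto)
      then show "irrationality_measure \<alpha> \<le> 2" by simp
    qed
  qed
qed

text \<open>Turns convergence for every fixed parameter into convergence along a parameter growing
  slowly with n: the largest i \<le> n whose threshold \<open>N i\<close> is already passed.\<close>

lemma diagonal_tendsto:
  fixes a :: "nat \<Rightarrow> nat \<Rightarrow> real"
  assumes a: "\<And>i. a i \<longlonglongrightarrow> l"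
  obtains \<iota> where "filterlim \<iota> at_top sequentially" "(\<lambda>n. a (\<iota> n) n) \<longlonglongrightarrow> l"
proof -
  have "\<exists>N. \<forall>n\<ge>N. dist (a i n) l < 1 / (real i + 1)" for i
    using a[of i] unfolding lim_sequentially by simp
  then obtain N where N: "\<And>i n. n \<ge> N i \<Longrightarrow> dist (a i n) l < 1 / (real i + 1)" by metis
  define \<iota> where "\<iota> n = Max (insert 0 {i. i \<le> n \<and> N i \<le> n})" for n
  have fin: "finite (insert 0 {i. i \<le> n \<and> N i \<le> n})" for n by simp
  have ge: "i \<le> \<iota> n" if "i \<le> n" "N i \<le> n" for i n
    unfolding \<iota>_def by (rule Max_ge[OF fin]) (use that in simp)
  have N\<iota>: "N (\<iota> n) \<le> n" if "N 0 \<le> n" for n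
    using Max_in[OF fin[of n]] that unfolding \<iota>_def[symmetric] by auto
  have lim: "filterlim \<iota> at_top sequentially"
    unfolding filterlim_at_top eventually_sequentially
    using ge by (metis max.bounded_iff order_refl)
  have lim0: "(\<lambda>n. 1 / (real (\<iota> n) + 1)) \<longlonglongrightarrow> 0"
  proof -
    have "(\<lambda>i. 1 / (real i + 1)) \<longlonglongrightarrow> 0" by real_asymp
    from filterlim_compose[OF this lim] show ?thesis .
  qed
  have ev: "eventually (\<lambda>n. dist (a (\<iota> n) n) l \<le> 1 / (real (\<iota> n) + 1)) sequentially"
    using eventually_ge_at_top[of "N 0"] by eventually_elim (use N N\<iota> less_imp_le in blast)
  have "(\<lambda>n. dist (a (\<iota> n) n) l) \<longlonglongrightarrow> 0"
    by (rule tendsto_sandwich[OF always_eventually ev tendsto_const lim0]) simp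
  then have "(\<lambda>n. a (\<iota> n) n) \<longlonglongrightarrow> l" by (rule tendsto_dist_iff[THEN iffD2])
  with lim show thesis by (rule that)
qed

theorem theorem4:
  "(\<forall>d\<^sub>0 \<alpha> :: real.
      d\<^sub>0 > 2 \<and> 0 < \<alpha> \<and> \<alpha> < 1 \<and> \<alpha> \<notin> \<rat> \<and> irrationality_measure \<alpha> < ereal d\<^sub>0 \<longrightarrow>
      (\<lambda>n. measure_pmf.prob
             (pair_pmf (random_graph n (real n powr (- \<alpha>))) (random_graph n (real n powr (- \<alpha>))))
             {(G\<^sub>1, G\<^sub>2). ereal_of_enat (fo_distinguishability G\<^sub>1 G\<^sub>2)
                           \<ge> ereal (1 / ln d\<^sub>0 * ln (ln (ln (real n))))})
        \<longlonglongrightarrow> 1)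
   \<and>
   (AE \<alpha> in (lebesgue :: real measure).
      0 < \<alpha> \<and> \<alpha> < 1 \<and> \<alpha> \<notin> \<rat> \<longrightarrow>
      (\<exists>\<epsilon> :: nat \<Rightarrow> real. \<epsilon> \<longlonglongrightarrow> 0 \<and>
        (\<lambda>n. measure_pmf.prob
               (pair_pmf (random_graph n (real n powr (- \<alpha>))) (random_graph n (real n powr (- \<alpha>))))
               {(G\<^sub>1, G\<^sub>2). ereal_of_enat (fo_distinguishability G\<^sub>1 G\<^sub>2)
                             \<ge> ereal ((1 - \<epsilon> n) / ln 2 * ln (ln (ln (real n))))})
          \<longlonglongrightarrow> 1))"
proof (intro conjI allI impI)
  fix d\<^sub>0 \<alpha> :: real
  assume "d\<^sub>0 > 2 \<and> 0 < \<alpha> \<and> \<alpha> < 1 \<and> \<alpha> \<notin> \<rat> \<and> irrationality_measure \<alpha> < ereal d\<^sub>0"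
  then show "(\<lambda>n. dist_prob n \<alpha> (1 / ln d\<^sub>0 * ln (ln (ln (real n))))) \<longlonglongrightarrow> 1"
    by (intro dist_prob_tendsto_1) auto
next
  show "AE \<alpha> in (lebesgue :: real measure). 0 < \<alpha> \<and> \<alpha> < 1 \<and> \<alpha> \<notin> \<rat> \<longrightarrow>
      (\<exists>\<epsilon> :: nat \<Rightarrow> real. \<epsilon> \<longlonglongrightarrow> 0 \<and>
        (\<lambda>n. dist_prob n \<alpha> ((1 - \<epsilon> n) / ln 2 * ln (ln (ln (real n))))) \<longlonglongrightarrow> 1)"
    using AE_irrationality_measure_le_2
  proof eventually_elim
    case (elim \<alpha>)
    show ?case
    proof
      assume \<alpha>: "0 < \<alpha> \<and> \<alpha> < 1 \<and> \<alpha> \<notin> \<rat>"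
      define D where "D i = 2 + 1 / (real i + 1)" for i :: nat
      have "(\<lambda>n. dist_prob n \<alpha> (1 / ln (D i) * ln (ln (ln (real n))))) \<longlonglongrightarrow> 1" for i
      proof (rule dist_prob_tendsto_1)
        have "irrationality_measure \<alpha> \<le> ereal 2" using elim \<alpha> by simp
        also have "ereal 2 < ereal (D i)" by (simp add: D_def)
        finally show "irrationality_measure \<alpha> < ereal (D i)" .
      qed (use \<alpha> in \<open>auto simp: D_def\<close>)
      then obtain \<iota> where \<iota>: "filterlim \<iota> at_top sequentially"
        "(\<lambda>n. dist_prob n \<alpha> (1 / ln (D (\<iota> n)) * ln (ln (ln (real n))))) \<longlonglongrightarrow> 1"
        using diagonal_tendsto[of "\<lambda>i n. dist_prob n \<alpha> (1 / ln (D i) * ln (ln (ln (real n))))" 1] by blast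
      \<comment> \<open>Solves (1 - \<epsilon>)/ln 2 = 1/ln D; it tends to 0 because D decreases to
        2 along \<iota>.\<close>
      define \<epsilon> where "\<epsilon> n = 1 - ln 2 / ln (D (\<iota> n))" for n
      have "(\<lambda>i. 1 - ln 2 / ln (D i)) \<longlonglongrightarrow> 0" unfolding D_def by real_asymp
      from filterlim_compose[OF this \<iota>(1)] have "\<epsilon> \<longlonglongrightarrow> 0" unfolding \<epsilon>_def[abs_def] .
      moreover have "(1 - \<epsilon> n) / ln 2 = 1 / ln (D (\<iota> n))" for n by (simp add: \<epsilon>_def)
      ultimately show "\<exists>\<epsilon>. \<epsilon> \<longlonglongrightarrow> 0 \<and>
          (\<lambda>n. dist_prob n \<alpha> ((1 - \<epsilon> n) / ln 2 * ln (ln (ln (real n))))) \<longlonglongrightarrow> 1"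
        using \<iota>(2) by (intro exI[of _ \<epsilon>]) simp
    qed
  qed
qed

end
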